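(* Consider a triangulated closed connected orientable piecewise-linear four-dimensional manifold $M$ with the vertices of its universal cover placed in $\mathbb R^4$ as described in the context, and assume that $$\operatorname{Ker}\left(\frac{\partial\Omega_a}{\partial S_i}\right)\subset\operatorname{Im}\left(\frac{\partial S_i}{\partial\vec v_a}\right).$$ Then under a move $2\to4$, replacing two adjoining 4-simplices $ACDEF$ and $BCDFE$ by the four 4-simplices $ABCDE$, $ABCFD$, $ABCEF$, $ABDFE$ and thereby adding the edge $AB$, the expression $$\frac{\prod_{i} S_i}{\prod V}\cdot\frac{\bigwedge_{\overline{\mathcal C}}dL\cdot\bigwedge_{\overline{\mathcal D}}dS}{\det\mathcal B}$$ (the invariant of moves $3\to3$) gets multiplied by $$\pm72\,L_{AB}^{5/2}\,dv_x\wedge dv_y\wedge dv_z,$$ where $dv_x,dv_y,dv_z$ are the components of the deviation $d\vec v_{AB}$ of the added edge $AB$.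
   Context: Setting. The vertices of the universal cover of the triangulation of $M$ are mapped to Euclidean space $\mathbb R^4$ generically and compatibly with the deck group, i.e. equivariantly with respect to a homomorphism from $\pi_1(M)$ to the group of motions of $\mathbb R^4$, so that all 4-simplices (before and after the move) are nondegenerate and the metric quantities below are well defined for the simplices of $M$. The move does not change the vertices or their placement. The index $a$ runs over the edges and $i$ over the two-dimensional faces of the triangulation of $M$. $L_a$ is the squared length of edge $a$, $S_i$ the area of face $i$, and $V$ the 4-volume of a 4-simplex. Fix an orientation of $M$; each 4-simplex gets the sign $+$ or $-$ according to whether its image in $\mathbb R^4$ has the orientation induced from $M$ or the opposite one. Deficit angles around faces. $\omega_i$ is minus the algebraic sum (modulo $2\pi$) of the dihedral angles at the two-dimensional face $i$ of all 4-simplices containing it, each dihedral angle being taken with the sign of its 4-simplex and regarded as a function of the squared edge lengths of that 4-simplex. The matrix $(\partial\omega_i/\partial L_a)$ is computed at the values given by the placement in $\mathbb R^4$, all $L_a$ being regarded as independent variables. The map $(\partial\Omega_a/\partial S_i)$. It takes columns $(dS_i)$ of independent area differentials to columns $(d\Omega_a)$ of differentials of deficit angles around edges. Its matrix is the transpose of the matrix $(\partial\omega_i/\partial L_a)$: $\partial\Omega_a/\partial S_i=\partial\omega_i/\partial L_a$. Edge deviations and the map $(\partial S_i/\partial\vec v_a)$. A deviation of an edge $AB$ is an infinitesimal vector $d\vec v_{AB}\in\mathbb R^4$ orthogonal to $AB$, imagined as starting at the midpoint of $AB$ (using a lift to the universal cover); it has three components $dv_x,dv_y,dv_z$ in an orthonormal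 basis of the orthogonal complement of $AB$. For a triangle $ABC$ with edge deviations $d\vec v_{AB},d\vec v_{BC},d\vec v_{CA}$, let $C',A',B'$ be the endpoints of these vectors drawn from the midpoints of $AB,BC,CA$ respectively; the generated area differential is, to first order, $dS_{ABC}=4S_{A'B'C'}-S_{ABC}$. The resulting linear map from all edge deviations to $(dS_i)$ is $(\partial S_i/\partial\vec v_a)$. It is known that $\operatorname{Im}(\partial S_i/\partial\vec v_a)\subset\operatorname{Ker}(\partial\Omega_a/\partial S_i)$. The expression. $\mathcal C$ is a subset of the set of edges and $\mathcal D$ a subset of the set of two-dimensional faces such that the submatrix $\mathcal B={}_{\mathcal D}(\partial\omega_i/\partial L_a)_{\mathcal C}$ (rows from $\mathcal D$, columns from $\mathcal C$) is square, nondegenerate and of maximal size, i.e. of size equal to the rank of $(\partial\omega_i/\partial L_a)$; $\overline{\mathcal C},\overline{\mathcal D}$ are the complements. $\prod_iS_i$ is over all two-dimensional faces and $\prod V$ over all 4-simplices. $\bigwedge_{\overline{\mathcal C}}dL$ is regarded as a top-degree form on $\operatorname{Ker}(\partial\omega_i/\partial L_a)$ and $\bigwedge_{\overline{\mathcal D}}dS$ as a top-degree form on $\operatorname{Ker}(\partial\Omega_a/\partial S_i)$. Up to sign the expression does not depend on the choice of $\mathcal C$ and $\mathcal D$. Meaning of "gets multiplied". Under the assumed inclusion the area form is expressed through edge deviations: before the move one chooses a set $\mathcal V$ of components of edge deviations such that the corresponding columns of $(\partial S_i/\partial\vec v_a)$ form a basis of $\operatorname{Ker}(\partial\Omega_a/\partial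 S_i)$, and writes $\bigwedge_{\overline{\mathcal D}}dS$ as a multiple of the exterior product of the components in $\mathcal V$; after the move one uses the set $\mathcal V$ supplemented with $dv_x,dv_y,dv_z$, the components of the new deviation $d\vec v_{AB}$. The $dL$-forms before and after the move are identified via the isomorphism between the kernels of $(\partial\omega_i/\partial L_a)$ after and before the move obtained by forgetting the component $dL_{AB}$. The product with $dv_x\wedge dv_y\wedge dv_z$ is the exterior product with the form in the area (deviation) variables. *)

theory Defs
  imports "HOL-Analysis.Analysis" "Jordan_Normal_Form.DL_Rank"
begin

section \<open>Triangulated PL manifolds\<close>

definition abstract_complex :: "'v set set \<Rightarrow> bool" where
  "abstract_complex K \<longleftrightarrow>
     (\<forall>s\<in>K. finite s \<and> s \<noteq> {}) \<and>
     (\<forall>s\<in>K. \<forall>t. t \<subseteq> s \<and> t \<noteq> {} \<longrightarrow> t \<in> K) \<and>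
     (\<forall>v. {v} \<in> K)"

definition realization :: "'v::finite set set \<Rightarrow> (real^'v) set" where
  "realization K = (\<Union>s\<in>K. convex hull ((\<lambda>v. axis v 1) ` s))"

definition compact_polyhedron :: "'a::real_vector set \<Rightarrow> bool" where
  "compact_polyhedron S \<longleftrightarrow> (\<exists>F. finite F \<and> (\<forall>P\<in>F. polytope P) \<and> S = \<Union>F)"

text \<open>A map between compact polyhedra is piecewise linear iff its graph is a compact polyhedron.\<close>

definition pl_homeomorphism ::
    "('a::real_vector \<Rightarrow> 'b::real_vector) \<Rightarrow> 'a set \<Rightarrow> 'b set \<Rightarrow> bool" where
  "pl_homeomorphism f S T \<longleftrightarrow>
     bij_betw f S T \<and> compact_polyhedron ((\<lambda>x. (x, f x)) ` S)"

definition closed_pl_4manifold :: "'a::euclidean_space set \<Rightarrow> bool" where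
  "closed_pl_4manifold S \<longleftrightarrow>
     compact_polyhedron S \<and> S \<noteq> {} \<and>
     (\<forall>x\<in>S. \<exists>U N (Q :: (real^4) set) f.
        open U \<and> x \<in> U \<and> U \<inter> S \<subseteq> N \<and> N \<subseteq> S \<and>
        polytope Q \<and> pl_homeomorphism f N Q \<and> f x \<in> interior Q)"

text \<open>An orientation assigns a sign to each ordering of the vertices of each 4-simplex. It is
  alternating, and two 4-simplices sharing a 3-face induce opposite orientations on that face.\<close>

definition orientation :: "'v set set \<Rightarrow> ('v list \<Rightarrow> real) \<Rightarrow> bool" where
  "orientation K sg \<longleftrightarrow>
     (\<forall>xs. distinct xs \<and> length xs = 5 \<and> set xs \<in> K \<longrightarrow>
        sg xs \<in> {1, -1} \<and>
        (\<forall>i<5. \<forall>j<5. i \<noteq> j \<longrightarrow> sg (xs[i := xs ! j, j := xs ! i]) = - sg xs)) \<and>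
     (\<forall>x y ts. length ts = 4 \<and> x \<noteq> y \<and> distinct (x # ts) \<and> distinct (y # ts) \<and>
        set (x # ts) \<in> K \<and> set (y # ts) \<in> K \<longrightarrow> sg (x # ts) = - sg (y # ts))"


section \<open>Universal covers\<close>

definition edge_path :: "'u set set \<Rightarrow> 'u list \<Rightarrow> bool" where
  "edge_path K xs \<longleftrightarrow> xs \<noteq> [] \<and> (\<forall>i. Suc i < length xs \<longrightarrow> {xs ! i, xs ! Suc i} \<in> K)"

definition edge_path_moves :: "'u set set \<Rightarrow> ('u list \<times> 'u list) set" where
  "edge_path_moves K =
     {(xs @ [x, y, z] @ ys, xs @ [x, z] @ ys) | xs ys x y z. {x, y, z} \<in> K} \<union>
     {(xs @ [x, x] @ ys, xs @ [x] @ ys) | xs ys x. True}"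

definition simply_connected_complex :: "'u set set \<Rightarrow> bool" where
  "simply_connected_complex K \<longleftrightarrow>
     (\<forall>u w. \<exists>xs. edge_path K xs \<and> hd xs = u \<and> last xs = w) \<and>
     (\<forall>xs. edge_path K xs \<and> hd xs = last xs \<longrightarrow>
        (xs, [hd xs]) \<in> (edge_path_moves K \<union> (edge_path_moves K)\<inverse>)\<^sup>*)"

text \<open>The data: a triangulation of the manifold, the induced triangulation of its universal cover
  with the covering projection on vertices, the positions of the vertices of the cover
  in \<open>\<real>\<^sup>4\<close>, and an orientation of the manifold.\<close>

record ('v, 'u) placed_complex =
  simplices :: "'v set set"
  cover :: "'u set set"
  proj :: "'u \<Rightarrow> 'v"
  place :: "'u \<Rightarrow> real^4"
  orient :: "'v list \<Rightarrow> real"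

definition deck_group :: "('v, 'u) placed_complex \<Rightarrow> ('u \<Rightarrow> 'u) set" where
  "deck_group X = {g. bij g \<and> proj X \<circ> g = proj X \<and> (\<forall>t. g ` t \<in> cover X \<longleftrightarrow> t \<in> cover X)}"

text \<open>The last condition, transitivity of the deck group on fibres, follows from the others; it is
  listed for convenience.\<close>

definition universal_cover :: "('v, 'u) placed_complex \<Rightarrow> bool" where
  "universal_cover X \<longleftrightarrow>
     abstract_complex (cover X) \<and> simply_connected_complex (cover X) \<and> surj (proj X) \<and>
     (\<forall>t\<in>cover X. inj_on (proj X) t \<and> proj X ` t \<in> simplices X) \<and>
     (\<forall>s\<in>simplices X. \<forall>u. proj X u \<in> s \<longrightarrow> (\<exists>!t. t \<in> cover X \<and> u \<in> t \<and> proj X ` t = s)) \<and>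
     (\<forall>u w. proj X u = proj X w \<longrightarrow> (\<exists>g\<in>deck_group X. g u = w))"

text \<open>Only orientation-preserving motions are admitted: otherwise the signs of the 4-simplices of
  the manifold would depend on the choice of lifts.\<close>

definition motion :: "(real^4 \<Rightarrow> real^4) \<Rightarrow> bool" where
  "motion m \<longleftrightarrow> (\<exists>R b. rotation_matrix R \<and> m = (\<lambda>x. R *v x + b))"

definition equivariant_placement ::
    "('v, 'u) placed_complex \<Rightarrow> (('u \<Rightarrow> 'u) \<Rightarrow> real^4 \<Rightarrow> real^4) \<Rightarrow> bool" where
  "equivariant_placement X \<rho> \<longleftrightarrow>
     (\<forall>g\<in>deck_group X. motion (\<rho> g) \<and> (\<forall>u. place X (g u) = \<rho> g (place X u))) \<and>
     (\<forall>g\<in>deck_group X. \<forall>h\<in>deck_group X. \<rho> (g \<circ> h) = \<rho> g \<circ> \<rho> h)"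

definition nondegenerate :: "('v, 'u) placed_complex \<Rightarrow> bool" where
  "nondegenerate X \<longleftrightarrow>
     (\<forall>t\<in>cover X. card t = 5 \<longrightarrow>
        inj_on (place X) t \<and> \<not> affine_dependent (place X ` t))"


section \<open>Metric quantities\<close>

definition edges :: "('v, 'u) placed_complex \<Rightarrow> 'v set set" where
  "edges X = {a \<in> simplices X. card a = 2}"

definition faces :: "('v, 'u) placed_complex \<Rightarrow> 'v set set" where
  "faces X = {i \<in> simplices X. card i = 3}"

definition four_simplices :: "('v, 'u) placed_complex \<Rightarrow> 'v set set" where
  "four_simplices X = {s \<in> simplices X. card s = 5}"

definition lift :: "('v, 'u) placed_complex \<Rightarrow> 'v set \<Rightarrow> 'u set" where
  "lift X s = (SOME t. t \<in> cover X \<and> proj X ` t = s)"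

definition sq_length :: "('v, 'u) placed_complex \<Rightarrow> 'v set \<Rightarrow> real" where
  "sq_length X a = (THE l. \<exists>u w. lift X a = {u, w} \<and> u \<noteq> w \<and>
     l = (dist (place X u) (place X w))\<^sup>2)"

definition triangle_area :: "real^4 \<Rightarrow> real^4 \<Rightarrow> real^4 \<Rightarrow> real" where
  "triangle_area a b c =
     sqrt ((norm (b - a))\<^sup>2 * (norm (c - a))\<^sup>2 - ((b - a) \<bullet> (c - a))\<^sup>2) / 2"

definition face_area :: "('v, 'u) placed_complex \<Rightarrow> 'v set \<Rightarrow> real" where
  "face_area X i = (THE s. \<exists>u v w. lift X i = {u, v, w} \<and> distinct [u, v, w] \<and>
     s = triangle_area (place X u) (place X v) (place X w))"

definition simplex_volume :: "('v, 'u) placed_complex \<Rightarrow> 'v set \<Rightarrow> real" where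
  "simplex_volume X s = measure lebesgue (convex hull (place X ` lift X s))"

definition simplex_sign :: "('v, 'u) placed_complex \<Rightarrow> 'v set \<Rightarrow> real" where
  "simplex_sign X s =
     (let xs = (SOME xs. distinct xs \<and> set xs = s);
          q = (\<lambda>k. place X (the_inv_into (lift X s) (proj X) (xs ! k)))
      in orient X xs *
         sgn (Determinants.det (vector [q 1 - q 0, q 2 - q 0, q 3 - q 0, q 4 - q 0] :: real^4^4)))"

text \<open>Angle at the triangle with vertex set \<open>P\<close> between its joins with \<open>x\<close> and with \<open>y\<close>, i.e.
  between the perpendiculars dropped from \<open>x\<close> and \<open>y\<close> onto the plane of the triangle.\<close>

definition dihedral_angle :: "(real^4) set \<Rightarrow> real^4 \<Rightarrow> real^4 \<Rightarrow> real" where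
  "dihedral_angle P x y =
     (let h = (\<lambda>z. z - closest_point (affine hull P) z)
      in arccos (h x \<bullet> h y / (norm (h x) * norm (h y))))"

text \<open>The dihedral angle at the 2-face \<open>i\<close> of the 4-simplex \<open>s\<close> as a function of the squared edge
  lengths \<open>l\<close>: the angle in any 4-simplex \<open>q\<close> of \<open>\<real>\<^sup>4\<close> having these squared edge lengths.\<close>

definition dihedral_of_lengths :: "'v set \<Rightarrow> 'v set \<Rightarrow> ('v set \<Rightarrow> real) \<Rightarrow> real" where
  "dihedral_of_lengths s i l = (THE \<theta>. \<exists>(q :: 'v \<Rightarrow> real^4) d e.
     (\<forall>x\<in>s. \<forall>y\<in>s. x \<noteq> y \<longrightarrow> (dist (q x) (q y))\<^sup>2 = l {x, y}) \<and>
     d \<noteq> e \<and> s - i = {d, e} \<and> \<theta> = dihedral_angle (q ` i) (q d) (q e))"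

text \<open>A real representative of the deficit angle, which is defined modulo \<open>2\<pi>\<close>.\<close>

definition deficit :: "('v, 'u) placed_complex \<Rightarrow> 'v set \<Rightarrow> ('v set \<Rightarrow> real) \<Rightarrow> real" where
  "deficit X i l =
     - (\<Sum>s | s \<in> four_simplices X \<and> i \<subseteq> s. simplex_sign X s * dihedral_of_lengths s i l)"

definition d_omega_d_L :: "('v, 'u) placed_complex \<Rightarrow> 'v set \<Rightarrow> 'v set \<Rightarrow> real" where
  "d_omega_d_L X i a =
     deriv (\<lambda>x. deficit X i ((sq_length X)(a := x))) (sq_length X a)"

definition d_Omega_d_S :: "('v, 'u) placed_complex \<Rightarrow> 'v set \<Rightarrow> 'v set \<Rightarrow> real" where
  "d_Omega_d_S X a i = d_omega_d_L X i a"

text \<open>Vectors indexed by the edges (faces) are functions vanishing off the edges (faces).\<close>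

definition ker_omega_L :: "('v, 'u) placed_complex \<Rightarrow> ('v set \<Rightarrow> real) set" where
  "ker_omega_L X = {w. (\<forall>a. a \<notin> edges X \<longrightarrow> w a = 0) \<and>
     (\<forall>i\<in>faces X. (\<Sum>a\<in>edges X. d_omega_d_L X i a * w a) = 0)}"

definition ker_Omega_S :: "('v, 'u) placed_complex \<Rightarrow> ('v set \<Rightarrow> real) set" where
  "ker_Omega_S X = {s. (\<forall>i. i \<notin> faces X \<longrightarrow> s i = 0) \<and>
     (\<forall>a\<in>edges X. (\<Sum>i\<in>faces X. d_Omega_d_S X a i * s i) = 0)}"


section \<open>Edge deviations\<close>

text \<open>Orthonormal bases \<open>n e 0, n e 1, n e 2\<close> of the orthogonal complements of the edges \<open>e\<close> of the
  universal cover, transported by the linear parts of the motions, so that components of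
  deviations are defined for the edges of the manifold.\<close>

definition edge_frame ::
    "('v, 'u) placed_complex \<Rightarrow> (('u \<Rightarrow> 'u) \<Rightarrow> real^4 \<Rightarrow> real^4) \<Rightarrow>
     ('u set \<Rightarrow> nat \<Rightarrow> real^4) \<Rightarrow> bool" where
  "edge_frame X \<rho> n \<longleftrightarrow>
     (\<forall>e\<in>cover X. card e = 2 \<longrightarrow>
        (\<forall>j<3. \<forall>k<3. n e j \<bullet> n e k = (if j = k then 1 else 0)) \<and>
        (\<forall>k<3. \<forall>u\<in>e. \<forall>w\<in>e. (place X u - place X w) \<bullet> n e k = 0) \<and>
        (\<forall>g\<in>deck_group X. \<forall>k<3. n (g ` e) k = \<rho> g (n e k) - \<rho> g 0))"

text \<open>For the triangle \<open>t = {x, y, z}\<close> of the cover and deviations \<open>v\<close> of its edges.\<close>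

definition generated_dS ::
    "('v, 'u) placed_complex \<Rightarrow> 'u set \<Rightarrow> ('u set \<Rightarrow> real^4) \<Rightarrow> real" where
  "generated_dS X t v = (THE s. \<exists>x y z. t = {x, y, z} \<and> distinct [x, y, z] \<and>
     s = 4 * triangle_area (midpoint (place X x) (place X y) + v {x, y})
                           (midpoint (place X y) (place X z) + v {y, z})
                           (midpoint (place X z) (place X x) + v {z, x})
         - triangle_area (place X x) (place X y) (place X z))"

text \<open>The pair \<open>(a, k)\<close> stands for the \<open>k\<close>-th component of the deviation of the edge \<open>a\<close>.\<close>

definition components :: "('v, 'u) placed_complex \<Rightarrow> ('v set \<times> nat) set" where
  "components X = edges X \<times> {..<3}"

definition d_S_d_v ::
    "('v, 'u) placed_complex \<Rightarrow> ('u set \<Rightarrow> nat \<Rightarrow> real^4) \<Rightarrow> 'v set \<Rightarrow> 'v set \<times> nat \<Rightarrow> real" where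
  "d_S_d_v X n i = (\<lambda>(a, k).
     deriv (\<lambda>\<tau>. generated_dS X (lift X i)
                   (\<lambda>e. if proj X ` e = a then \<tau> *\<^sub>R n e k else 0)) 0)"

definition area_map ::
    "('v, 'u) placed_complex \<Rightarrow> ('u set \<Rightarrow> nat \<Rightarrow> real^4) \<Rightarrow>
     ('v set \<times> nat \<Rightarrow> real) \<Rightarrow> ('v set \<Rightarrow> real)" where
  "area_map X n v =
     (\<lambda>i. if i \<in> faces X then \<Sum>c\<in>components X. d_S_d_v X n i c * v c else 0)"

text \<open>The columns of \<open>area_map\<close> with the indices in \<open>Vs\<close> form a basis of \<open>ker_Omega_S X\<close>.\<close>

definition column_basis ::
    "('v, 'u) placed_complex \<Rightarrow> ('u set \<Rightarrow> nat \<Rightarrow> real^4) \<Rightarrow> ('v set \<times> nat) list \<Rightarrow> bool" where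
  "column_basis X n Vs \<longleftrightarrow>
     distinct Vs \<and> set Vs \<subseteq> components X \<and>
     (\<forall>c\<in>set Vs. area_map X n (\<lambda>b. if b = c then 1 else 0) \<in> ker_Omega_S X) \<and>
     (\<forall>s\<in>ker_Omega_S X. \<exists>!v. (\<forall>b. b \<notin> set Vs \<longrightarrow> v b = 0) \<and> s = area_map X n v)"


section \<open>Exterior forms and the expression\<close>

text \<open>An exterior form of degree \<open>n\<close> is a function of lists of \<open>n\<close> vectors, taken to vanish on lists
  of any other length.\<close>

type_synonym 'i form = "('i \<Rightarrow> real) list \<Rightarrow> real"

definition wedge :: "'i list \<Rightarrow> 'i form" where
  "wedge js ws =
     (if length ws = length js
      then Determinant.det
             (Matrix.mat (length js) (length js) (\<lambda>(p, q). (ws ! q) (js ! p)))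
      else 0)"

text \<open>The exterior product as the signed sum over shuffles.\<close>

definition ext_prod :: "'i form \<Rightarrow> 'i form \<Rightarrow> 'i form" where
  "ext_prod f g vs =
     (\<Sum>I\<in>Pow {..<length vs}.
        (-1) ^ card {(i, j). i \<in> I \<and> j < i \<and> j \<notin> I} *
        f (nths vs I) * g (nths vs ({..<length vs} - I)))"

definition minor_B :: "('v, 'u) placed_complex \<Rightarrow> 'v set list \<Rightarrow> 'v set list \<Rightarrow> real mat" where
  "minor_B X Ds Cs =
     Matrix.mat (length Ds) (length Cs) (\<lambda>(p, q). d_omega_d_L X (Ds ! p) (Cs ! q))"

text \<open>\<open>Cs\<close>, \<open>Cs'\<close> enumerate the subset \<open>\<C>\<close> of the edges and its complement; likewise \<open>Ds\<close>, \<open>Ds'\<close>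
  for the subset \<open>\<D>\<close> of the faces. The full matrix is \<open>minor_B X (Ds @ Ds') (Cs @ Cs')\<close>.\<close>

definition admissible ::
    "('v, 'u) placed_complex \<Rightarrow> 'v set list \<Rightarrow> 'v set list \<Rightarrow> 'v set list \<Rightarrow> 'v set list \<Rightarrow> bool" where
  "admissible X Cs Cs' Ds Ds' \<longleftrightarrow>
     distinct (Cs @ Cs') \<and> set (Cs @ Cs') = edges X \<and>
     distinct (Ds @ Ds') \<and> set (Ds @ Ds') = faces X \<and>
     length Ds = length Cs \<and>
     length Cs = vec_space.rank (length (Ds @ Ds')) (minor_B X (Ds @ Ds') (Cs @ Cs')) \<and>
     Determinant.det (minor_B X Ds Cs) \<noteq> 0"

text \<open>The factor \<open>c\<close> in the expression of the exterior product of the \<open>dS\<close> over \<open>Ds'\<close> as \<open>c\<close> times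
  the exterior product of the deviation components in \<open>Vs\<close>, deviations with only these
  components being coordinates on the kernel.\<close>

definition area_form_factor ::
    "('v, 'u) placed_complex \<Rightarrow> ('u set \<Rightarrow> nat \<Rightarrow> real^4) \<Rightarrow> 'v set list \<Rightarrow>
     ('v set \<times> nat) list \<Rightarrow> real" where
  "area_form_factor X n Ds' Vs =
     (THE c. \<forall>vs. (\<forall>v\<in>set vs. \<forall>b. b \<notin> set Vs \<longrightarrow> v b = 0) \<longrightarrow>
        wedge Ds' (map (area_map X n) vs) = c * wedge Vs vs)"

text \<open>The expression as a form in the length variables \<open>ws\<close> (elements of \<open>ker_omega_L X\<close>) and the
  deviation variables.\<close>

definition expression ::
    "('v, 'u) placed_complex \<Rightarrow> ('u set \<Rightarrow> nat \<Rightarrow> real^4) \<Rightarrow>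
     'v set list \<Rightarrow> 'v set list \<Rightarrow> 'v set list \<Rightarrow> 'v set list \<Rightarrow> ('v set \<times> nat) list \<Rightarrow>
     ('v set \<Rightarrow> real) list \<Rightarrow> ('v set \<times> nat) form" where
  "expression X n Cs Cs' Ds Ds' Vs ws vs =
     (\<Prod>i\<in>faces X. face_area X i) / (\<Prod>s\<in>four_simplices X. simplex_volume X s) *
     (wedge Cs' ws * (area_form_factor X n Ds' Vs * wedge Vs vs)) /
     Determinant.det (minor_B X Ds Cs)"


section \<open>The move\<close>

definition removed_simplices :: "'v \<Rightarrow> 'v \<Rightarrow> 'v set \<Rightarrow> 'v set set" where
  "removed_simplices A B R = {insert A R, insert B R, R}"

definition added_simplices :: "'v \<Rightarrow> 'v \<Rightarrow> 'v set \<Rightarrow> 'v set set" where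
  "added_simplices A B R = {{A, B} \<union> T | T. T \<subset> R}"

text \<open>The last condition says that the orientation \<open>orient Y\<close> is that of the same manifold: the
  simplices of the replaced and of the replacing cluster lie on the same side of each boundary
  tetrahedron of the cluster, and hence must induce the same orientation on it.\<close>

definition move_2_4 ::
    "('v, 'u) placed_complex \<Rightarrow> 'v \<Rightarrow> 'v \<Rightarrow> 'v \<Rightarrow> 'v \<Rightarrow> 'v \<Rightarrow> 'v \<Rightarrow> ('v, 'u) placed_complex \<Rightarrow> bool" where
  "move_2_4 X A B C D E F Y \<longleftrightarrow>
     (let R = {C, D, E, F} in
      distinct [A, B, C, D, E, F] \<and>
      {A, C, D, E, F} \<in> simplices X \<and> {B, C, D, F, E} \<in> simplices X \<and> {A, B} \<notin> simplices X \<and>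
      simplices Y = (simplices X - removed_simplices A B R) \<union> added_simplices A B R \<and>
      cover Y = {t \<in> cover X. proj X ` t \<notin> removed_simplices A B R} \<union>
        {t. \<exists>tA\<in>cover X. \<exists>tB\<in>cover X.
              proj X ` tA = insert A R \<and> proj X ` tB = insert B R \<and> proj X ` (tA \<inter> tB) = R \<and>
              t \<subseteq> tA \<union> tB \<and> proj X ` t \<in> added_simplices A B R} \<and>
      proj Y = proj X \<and> place Y = place X \<and>
      orientation (simplices Y) (orient Y) \<and>
      (\<forall>xs. distinct xs \<and> length xs = 5 \<and> set xs \<in> simplices X \<inter> simplices Y \<longrightarrow>
         orient Y xs = orient X xs) \<and>
      (\<forall>x y ts. length ts = 4 \<and> distinct (x # ts) \<and> distinct (y # ts) \<and>
         set (x # ts) \<in> simplices X - simplices Y \<and>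
         set (y # ts) \<in> simplices Y - simplices X \<longrightarrow>
         orient Y (y # ts) = orient X (x # ts)))"

definition forget_edge :: "'v set \<Rightarrow> ('v set \<Rightarrow> real) \<Rightarrow> ('v set \<Rightarrow> real)" where
  "forget_edge a w = w(a := 0)"

end

theory Submission
  imports Defs "Jordan_Normal_Form.DL_Rank_Submatrix"
begin

text \<open>Let \<open>lam\<close> be the affine dependency in \<open>\<real>\<^sup>4\<close> of the six vertices of the cluster replaced by the
  move, normalized so that \<open>lam w\<close> is, up to sign, 24 times the volume of the 4-simplex without \<open>w\<close>.
  Around a face \<open>i\<close> of the cluster the three signed dihedral angles of the cluster add up to a
  multiple of \<open>2\<pi>\<close> in every flat position, so the gradient of their sum in the edge lengths is
  proportional to the stress \<open>lam x lam y\<close>; explicitly it is \<open>S\<^sub>i lam x lam y\<close> divided by the product of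
  \<open>lam w\<close> over the three vertices outside \<open>i\<close>. Hence the move changes the matrix of the derivatives
  of the deficit angles by a rank one matrix supported on the cluster. The new minor is therefore
  the old one times the entry for the face \<open>ABC\<close> and the edge \<open>AB\<close>, and the kernels are identified.
  The old faces do not see the deviation of \<open>AB\<close>, so the factor of the area form is multiplied by
  the determinant of the areas of \<open>ABD, ABE, ABF\<close> with respect to this deviation, which is
  proportional to \<open>lam C\<close>. All volumes and areas of the cluster cancel.\<close>

text \<open>The overview argues by flatness; the code instead differentiates each dihedral angle
  explicitly and lets \<open>cluster_identity\<close> add up three such derivatives. The obstacle
  there is that the lengths are independent variables and the angle is picked by \<open>THE\<close>:
  lengths near the given ones must be shown to belong to a simplex. The minors before and after the
  move are chosen separately, so the two expressions become comparable only after proving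
  independence of the choice. One sign has to serve all vectors, so the lemmas on changes of choice
  fix their sign before quantifying over matrices and vectors. The constant: four new volumes
  replace two old ones, which gives 24^4 / 24^2 = 576, and the areas of ABD, ABE, ABF vary with
  slopes L / (2 S), which divides by 8; 576 / 8 = 72. The power: three factors L = |AB|^2, against
  one |AB| lost when \<open>lam C\<close>, a determinant in four-space, is written as |AB| times a
  determinant of components orthogonal to AB; what remains is |AB|^5.\<close>

no_notation vec_index (infixl "$" 100)
no_notation scalar_prod (infix "\<bullet>" 70)

section \<open>Minors of matrices given by functions\<close>

text \<open>Rows and columns are lists of labels of arbitrary types, so that edges, faces, deviation
  components and even vectors can index a minor; the order of the lists fixes its sign.\<close>

definition mdet :: "('a \<Rightarrow> 'b \<Rightarrow> real) \<Rightarrow> 'a list \<Rightarrow> 'b list \<Rightarrow> real" where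
  "mdet M rs cs =
     Determinant.det (Matrix.mat (length rs) (length cs) (\<lambda>(p, q). M (rs ! p) (cs ! q)))"

lemma mdet_cong:
  assumes "\<And>r c. r \<in> set rs \<Longrightarrow> c \<in> set cs \<Longrightarrow> M r c = N r c"
  shows "mdet M rs cs = mdet N rs cs"
  unfolding mdet_def by (intro arg_cong[where f = Determinant.det] eq_matI) (auto intro: assms)

lemma mdet_map: "mdet M (map f rs) (map g cs) = mdet (\<lambda>r c. M (f r) (g c)) rs cs"
  unfolding mdet_def by (intro arg_cong[where f = Determinant.det] eq_matI) auto

lemma mdet_Nil [simp]: "mdet M [] [] = 1"
  unfolding mdet_def by simp

lemma mdet_single [simp]: "mdet M [r] [c] = M r c"
  unfolding mdet_def by (subst det_single) auto

lemma mdet_transpose: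
  assumes "length rs = length cs"
  shows "mdet (\<lambda>c r. M r c) cs rs = mdet M rs cs"
proof -
  let ?A = "Matrix.mat (length rs) (length cs) (\<lambda>(p, q). M (rs ! p) (cs ! q))"
  have "Determinant.det (transpose_mat ?A) = Determinant.det ?A"
    by (rule Determinant.det_transpose[of _ "length rs"]) (simp add: assms)
  moreover have "transpose_mat ?A =
      Matrix.mat (length cs) (length rs) (\<lambda>(p, q). M (rs ! q) (cs ! p))"
    by (rule eq_matI) auto
  ultimately show ?thesis
    unfolding mdet_def by simp
qed

text \<open>The sign is that of the permutation taking \<open>rs\<close> to \<open>rs'\<close>; it
  is obtained before \<open>M\<close> and \<open>cs\<close> are given, so one sign serves all
  matrices.\<close>

lemma mdet_permute_rows:
  assumes "distinct rs" "distinct rs'" "set rs = set rs'"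
  obtains e :: real where "e \<in> {1, -1}"
    "\<And>(M :: 'a \<Rightarrow> 'b \<Rightarrow> real) cs. length cs = length rs \<Longrightarrow> mdet M rs' cs = e * mdet M rs cs"
proof -
  have "mset rs' = mset rs"
    using assms set_eq_iff_mset_eq_distinct by blast
  then obtain p where p: "p permutes {..<length rs}" "permute_list p rs = rs'"
    by (metis mset_eq_permutation)
  have len: "length rs' = length rs"
    using \<open>mset rs' = mset rs\<close> by (metis size_mset)
  let ?e = "signof p :: real"
  have "mdet M rs' cs = ?e * mdet M rs cs" if "length cs = length rs"
    for M :: "'a \<Rightarrow> 'b \<Rightarrow> real" and cs
  proof -
    let ?n = "length rs"
    let ?A = "Matrix.mat ?n ?n (\<lambda>(i, j). M (rs ! i) (cs ! j))"
    have "p permutes {0..<?n}"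
      using p(1) by (simp add: lessThan_atLeast0)
    then have "Determinant.det (Matrix.mat ?n ?n (\<lambda>(i, j). ?A $$ (p i, j))) = ?e * Determinant.det ?A"
      by (intro det_permute_rows) auto
    moreover have "Matrix.mat ?n ?n (\<lambda>(i, j). ?A $$ (p i, j)) =
        Matrix.mat ?n ?n (\<lambda>(i, j). M (rs' ! i) (cs ! j))"
    proof (rule eq_matI)
      fix i j assume "i < dim_row (Matrix.mat ?n ?n (\<lambda>(i, j). M (rs' ! i) (cs ! j)))"
        and "j < dim_col (Matrix.mat ?n ?n (\<lambda>(i, j). M (rs' ! i) (cs ! j)))"
      then have ij: "i < ?n" "j < ?n" by auto
      have "p i < ?n"
        using p(1) ij(1) permutes_in_image by fastforce
      moreover have "rs' ! i = rs ! p i"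
        using p ij(1) permute_list_nth by metis
      ultimately show "Matrix.mat ?n ?n (\<lambda>(i, j). ?A $$ (p i, j)) $$ (i, j) =
          Matrix.mat ?n ?n (\<lambda>(i, j). M (rs' ! i) (cs ! j)) $$ (i, j)"
        using ij by simp
    qed auto
    ultimately show ?thesis
      unfolding mdet_def using that len by simp
  qed
  moreover have "?e \<in> {1, -1}"
    by (auto simp: sign_def)
  ultimately show thesis using that by blast
qed

lemma mdet_block:
  assumes "length r1 = length c1" "length r2 = length c2"
    and "\<And>r c. r \<in> set r1 \<Longrightarrow> c \<in> set c2 \<Longrightarrow> M r c = 0"
  shows "mdet M (r1 @ r2) (c1 @ c2) = mdet M r1 c1 * mdet M r2 c2"
proof -
  let ?n = "length r1" and ?m = "length r2"
  let ?A = "Matrix.mat ?n ?n (\<lambda>(p, q). M (r1 ! p) (c1 ! q))"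
  let ?C = "Matrix.mat ?m ?n (\<lambda>(p, q). M (r2 ! p) (c1 ! q))"
  let ?D = "Matrix.mat ?m ?m (\<lambda>(p, q). M (r2 ! p) (c2 ! q))"
  have "Matrix.mat (?n + ?m) (?n + ?m) (\<lambda>(p, q). M ((r1 @ r2) ! p) ((c1 @ c2) ! q)) =
      four_block_mat ?A (0\<^sub>m ?n ?m) ?C ?D"
    using assms by (intro eq_matI) (auto simp: nth_append)
  moreover have "Determinant.det (four_block_mat ?A (0\<^sub>m ?n ?m) ?C ?D) =
      Determinant.det ?A * Determinant.det ?D"
    by (rule det_four_block_mat_upper_right_zero) auto
  ultimately show ?thesis
    unfolding mdet_def using assms(1,2) by simp
qed

lemma mdet_block':
  assumes "length r1 = length c1" "length r2 = length c2"
    and "\<And>r c. r \<in> set r2 \<Longrightarrow> c \<in> set c1 \<Longrightarrow> M r c = 0"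
  shows "mdet M (r1 @ r2) (c1 @ c2) = mdet M r1 c1 * mdet M r2 c2"
proof -
  have "mdet (\<lambda>c r. M r c) (c1 @ c2) (r1 @ r2) =
      mdet (\<lambda>c r. M r c) c1 r1 * mdet (\<lambda>c r. M r c) c2 r2"
    by (rule mdet_block) (use assms in auto)
  then show ?thesis
    using mdet_transpose[of "r1 @ r2" "c1 @ c2" M] mdet_transpose[of r1 c1 M]
      mdet_transpose[of r2 c2 M] assms(1,2) by simp
qed

lemma sum_set_conv_nth:
  assumes "distinct ks"
  shows "(\<Sum>k\<in>set ks. f k) = (\<Sum>i<length ks. f (ks ! i))"
  using sum.reindex_bij_betw[OF bij_betw_nth[OF assms refl refl], of f] by simp

lemma mdet_mult:
  assumes "length rs = length ks" "length ks = length cs" "distinct ks"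
  shows "mdet (\<lambda>r c. \<Sum>k\<in>set ks. M r k * N k c) rs cs = mdet M rs ks * mdet N ks cs"
proof -
  let ?n = "length ks"
  let ?A = "Matrix.mat ?n ?n (\<lambda>(p, q). M (rs ! p) (ks ! q))"
  let ?B = "Matrix.mat ?n ?n (\<lambda>(p, q). N (ks ! p) (cs ! q))"
  have "(\<Sum>k\<in>set ks. M r k * N k c) = (\<Sum>i<?n. M r (ks ! i) * N (ks ! i) c)" for r c
    using assms(3) by (rule sum_set_conv_nth)
  then have "Matrix.mat ?n ?n (\<lambda>(p, q). (\<Sum>k\<in>set ks. M (rs ! p) k * N k (cs ! q))) = ?A * ?B"
    by (intro eq_matI) (auto simp: scalar_prod_def lessThan_atLeast0)
  moreover have "Determinant.det (?A * ?B) = Determinant.det ?A * Determinant.det ?B"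
    by (rule Determinant.det_mult) auto
  ultimately show ?thesis
    unfolding mdet_def using assms by simp
qed

lemma mdet_unit [simp]:
  assumes "distinct ks"
  shows "mdet (\<lambda>r c. if r = c then 1 else 0) ks ks = 1"
proof -
  have "Matrix.mat (length ks) (length ks) (\<lambda>(p, q). if ks ! p = ks ! q then 1 else 0) =
      (1\<^sub>m (length ks) :: real mat)"
    by (rule eq_matI) (use assms in \<open>auto simp: nth_eq_iff_index_eq\<close>)
  then show ?thesis unfolding mdet_def by simp
qed

text \<open>Pad both factors with zeros.\<close>

lemma mdet_mult_thin:
  assumes "length rs = length cs" "length ks < length rs" "distinct ks"
  shows "mdet (\<lambda>r c. \<Sum>k\<in>set ks. M r k * N k c) rs cs = 0"
proof -
  let ?n = "length rs"
  let ?k = "length ks"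
  let ?A = "Matrix.mat ?n ?n (\<lambda>(p, q). if q < ?k then M (rs ! p) (ks ! q) else 0)"
  let ?B = "Matrix.mat ?n ?n (\<lambda>(p, q). if p < ?k then N (ks ! p) (cs ! q) else 0)"
  have 1: "(\<Sum>k\<in>set ks. M r k * N k c) = (\<Sum>i<?k. M r (ks ! i) * N (ks ! i) c)" for r c
    using assms(3) by (rule sum_set_conv_nth)
  have "Matrix.mat ?n ?n (\<lambda>(p, q). (\<Sum>k\<in>set ks. M (rs ! p) k * N k (cs ! q))) = ?A * ?B"
  proof (rule eq_matI)
    fix i j assume "i < dim_row (?A * ?B)" "j < dim_col (?A * ?B)"
    then have ij: "i < ?n" "j < ?n" by auto
    have "(?A * ?B) $$ (i, j) = (\<Sum>q\<in>{0..<?n}. (if q < ?k then M (rs ! i) (ks ! q) else 0) *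
        (if q < ?k then N (ks ! q) (cs ! j) else 0))"
      using ij by (simp add: scalar_prod_def)
    also have "\<dots> = (\<Sum>q\<in>{..<?k}. M (rs ! i) (ks ! q) * N (ks ! q) (cs ! j))"
      using assms(2) by (intro sum.mono_neutral_cong_right) auto
    finally show "Matrix.mat ?n ?n (\<lambda>(p, q). (\<Sum>k\<in>set ks. M (rs ! p) k * N k (cs ! q))) $$ (i, j) =
        (?A * ?B) $$ (i, j)"
      using ij 1 by simp
  qed auto
  moreover have "Determinant.det (?A * ?B) = Determinant.det ?A * Determinant.det ?B"
    by (rule Determinant.det_mult) auto
  \<comment> \<open>Since \<open>length ks < length rs\<close>, the last row of \<open>?B\<close> is
    padding and zero.\<close>
  moreover have "Determinant.det ?B = 0"
  proof -
    have "Determinant.det ?B = (\<Sum>j<?n. ?B $$ (?n - 1, j) * cofactor ?B (?n - 1) j)"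
      using assms(2) by (intro laplace_expansion_row) auto
    also have "\<dots> = 0"
      using assms(2) by (intro sum.neutral) auto
    finally show ?thesis .
  qed
  ultimately show ?thesis
    unfolding mdet_def using assms(1) by simp
qed

text \<open>The adjugate over the determinant is a two-sided inverse; \<open>f\<close> and
  \<open>g\<close> turn labels back into positions, which makes the inverse a function of
  labels.\<close>

lemma mdet_inverse:
  assumes "mdet M D C \<noteq> 0" "length D = length C" "distinct C" "distinct D"
  obtains B :: "'b \<Rightarrow> 'a \<Rightarrow> real" where
    "\<And>d d'. d \<in> set D \<Longrightarrow> d' \<in> set D \<Longrightarrow> (\<Sum>c\<in>set C. M d c * B c d') = (if d = d' then 1 else 0)"
    "\<And>c c'. c \<in> set C \<Longrightarrow> c' \<in> set C \<Longrightarrow> (\<Sum>d\<in>set D. B c d * M d c') = (if c = c' then 1 else 0)"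
proof -
  let ?n = "length C"
  let ?A = "Matrix.mat ?n ?n (\<lambda>(p, q). M (D ! p) (C ! q))"
  have A: "?A \<in> carrier_mat ?n ?n" by simp
  have det: "Determinant.det ?A \<noteq> 0"
    using assms(1,2) unfolding mdet_def by simp
  define X where "X = (1 / Determinant.det ?A) \<cdot>\<^sub>m adj_mat ?A"
  have X: "X \<in> carrier_mat ?n ?n"
    unfolding X_def using adj_mat(1)[OF A] by simp
  have one: "(1 / Determinant.det ?A) \<cdot>\<^sub>m (Determinant.det ?A \<cdot>\<^sub>m 1\<^sub>m ?n) = 1\<^sub>m ?n"
    using det by (intro eq_matI) auto
  have AX: "?A * X = 1\<^sub>m ?n" and XA: "X * ?A = 1\<^sub>m ?n"
    unfolding X_def mult_smult_distrib[OF A adj_mat(1)[OF A]]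
      mult_smult_assoc_mat[OF adj_mat(1)[OF A] A] adj_mat(2,3)[OF A] by (rule one)+
  obtain f where f: "\<And>p. p < ?n \<Longrightarrow> f (C ! p) = p"
    using the_inv_into_f_f[OF inj_on_nth[of C "{..<length C}"]] assms(2,3,4) by (metis lessThan_iff)
  obtain g where g: "\<And>p. p < ?n \<Longrightarrow> g (D ! p) = p"
    using the_inv_into_f_f[OF inj_on_nth[of D "{..<length D}"]] assms(2,3,4) by (metis lessThan_iff)
  define B where "B c d = X $$ (f c, g d)" for c d
  show thesis
  proof (rule that)
    fix d d' assume "d \<in> set D" "d' \<in> set D"
    then obtain p q where pq: "p < ?n" "q < ?n" "d = D ! p" "d' = D ! q"
      using assms(2) by (metis in_set_conv_nth)
    have "(\<Sum>c\<in>set C. M d c * B c d') = (\<Sum>i<?n. M d (C ! i) * B (C ! i) d')"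
      by (rule sum_set_conv_nth[OF assms(3)])
    also have "\<dots> = (?A * X) $$ (p, q)"
      using pq X by (auto simp: scalar_prod_def lessThan_atLeast0 B_def f g intro!: sum.cong)
    also have "\<dots> = (if d = d' then 1 else 0)"
      using pq AX assms(2,4) by (simp add: nth_eq_iff_index_eq)
    finally show "(\<Sum>c\<in>set C. M d c * B c d') = (if d = d' then 1 else 0)" .
  next
    fix c c' assume "c \<in> set C" "c' \<in> set C"
    then obtain p q where pq: "p < ?n" "q < ?n" "c = C ! p" "c' = C ! q"
      by (metis in_set_conv_nth)
    have "(\<Sum>d\<in>set D. B c d * M d c') = (\<Sum>i<?n. B c (D ! i) * M (D ! i) c')"
      using sum_set_conv_nth[OF assms(4)] assms(2) by simp
    also have "\<dots> = (X * ?A) $$ (p, q)"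
      using pq X by (auto simp: scalar_prod_def lessThan_atLeast0 B_def f g intro!: sum.cong)
    also have "\<dots> = (if c = c' then 1 else 0)"
      using pq XA assms(3) by (simp add: nth_eq_iff_index_eq)
    finally show "(\<Sum>d\<in>set D. B c d * M d c') = (if c = c' then 1 else 0)" .
  qed
qed

text \<open>Multiply the matrix with rows \<open>Q\<close> and the unit rows of \<open>C2'\<close> by the matrix with the unit
  columns of \<open>C\<close> and the columns of \<open>W\<close>; all three determinants are block triangular.\<close>

lemma mdet_exchange:
  assumes CC: "distinct (C @ C')" and CC2: "distinct (C2 @ C2')"
    and set_eq: "set (C2 @ C2') = set (C @ C')" and len: "length C2 = length C"
  shows "\<exists>e\<in>{1, -1 :: real}. \<forall>(Q :: 'd \<Rightarrow> 'e \<Rightarrow> real) (W :: 'e \<Rightarrow> 'n \<Rightarrow> real) D N.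
       length D = length C \<longrightarrow> length N = length C' \<longrightarrow>
       (\<forall>d\<in>set D. \<forall>n\<in>set N. (\<Sum>a\<in>set (C @ C'). Q d a * W a n) = 0) \<longrightarrow>
       mdet Q D C2 * mdet W C' N = e * (mdet Q D C * mdet W C2' N)"
proof -
  have "length (C2 @ C2') = length (C @ C')"
    by (metis CC CC2 distinct_card set_eq)
  then have len': "length C2' = length C'" using len by simp
  obtain e :: real where e: "e \<in> {1, -1}"
    "\<And>(M :: 'e \<Rightarrow> 'e + 'n \<Rightarrow> real) cs. length cs = length (C @ C') \<Longrightarrow>
       mdet M (C2 @ C2') cs = e * mdet M (C @ C') cs"
    using mdet_permute_rows[OF CC CC2 set_eq[symmetric]] by metis
  show ?thesis
  proof (rule bexI[OF _ e(1)], intro allI impI)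
    fix Q :: "'d \<Rightarrow> 'e \<Rightarrow> real" and W :: "'e \<Rightarrow> 'n \<Rightarrow> real" and D :: "'d list" and N :: "'n list"
    assume D: "length D = length C" and N: "length N = length C'"
      and QW: "\<forall>d\<in>set D. \<forall>n\<in>set N. (\<Sum>a\<in>set (C @ C'). Q d a * W a n) = 0"
    \<comment> \<open>The sum types keep the row labels of \<open>Q\<close> apart from those of the
      unit rows, and the columns of \<open>W\<close> apart from the unit columns.\<close>
    define Z where "Z r a = (case r of Inl d \<Rightarrow> Q d a | Inr b \<Rightarrow> if b = a then 1 else 0)"
      for r :: "'d + 'e" and a
    define T where "T a s = (case s of Inl b \<Rightarrow> if a = b then 1 else 0 | Inr n \<Rightarrow> W a n)"
      for s :: "'e + 'n" and a
    let ?R = "map Inl D @ map Inr C2' :: ('d + 'e) list"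
    let ?S = "map Inl C @ map Inr N :: ('e + 'n) list"
    have Z: "mdet Z ?R (C2 @ C2') = mdet Q D C2"
    proof -
      have "mdet Z ?R (C2 @ C2') = mdet Z (map Inl D) C2 * mdet Z (map Inr C2') C2'"
        by (rule mdet_block') (use CC2 D len in \<open>auto simp: Z_def\<close>)
      also have "mdet Z (map Inl D) C2 = mdet Q D C2"
        using mdet_map[of Z Inl D id C2] by (simp add: Z_def)
      also have "mdet Z (map Inr C2') C2' = 1"
        using mdet_map[of Z Inr C2' id C2'] CC2 by (simp add: Z_def)
      finally show ?thesis by simp
    qed
    have T: "mdet T (C2 @ C2') ?S = e * mdet W C' N"
    proof -
      have "mdet T (C @ C') ?S = mdet T C (map Inl C) * mdet T C' (map Inr N)"
        by (rule mdet_block') (use CC N in \<open>auto simp: T_def\<close>)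
      also have "mdet T C (map Inl C) = 1"
        using mdet_map[of T id C Inl C] CC by (simp add: T_def)
      also have "mdet T C' (map Inr N) = mdet W C' N"
        using mdet_map[of T id C' Inr N] by (simp add: T_def)
      finally show ?thesis using e(2)[of ?S T] N by simp
    qed
    have "mdet (\<lambda>r s. \<Sum>a\<in>set (C2 @ C2'). Z r a * T a s) ?R ?S =
        mdet Z ?R (C2 @ C2') * mdet T (C2 @ C2') ?S"
      by (rule mdet_mult) (use CC2 len len' D N in auto)
    moreover have "mdet (\<lambda>r s. \<Sum>a\<in>set (C2 @ C2'). Z r a * T a s) ?R ?S =
        mdet Q D C * mdet W C2' N"
    proof -
      let ?P = "\<lambda>r s. \<Sum>a\<in>set (C2 @ C2'). Z r a * T a s"
      \<comment> \<open>The block of the rows of \<open>Q\<close> against the columns of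
        \<open>W\<close> is their product, which is zero by \<open>QW\<close>.\<close>
      have "mdet ?P ?R ?S = mdet ?P (map Inl D) (map Inl C) * mdet ?P (map Inr C2') (map Inr N)"
        by (rule mdet_block)
          (use D N len' QW set_eq in \<open>auto simp: Z_def T_def\<close>)
      also have "mdet ?P (map Inl D) (map Inl C) = mdet Q D C"
      proof -
        have "?P (Inl d) (Inl c) = Q d c" if "c \<in> set C" for d c
          unfolding set_eq using that by (simp add: Z_def T_def if_distrib cong: if_cong)
        then show ?thesis unfolding mdet_map by (intro mdet_cong) auto
      qed
      also have "mdet ?P (map Inr C2') (map Inr N) = mdet W C2' N"
      proof -
        have "?P (Inr c) (Inr n) = W c n" if "c \<in> set C2'" for c n
          using that by (simp add: Z_def T_def if_distrib[of "\<lambda>x. x * _"] cong: if_cong)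
        then show ?thesis unfolding mdet_map by (intro mdet_cong) auto
      qed
      finally show ?thesis .
    qed
    ultimately have "mdet Q D C * mdet W C2' N = mdet Q D C2 * (e * mdet W C' N)"
      using Z T by simp
    then show "mdet Q D C2 * mdet W C' N = e * (mdet Q D C * mdet W C2' N)"
      using e(1) by auto
  qed
qed

section \<open>Maximal minors and the freedom in choosing them\<close>

text \<open>The form in which maximality of a minor is used: every column is a combination of the
  columns in \<open>C\<close>, with coefficients \<open>G\<close> that do not depend on the
  row.\<close>

definition spans_cols :: "('f \<Rightarrow> 'e \<Rightarrow> real) \<Rightarrow> 'f set \<Rightarrow> 'e set \<Rightarrow> 'e list \<Rightarrow> bool" where
  "spans_cols M F E C \<longleftrightarrow>
     (\<exists>G. \<forall>i\<in>F. \<forall>a\<in>E. M i a = (\<Sum>c\<in>set C. M i c * G c a))"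

text \<open>\<open>M\<close> factors through the labels in \<open>C\<close>, so a minor with more
  columns than \<open>C\<close> is a product through too few labels and vanishes by
  \<open>mdet_mult_thin\<close>.\<close>

lemma spans_cols_length_le:
  assumes "spans_cols M F E C" "distinct C" "mdet M D2 C2 \<noteq> 0" "length D2 = length C2"
    and "set D2 \<subseteq> F" "set C2 \<subseteq> E"
  shows "length C2 \<le> length C"
proof (rule ccontr)
  assume *: "\<not> length C2 \<le> length C"
  obtain G where G: "\<forall>i\<in>F. \<forall>a\<in>E. M i a = (\<Sum>c\<in>set C. M i c * G c a)"
    using assms(1) unfolding spans_cols_def by blast
  have "mdet M D2 C2 = mdet (\<lambda>i a. \<Sum>c\<in>set C. M i c * G c a) D2 C2"
    using G assms(5,6) by (intro mdet_cong) blast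
  also have "\<dots> = 0"
    using * assms by (intro mdet_mult_thin) auto
  finally show False using assms(3) by simp
qed

text \<open>Two exchanges by way of the mixed minor on \<open>D\<close> and \<open>C2\<close>: one
  replaces the columns and acts on right kernel vectors \<open>W\<close>, the other replaces the
  rows and acts on left kernel vectors \<open>S\<close>. The mixed minor occurs once in a numerator
  and once in a denominator and cancels. This is the independence of the expression, up to sign, of
  the choice of the minor.\<close>

lemma mdet_independent_of_choice:
  fixes M :: "'f \<Rightarrow> 'e \<Rightarrow> real"
  assumes "distinct (C @ C')" "set (C @ C') = E" "distinct (C2 @ C2')" "set (C2 @ C2') = E"
    and "distinct (D @ D')" "set (D @ D') = F" "distinct (D2 @ D2')" "set (D2 @ D2') = F"
    and "length D = length C" "length D2 = length C" "length C2 = length C"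
    and nz: "mdet M D C \<noteq> 0" "mdet M D2 C2 \<noteq> 0"
    and spans: "spans_cols M F E C2"
  shows "\<exists>e\<in>{1, -1 :: real}. \<forall>(W :: 'e \<Rightarrow> 'm \<Rightarrow> real) (S :: 'f \<Rightarrow> 'n \<Rightarrow> real) N N'.
       length N = length C' \<longrightarrow> length N' = length D' \<longrightarrow>
       (\<forall>i\<in>F. \<forall>n\<in>set N. (\<Sum>a\<in>E. M i a * W a n) = 0) \<longrightarrow>
       (\<forall>a\<in>E. \<forall>n\<in>set N'. (\<Sum>i\<in>F. M i a * S i n) = 0) \<longrightarrow>
       mdet W C2' N * mdet S D2' N' / mdet M D2 C2 = e * (mdet W C' N * mdet S D' N' / mdet M D C)"
proof -
  obtain G where G: "\<forall>i\<in>F. \<forall>a\<in>E. M i a = (\<Sum>c\<in>set C2. M i c * G c a)"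
    using spans unfolding spans_cols_def by blast
  \<comment> \<open>The columns in \<open>C2\<close> span, so the mixed minor is a factor of the
    nonzero minor on \<open>D\<close> and \<open>C\<close>; hence one may divide by it.\<close>
  have "mdet M D C = mdet (\<lambda>i a. \<Sum>c\<in>set C2. M i c * G c a) D C"
    by (intro mdet_cong) (use G assms(2,6) in auto)
  also have "\<dots> = mdet M D C2 * mdet G C2 C"
    by (intro mdet_mult) (use assms in auto)
  finally have nz2: "mdet M D C2 \<noteq> 0" using nz(1) by auto
  have sE: "set (C2 @ C2') = set (C @ C')" and sF: "set (D2 @ D2') = set (D @ D')"
    and lD: "length D2 = length D"
    using assms by auto
  obtain e1 :: real where e1: "e1 \<in> {1, -1}"
    "\<forall>(Q :: 'f \<Rightarrow> 'e \<Rightarrow> real) (W :: 'e \<Rightarrow> 'm \<Rightarrow> real) D N.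
       length D = length C \<longrightarrow> length N = length C' \<longrightarrow>
       (\<forall>d\<in>set D. \<forall>n\<in>set N. (\<Sum>a\<in>set (C @ C'). Q d a * W a n) = 0) \<longrightarrow>
       mdet Q D C2 * mdet W C' N = e1 * (mdet Q D C * mdet W C2' N)"
    using mdet_exchange[OF assms(1,3) sE assms(11)] by blast
  obtain e2 :: real where e2: "e2 \<in> {1, -1}"
    "\<forall>(Q :: 'e \<Rightarrow> 'f \<Rightarrow> real) (W :: 'f \<Rightarrow> 'n \<Rightarrow> real) C N.
       length C = length D \<longrightarrow> length N = length D' \<longrightarrow>
       (\<forall>d\<in>set C. \<forall>n\<in>set N. (\<Sum>a\<in>set (D @ D'). Q d a * W a n) = 0) \<longrightarrow>
       mdet Q C D2 * mdet W D' N = e2 * (mdet Q C D * mdet W D2' N)"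
    using mdet_exchange[OF assms(5,7) sF lD] by blast
  have "e1 * e2 \<in> {1, -1}" using e1(1) e2(1) by auto
  then show ?thesis
  proof (rule bexI[rotated], intro allI impI)
    fix W :: "'e \<Rightarrow> 'm \<Rightarrow> real" and S :: "'f \<Rightarrow> 'n \<Rightarrow> real" and N N'
    assume N: "length N = length C'" "length N' = length D'"
      and W: "\<forall>i\<in>F. \<forall>n\<in>set N. (\<Sum>a\<in>E. M i a * W a n) = 0"
      and S: "\<forall>a\<in>E. \<forall>n\<in>set N'. (\<Sum>i\<in>F. M i a * S i n) = 0"
    have 1: "mdet M D C2 * mdet W C' N = e1 * (mdet M D C * mdet W C2' N)"
      by (rule e1(2)[rule_format]) (use assms N W in auto)
    have "mdet (\<lambda>c d. M d c) C2 D2 * mdet S D' N' =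
        e2 * (mdet (\<lambda>c d. M d c) C2 D * mdet S D2' N')"
      by (rule e2(2)[rule_format]) (use assms N S in auto)
    then have 2: "mdet M D2 C2 * mdet S D' N' = e2 * (mdet M D C2 * mdet S D2' N')"
      using mdet_transpose[of D2 C2 M] mdet_transpose[of D C2 M] assms by simp
    have "e1 * e1 = 1" "e2 * e2 = 1" using e1(1) e2(1) by auto
    with 1 2 have 3: "mdet W C2' N = e1 * (mdet M D C2 * mdet W C' N / mdet M D C)"
      and 4: "mdet S D2' N' = e2 * (mdet M D2 C2 * mdet S D' N' / mdet M D C2)"
      using nz nz2 by (simp_all add: field_simps)
    show "mdet W C2' N * mdet S D2' N' / mdet M D2 C2 =
        e1 * e2 * (mdet W C' N * mdet S D' N' / mdet M D C)"
      unfolding 3 4 using nz nz2 by (simp add: field_simps)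
  qed
qed

section \<open>Exterior products\<close>

definition remove_nth :: "nat \<Rightarrow> 'a list \<Rightarrow> 'a list" where
  "remove_nth p xs = take p xs @ drop (Suc p) xs"

lemma length_remove_nth [simp]: "p < length xs \<Longrightarrow> length (remove_nth p xs) = length xs - 1"
  unfolding remove_nth_def by auto

lemma nth_remove_nth:
  "p < length xs \<Longrightarrow> k < length xs - 1 \<Longrightarrow> remove_nth p xs ! k = xs ! (if k < p then k else Suc k)"
  unfolding remove_nth_def by (auto simp: nth_append min_def)

lemma remove_nth_append1: "p < length xs \<Longrightarrow> remove_nth p (xs @ ys) = remove_nth p xs @ ys"
  unfolding remove_nth_def by simp

lemma remove_nth_append2: "remove_nth (length xs + p) (xs @ ys) = xs @ remove_nth p ys"
  unfolding remove_nth_def by simp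

lemma mdet_expand_first_col:
  assumes "length rs = Suc (length cs)"
  shows "mdet M rs (c # cs) =
    (\<Sum>p<length rs. (-1) ^ p * M (rs ! p) c * mdet M (remove_nth p rs) cs)"
proof -
  let ?n = "length rs"
  let ?A = "Matrix.mat ?n ?n (\<lambda>(p, q). M (rs ! p) ((c # cs) ! q))"
  have "Determinant.det ?A = (\<Sum>p<?n. ?A $$ (p, 0) * cofactor ?A p 0)"
    using assms by (intro laplace_expansion_column) auto
  also have "\<dots> = (\<Sum>p<?n. (-1) ^ p * M (rs ! p) c * mdet M (remove_nth p rs) cs)"
  proof (intro sum.cong refl)
    fix p assume p: "p \<in> {..<?n}"
    have "mat_delete ?A p 0 =
        Matrix.mat (length (remove_nth p rs)) (length cs) (\<lambda>(i, j). M (remove_nth p rs ! i) (cs ! j))"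
      using p assms unfolding mat_delete_def by (intro eq_matI) (auto simp: nth_remove_nth)
    then show "?A $$ (p, 0) * cofactor ?A p 0 = (-1) ^ p * M (rs ! p) c * mdet M (remove_nth p rs) cs"
      using p assms unfolding cofactor_def mdet_def by auto
  qed
  finally show ?thesis
    unfolding mdet_def using assms by simp
qed

lemma wedge_conv_mdet:
  "length ws = length js \<Longrightarrow> wedge js ws = mdet (\<lambda>j w. w j) js ws"
  unfolding wedge_def mdet_def by simp

lemma wedge_eq_0 [simp]: "length ws \<noteq> length js \<Longrightarrow> wedge js ws = 0"
  unfolding wedge_def by simp

lemma wedge_Cons:
  "wedge js (v # vs) = (\<Sum>p<length js. (-1) ^ p * v (js ! p) * wedge (remove_nth p js) vs)"
proof (cases "length js = Suc (length vs)")
  case True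
  then show ?thesis
    using mdet_expand_first_col[OF True, of "\<lambda>j w. w j" v] by (simp add: wedge_conv_mdet)
next
  case False
  then have "wedge (remove_nth p js) vs = 0" if "p < length js" for p
    using that by (intro wedge_eq_0) simp
  then show ?thesis using False by simp
qed

text \<open>The inversions of the shuffle that moves the positions in \<open>I\<close> to the front;
  their number is the sign exponent in \<open>ext_prod\<close>.\<close>

definition inversions :: "nat set \<Rightarrow> (nat \<times> nat) set" where
  "inversions I = {(i, j). i \<in> I \<and> j < i \<and> j \<notin> I}"

lemma finite_inversions: "finite I \<Longrightarrow> finite (inversions I)"
  by (rule finite_subset[of _ "Sigma I (\<lambda>i. {..<i})"]) (auto simp: inversions_def)

text \<open>A first vector that goes to the first factor has nothing to pass.\<close>

lemma card_inversions_insert_0: "card (inversions (insert 0 (Suc ` I))) = card (inversions I)"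
proof -
  have "inversions (insert 0 (Suc ` I)) = map_prod Suc Suc ` inversions I"
  proof (intro equalityI subsetI)
    fix x assume "x \<in> inversions (insert 0 (Suc ` I))"
    then obtain i j where x: "x = (Suc i, j)" "i \<in> I" "j < Suc i" "j \<notin> insert 0 (Suc ` I)"
      unfolding inversions_def by auto
    then obtain k where "j = Suc k" by (cases j) auto
    then show "x \<in> map_prod Suc Suc ` inversions I"
      using x unfolding inversions_def by (intro image_eqI[of _ _ "(i, k)"]) auto
  qed (auto simp: inversions_def)
  then show ?thesis
    by (metis card_image inj_Suc prod.inj_map inj_on_subset subset_UNIV)
qed

text \<open>A first vector that goes to the second factor is passed by every position in
  \<open>I\<close>, which adds \<open>card I\<close> inversions.\<close>

lemma card_inversions_Suc:
  assumes "finite I"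
  shows "card (inversions (Suc ` I)) = card (inversions I) + card I"
proof -
  have "inversions (Suc ` I) = map_prod Suc Suc ` inversions I \<union> (\<lambda>i. (Suc i, 0)) ` I"
  proof (intro equalityI subsetI)
    fix x assume "x \<in> inversions (Suc ` I)"
    then obtain i j where x: "x = (Suc i, j)" "i \<in> I" "j < Suc i" "j \<notin> Suc ` I"
      unfolding inversions_def by auto
    show "x \<in> map_prod Suc Suc ` inversions I \<union> (\<lambda>i. (Suc i, 0)) ` I"
    proof (cases j)
      case (Suc k)
      then have "x \<in> map_prod Suc Suc ` inversions I"
        using x unfolding inversions_def by (intro image_eqI[of _ _ "(i, k)"]) auto
      then show ?thesis by simp
    qed (use x in auto)
  qed (auto simp: inversions_def)
  moreover have "card (map_prod Suc Suc ` inversions I) = card (inversions I)"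
    by (metis card_image inj_Suc prod.inj_map inj_on_subset subset_UNIV)
  moreover have "card ((\<lambda>i. (Suc i, 0::nat)) ` I) = card I"
    by (intro card_image) (auto simp: inj_on_def)
  moreover have "map_prod Suc Suc ` inversions I \<inter> (\<lambda>i. (Suc i, 0)) ` I = {}"
    by auto
  ultimately show ?thesis
    using assms finite_inversions by (simp add: card_Un_disjoint)
qed

lemma nths_Cons_insert_0: "nths (v # vs) (insert 0 (Suc ` I)) = v # nths vs I"
  by (simp add: nths_Cons image_iff)

lemma nths_Cons_Suc: "nths (v # vs) (Suc ` I) = nths vs I"
  by (simp add: nths_Cons image_iff)

text \<open>The subsets of positions split by whether they contain 0. In the second group the sign
  gains \<open>(-1) ^ card I\<close>, and since \<open>f\<close> lives in degree \<open>k\<close>,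
  this is \<open>(-1) ^ k\<close> in every nonzero summand.\<close>

lemma ext_prod_Cons:
  assumes "\<And>ws. length ws \<noteq> k \<Longrightarrow> f ws = 0"
  shows "ext_prod f g (v # vs) =
    ext_prod (\<lambda>ws. f (v # ws)) g vs + (-1) ^ k * ext_prod f (\<lambda>ws. g (v # ws)) vs"
proof -
  let ?n = "length vs"
  define T where "T I = (-1) ^ card (inversions I) *
    f (nths (v # vs) I) * g (nths (v # vs) ({..<Suc ?n} - I))" for I
  have [simp]: "finite I" if "I \<in> Pow {..<?n}" for I
    using that finite_subset by blast
  have lt: "{..<Suc ?n} = insert 0 (Suc ` {..<?n})"
    by (rule lessThan_Suc_eq_insert_0)
  have inj: "inj_on (image Suc) A" for A
    by (meson inj_Suc inj_image_eq_iff inj_onI)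
  have inj0: "inj_on (\<lambda>I. insert 0 (Suc ` I)) A" for A
    by (rule inj_onI) (metis Diff_insert_absorb Zero_not_Suc image_iff inj_Suc inj_image_eq_iff)
  have "ext_prod f g (v # vs) = (\<Sum>I\<in>Pow (insert 0 (Suc ` {..<?n})). T I)"
    unfolding ext_prod_def T_def inversions_def lt[symmetric] by simp
  also have "\<dots> = (\<Sum>I\<in>Pow (Suc ` {..<?n}). T I) + (\<Sum>I\<in>insert 0 ` Pow (Suc ` {..<?n}). T I)"
    unfolding Pow_insert by (rule sum.union_disjoint) auto
  also have "(\<Sum>I\<in>Pow (Suc ` {..<?n}). T I) = (\<Sum>I\<in>Pow {..<?n}. T (Suc ` I))"
    unfolding image_Pow_surj[OF refl, symmetric] by (subst sum.reindex[OF inj]) simp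
  also have "insert 0 ` Pow (Suc ` {..<?n}) = (\<lambda>I. insert 0 (Suc ` I)) ` Pow {..<?n}"
    unfolding image_Pow_surj[OF refl, symmetric] image_image ..
  also have "(\<Sum>I\<in>(\<lambda>I. insert 0 (Suc ` I)) ` Pow {..<?n}. T I) =
      (\<Sum>I\<in>Pow {..<?n}. T (insert 0 (Suc ` I)))"
    by (subst sum.reindex[OF inj0]) simp
  also have "\<dots> = ext_prod (\<lambda>ws. f (v # ws)) g vs"
  proof -
    have "{..<Suc ?n} - insert 0 (Suc ` I) = Suc ` ({..<?n} - I)" for I
      unfolding lt by auto
    then show ?thesis
      unfolding ext_prod_def T_def inversions_def[symmetric]
      by (simp add: card_inversions_insert_0 nths_Cons_insert_0 nths_Cons_Suc)
  qed
  also have "(\<Sum>I\<in>Pow {..<?n}. T (Suc ` I)) = (-1) ^ k * ext_prod f (\<lambda>ws. g (v # ws)) vs"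
    unfolding ext_prod_def sum_distrib_left
  proof (intro sum.cong refl)
    fix I assume I: "I \<in> Pow {..<?n}"
    have *: "{..<Suc ?n} - Suc ` I = insert 0 (Suc ` ({..<?n} - I))"
      unfolding lt by auto
    have "length (nths vs I) = card I"
      unfolding length_nths using I by (intro arg_cong[where f = card]) auto
    then have "f (nths vs I) = 0 \<or> card I = k"
      using assms by metis
    then show "T (Suc ` I) = (-1) ^ k * ((-1) ^ card {(i, j). i \<in> I \<and> j < i \<and> j \<notin> I} *
        f (nths vs I) * g (v # nths vs ({..<?n} - I)))"
      unfolding T_def * using I
      by (auto simp: card_inversions_Suc nths_Cons_insert_0 nths_Cons_Suc power_add
          inversions_def[symmetric])
  qed
  finally show ?thesis by simp
qed

lemma ext_prod_sum_left:
  "ext_prod (\<lambda>ws. \<Sum>p\<in>P. c p * F p ws) g vs = (\<Sum>p\<in>P. c p * ext_prod (F p) g vs)"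
  unfolding ext_prod_def sum_distrib_left
  by (subst sum.swap) (simp add: sum_distrib_left sum_distrib_right mult_ac)

lemma ext_prod_sum_right:
  "ext_prod f (\<lambda>ws. \<Sum>p\<in>P. c p * G p ws) vs = (\<Sum>p\<in>P. c p * ext_prod f (G p) vs)"
  unfolding ext_prod_def sum_distrib_left
  by (subst sum.swap) (simp add: sum_distrib_left sum_distrib_right mult_ac)

lemma sum_lessThan_add:
  fixes k l :: nat
  shows "(\<Sum>p<k + l. f p) = (\<Sum>p<k. f p) + (\<Sum>p<l. f (k + p) :: real)"
  by (induction l) (auto simp: algebra_simps)

text \<open>The generalized Laplace expansion. Induction on the columns: expanding the first column of the
  determinant corresponds to splitting the shuffles by the factor that receives the first vector.\<close>

lemma ext_prod_wedge: "ext_prod (wedge js) (wedge ks) vs = wedge (js @ ks) vs"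
proof (induction vs arbitrary: js ks)
  case Nil
  have "ext_prod (wedge js) (wedge ks) [] = wedge js [] * wedge ks []"
    unfolding ext_prod_def by simp
  also have "\<dots> = wedge (js @ ks) []"
    by (cases js; cases ks) (simp_all add: wedge_def)
  finally show ?case .
next
  case (Cons v vs)
  let ?k = "length js" and ?l = "length ks"
  have "ext_prod (wedge js) (wedge ks) (v # vs) =
      ext_prod (\<lambda>ws. wedge js (v # ws)) (wedge ks) vs +
      (-1) ^ ?k * ext_prod (wedge js) (\<lambda>ws. wedge ks (v # ws)) vs"
    by (rule ext_prod_Cons) simp
  also have "\<dots> =
      (\<Sum>p<?k. (-1) ^ p * v (js ! p) * wedge (remove_nth p js @ ks) vs) +
      (\<Sum>p<?l. (-1) ^ (?k + p) * v (ks ! p) * wedge (js @ remove_nth p ks) vs)"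
    unfolding wedge_Cons ext_prod_sum_left ext_prod_sum_right Cons.IH
    by (simp add: sum_distrib_left power_add mult_ac)
  also have "\<dots> = wedge (js @ ks) (v # vs)"
    unfolding wedge_Cons length_append sum_lessThan_add
    by (simp add: nth_append remove_nth_append1 remove_nth_append2)
  finally show ?case .
qed

section \<open>Rank and kernels\<close>

text \<open>Border the minor by a row \<open>i\<close> and a column \<open>a\<close>: the result
  exceeds the rank in size and vanishes. Its expansion along the row \<open>i\<close> expresses
  \<open>M i a\<close> by the entries in the columns \<open>C\<close>, and the coefficients,
  cofactors along that row, do not depend on \<open>i\<close>.\<close>

lemma rank_spans_cols:
  fixes M :: "'f \<Rightarrow> 'e \<Rightarrow> real"
  assumes dist: "distinct (C @ C')" "distinct (D @ D')"
    and len: "length D = length C"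
    and rank: "length C = vec_space.rank (length (D @ D'))
      (Matrix.mat (length (D @ D')) (length (C @ C')) (\<lambda>(p, q). M ((D @ D') ! p) ((C @ C') ! q)))"
    and nz: "mdet M D C \<noteq> 0"
  shows "spans_cols M (set (D @ D')) (set (C @ C')) C"
proof -
  let ?r = "length C" and ?m = "length (D @ D')" and ?n = "length (C @ C')"
  define A where "A = Matrix.mat ?m ?n (\<lambda>(p, q). M ((D @ D') ! p) ((C @ C') ! q))"
  have A: "A \<in> carrier_mat ?m ?n" by (simp add: A_def)
  define N where "N i a = Matrix.mat (Suc ?r) (Suc ?r) (\<lambda>(p, q). M ((D @ [i]) ! p) ((C @ [a]) ! q))"
    for i a
  have bordered_nth: "Determinant.det (N ((D @ D') ! i) ((C @ C') ! a)) = 0"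
    if i: "?r \<le> i" "i < ?m" and a: "?r \<le> a" "a < ?n" for i a
  proof -
    \<comment> \<open>\<open>submatrix\<close> lists its indices in increasing order;
      \<open>k\<close> is at least \<open>?r\<close>, so the border comes last.\<close>
    define pk where "pk k = insert k {0..<?r}" for k
    have restrict: "{j. j < l \<and> j \<in> pk k} = pk k" if "?r \<le> k" "k < l" for k l
      using that unfolding pk_def by auto
    have card_pk: "card (pk k) = Suc ?r" if "?r \<le> k" for k
      using that unfolding pk_def by auto
    have pick_pk: "pick (pk k) p = (if p < ?r then p else k)" if "?r \<le> k" "p < Suc ?r" for k p
    proof (cases "p < ?r")
      case True
      have "{x \<in> pk k. x < p} = {0..<p}" using that True unfolding pk_def by auto
      then have "card {x \<in> pk k. x < p} = p" by simp
      moreover have "p \<in> pk k" using True unfolding pk_def by simp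
      ultimately show ?thesis using pick_card_in_set[of p "pk k"] True by simp
    next
      case False
      have "{x \<in> pk k. x < k} = {0..<?r}" using that unfolding pk_def by auto
      then have "card {x \<in> pk k. x < k} = ?r" by simp
      moreover have "k \<in> pk k" unfolding pk_def by simp
      ultimately show ?thesis using pick_card_in_set[of k "pk k"] False that by (simp add: less_Suc_eq)
    qed
    have "submatrix A (pk i) (pk a) = N ((D @ D') ! i) ((C @ C') ! a)"
    proof (rule eq_matI)
      have dims: "dim_row A = ?m" "dim_col A = ?n" by (simp_all add: A_def)
      show "dim_row (submatrix A (pk i) (pk a)) = dim_row (N ((D @ D') ! i) ((C @ C') ! a))"
        "dim_col (submatrix A (pk i) (pk a)) = dim_col (N ((D @ D') ! i) ((C @ C') ! a))"
        unfolding dim_submatrix dims restrict[OF i] restrict[OF a] card_pk[OF i(1)] card_pk[OF a(1)]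
        by (simp_all add: N_def)
      fix p q assume "p < dim_row (N ((D @ D') ! i) ((C @ C') ! a))"
        "q < dim_col (N ((D @ D') ! i) ((C @ C') ! a))"
      then have pq: "p < Suc ?r" "q < Suc ?r" by (simp_all add: N_def)
      have "submatrix A (pk i) (pk a) $$ (p, q) = A $$ (pick (pk i) p, pick (pk a) q)"
        by (rule submatrix_index)
          (use pq in \<open>simp_all only: dims restrict[OF i] restrict[OF a] card_pk[OF i(1)] card_pk[OF a(1)]\<close>)
      then show "submatrix A (pk i) (pk a) $$ (p, q) = N ((D @ D') ! i) ((C @ C') ! a) $$ (p, q)"
        using pq i a len by (auto simp: pick_pk A_def N_def nth_append less_Suc_eq)
    qed
    moreover have "Determinant.det (submatrix A (pk i) (pk a)) = 0"
    proof (rule ccontr)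
      assume "\<not> ?thesis"
      then have "card {j. j < ?n \<and> j \<in> pk a} \<le> vec_space.rank ?m A"
        using vec_space.rank_gt_minor[OF A] by blast
      then show False
        unfolding restrict[OF a] card_pk[OF a(1)] rank[folded A_def, symmetric] by simp
    qed
    ultimately show ?thesis by simp
  qed
  \<comment> \<open>A border row that already occurs in \<open>D\<close> gives two equal rows, so
    the rank does not enter here.\<close>
  have identical: "Determinant.det (N i a) = 0" if "i \<in> set D" for i a
  proof -
    obtain p where p: "p < ?r" "D ! p = i" using \<open>i \<in> set D\<close> len by (metis in_set_conv_nth)
    show ?thesis
    proof (rule det_identical_rows[of _ "Suc ?r" p ?r])
      show "Matrix.row (N i a) p = Matrix.row (N i a) ?r"
        unfolding N_def using p len by (intro eq_vecI) (auto simp: nth_append)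
    qed (use p in \<open>auto simp: N_def\<close>)
  qed
  have bordered: "Determinant.det (N i a) = 0" if "i \<in> set (D @ D')" "a \<in> set C'" for i a
  proof (cases "i \<in> set D")
    case False
    with that have "i \<in> set D'" by simp
    then obtain k where k: "k < length D'" "D' ! k = i" by (metis in_set_conv_nth)
    obtain l where l: "l < length C'" "C' ! l = a" using \<open>a \<in> set C'\<close> by (metis in_set_conv_nth)
    show ?thesis
      using bordered_nth[of "?r + k" "?r + l"] k l len
      by (simp add: nth_append)
  qed (simp add: identical)
  \<comment> \<open>Cofactors along the last row do not see that row, so \<open>undefined\<close>
    may stand for its label.\<close>
  define cf where "cf a q = cofactor (N undefined a) ?r q" for a q
  have expand: "Determinant.det (N i a) = (\<Sum>q<?r. M i (C ! q) * cf a q) + M i a * mdet M D C" for i a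
  proof -
    have cof: "cofactor (N i a) ?r q = cf a q" if "q < Suc ?r" for q
    proof -
      have "mat_delete (N i a) ?r q = mat_delete (N undefined a) ?r q"
        unfolding mat_delete_def N_def using len that by (intro eq_matI) (auto simp: nth_append)
      then show ?thesis unfolding cf_def cofactor_def by simp
    qed
    have "mat_delete (N i a) ?r ?r = Matrix.mat ?r ?r (\<lambda>(p, q). M (D ! p) (C ! q))"
      unfolding mat_delete_def N_def using len by (intro eq_matI) (auto simp: nth_append)
    then have last: "cf a ?r = mdet M D C"
      unfolding cof[of ?r, symmetric, simplified] cofactor_def mdet_def using len
      by simp
    have "Determinant.det (N i a) = (\<Sum>q<Suc ?r. N i a $$ (?r, q) * cofactor (N i a) ?r q)"
      by (rule laplace_expansion_row) (auto simp: N_def)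
    also have "\<dots> = (\<Sum>q<Suc ?r. M i ((C @ [a]) ! q) * cf a q)"
      using cof len by (intro sum.cong refl) (auto simp: N_def nth_append)
    also have "\<dots> = (\<Sum>q<?r. M i (C ! q) * cf a q) + M i a * mdet M D C"
      using last by (simp add: nth_append)
    finally show ?thesis .
  qed
  define ix where "ix = the_inv_into {..<?r} ((!) C)"
  have ix: "ix (C ! q) = q" if "q < ?r" for q
    unfolding ix_def using the_inv_into_f_f[OF inj_on_nth[of C "{..<?r}"]] dist(1) that by simp
  \<comment> \<open>Cramer's rule for columns outside \<open>C\<close>, unit coefficients for
    columns in \<open>C\<close>.\<close>
  define G where "G c a = (if a \<in> set C then if c = a then 1 else 0 else - cf a (ix c) / mdet M D C)"
    for c a
  have "M i a = (\<Sum>c\<in>set C. M i c * G c a)" if "i \<in> set (D @ D')" "a \<in> set (C @ C')" for i a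
  proof (cases "a \<in> set C")
    case True
    then have "(\<Sum>c\<in>set C. M i c * G c a) = (\<Sum>c\<in>set C. if c = a then M i c else 0)"
      by (intro sum.cong refl) (simp add: G_def)
    then show ?thesis using True by simp
  next
    case False
    then have "a \<in> set C'" using that by simp
    then have "(\<Sum>q<?r. M i (C ! q) * cf a q) + M i a * mdet M D C = 0"
      using bordered[OF that(1)] expand by simp
    then have "M i a * mdet M D C = - (\<Sum>q<?r. M i (C ! q) * cf a q)" by linarith
    then have "M i a = - (\<Sum>q<?r. M i (C ! q) * cf a q) / mdet M D C"
      by (simp only: nonzero_eq_divide_eq[OF nz])
    moreover have "(\<Sum>c\<in>set C. M i c * G c a) = (\<Sum>q<?r. M i (C ! q) * G (C ! q) a)"
      by (rule sum_set_conv_nth) (use dist in auto)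
    moreover have "\<dots> = - (\<Sum>q<?r. M i (C ! q) * cf a q) / mdet M D C"
      using False ix by (simp add: G_def sum_divide_distrib sum_negf)
    ultimately show ?thesis by simp
  qed
  then show ?thesis unfolding spans_cols_def by blast
qed

text \<open>The coordinates in \<open>D'\<close> of an element of the left kernel determine it and can be prescribed.\<close>

lemma left_kernel_basis_length:
  fixes M :: "'f \<Rightarrow> 'e \<Rightarrow> real" and P :: "'f \<Rightarrow> 'v \<Rightarrow> real"
  assumes dist: "distinct (D @ D')" "distinct C" "distinct Vs"
    and F: "set (D @ D') = F" and CE: "set C \<subseteq> E" and len: "length D = length C"
    and nz: "mdet M D C \<noteq> 0" and spans: "spans_cols M F E C"
    and K: "K = {s. (\<forall>i. i \<notin> F \<longrightarrow> s i = 0) \<and> (\<forall>a\<in>E. (\<Sum>i\<in>F. M i a * s i) = 0)}"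
    and P: "\<And>c. c \<in> set Vs \<Longrightarrow> (\<lambda>i. P i c) \<in> K"
    and basis: "\<And>s. s \<in> K \<Longrightarrow> \<exists>!v. (\<forall>b. b \<notin> set Vs \<longrightarrow> v b = 0) \<and> s = (\<lambda>i. \<Sum>c\<in>set Vs. P i c * v c)"
  shows "length Vs = length D'"
proof -
  have "distinct D" using dist(1) by simp
  obtain B :: "'e \<Rightarrow> 'f \<Rightarrow> real" where B:
    "\<And>d d'. d \<in> set D \<Longrightarrow> d' \<in> set D \<Longrightarrow> (\<Sum>c\<in>set C. M d c * B c d') = (if d = d' then 1 else 0)"
    "\<And>c c'. c \<in> set C \<Longrightarrow> c' \<in> set C \<Longrightarrow> (\<Sum>d\<in>set D. B c d * M d c') = (if c = c' then 1 else 0)"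
    using mdet_inverse[OF nz len dist(2) \<open>distinct D\<close>] by blast
  have F_split: "(\<Sum>i\<in>F. f i) = (\<Sum>i\<in>set D. f i) + (\<Sum>i\<in>set D'. f i)" for f :: "'f \<Rightarrow> real"
    unfolding F[symmetric] set_append by (rule sum.union_disjoint) (use dist(1) in auto)
  obtain G where G: "\<forall>i\<in>F. \<forall>a\<in>E. M i a = (\<Sum>c\<in>set C. M i c * G c a)"
    using spans unfolding spans_cols_def by blast
  have determined: "s = (\<lambda>i. 0)" if "s \<in> K" and D': "\<And>i. i \<in> set D' \<Longrightarrow> s i = 0" for s
  proof
    fix d
    show "s d = 0"
    proof (cases "d \<in> set D")
      case True
      have "s d = (\<Sum>d'\<in>set D. (if d' = d then 1 else 0) * s d')"
        using True by (simp add: if_distrib[of "\<lambda>x. x * _"] cong: if_cong)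
      also have "\<dots> = (\<Sum>d'\<in>set D. (\<Sum>c\<in>set C. M d' c * B c d) * s d')"
        using True B(1) by (intro sum.cong) auto
      also have "\<dots> = (\<Sum>c\<in>set C. B c d * (\<Sum>d'\<in>set D. M d' c * s d'))"
        by (simp add: sum_distrib_left sum_distrib_right mult_ac) (rule sum.swap)
      also have "\<dots> = 0"
      proof (intro sum.neutral ballI)
        fix c assume "c \<in> set C"
        then have "(\<Sum>i\<in>F. M i c * s i) = 0" using \<open>s \<in> K\<close> CE unfolding K by auto
        then show "B c d * (\<Sum>d'\<in>set D. M d' c * s d') = 0"
          unfolding F_split using D' by simp
      qed
      finally show ?thesis .
    next
      case False
      then show ?thesis using that F unfolding K by (cases "d \<in> F") auto
    qed
  qed
  \<comment> \<open>The kernel vector whose coordinates in \<open>D'\<close> are the unit vector at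
    \<open>j\<close>; its coordinates in \<open>D\<close> solve the equations for the columns in
    \<open>C\<close> by means of \<open>B\<close>.\<close>
  define ev where "ev j i = (if i \<in> set D then - (\<Sum>c\<in>set C. M j c * B c i)
    else if i = j then 1 else 0)" for j i
  have ev: "ev j \<in> K" if j: "j \<in> set D'" for j
  proof -
    have C: "(\<Sum>i\<in>F. M i c' * ev j i) = 0" if c': "c' \<in> set C" for c'
    proof -
      have "(\<Sum>i\<in>set D. M i c' * ev j i) = - (\<Sum>c\<in>set C. M j c * (\<Sum>d\<in>set D. B c d * M d c'))"
        by (simp add: ev_def sum_distrib_left sum_negf mult_ac) (rule sum.swap)
      also have "\<dots> = - (\<Sum>c\<in>set C. M j c * (if c = c' then 1 else 0))"
        using B(2) c' by simp
      also have "\<dots> = - M j c'" using c' by (simp add: if_distrib cong: if_cong)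
      finally have 1: "(\<Sum>i\<in>set D. M i c' * ev j i) = - M j c'" .
      have "(\<Sum>i\<in>set D'. M i c' * ev j i) = (\<Sum>i\<in>set D'. M i c' * (if i = j then 1 else 0))"
        using dist(1) by (intro sum.cong) (auto simp: ev_def)
      also have "\<dots> = M j c'" using j by (simp add: if_distrib cong: if_cong)
      finally show ?thesis unfolding F_split using 1 by simp
    qed
    have "(\<Sum>i\<in>F. M i a * ev j i) = 0" if "a \<in> E" for a
    proof -
      have "(\<Sum>i\<in>F. M i a * ev j i) = (\<Sum>i\<in>F. (\<Sum>c\<in>set C. M i c * G c a) * ev j i)"
        using G that by (intro sum.cong) auto
      also have "\<dots> = (\<Sum>c\<in>set C. G c a * (\<Sum>i\<in>F. M i c * ev j i))"
        by (simp add: sum_distrib_left sum_distrib_right mult_ac) (rule sum.swap)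
      also have "\<dots> = 0" using C by simp
      finally show ?thesis .
    qed
    moreover have "ev j i = 0" if "i \<notin> F" for i
      using that j F unfolding ev_def by auto
    ultimately show ?thesis unfolding K by simp
  qed
  have ev_D': "ev j i = (if i = j then 1 else 0)" if "i \<in> set D'" for j i
    using that dist(1) unfolding ev_def by auto
  have "\<forall>j. \<exists>v. j \<in> set D' \<longrightarrow> ev j = (\<lambda>i. \<Sum>c\<in>set Vs. P i c * v c)"
    using basis[OF ev] by metis
  then obtain w where w: "\<And>j. j \<in> set D' \<Longrightarrow> ev j = (\<lambda>i. \<Sum>c\<in>set Vs. P i c * w j c)"
    by metis
  have PW: "(\<Sum>c\<in>set Vs. P i c * w j c) = (if i = j then 1 else 0)"
    if "i \<in> set D'" "j \<in> set D'" for i j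
    using fun_cong[OF w[OF that(2)], of i] ev_D'[OF that(1)] by simp
  have WP: "(\<Sum>j\<in>set D'. w j c' * P j c) = (if c' = c then 1 else 0)"
    if c: "c \<in> set Vs" and c': "c' \<in> set Vs" for c c'
  proof -
    define v where "v b = (if b \<in> set Vs then \<Sum>j\<in>set D'. w j b * P j c else 0)" for b
    define u where "u b = (if b = c then 1 else 0 :: real)" for b
    \<comment> \<open>The column \<open>c\<close> minus the combination of the \<open>ev j\<close>
      with the same coordinates in \<open>D'\<close>: a kernel vector whose coordinates in
      \<open>D'\<close> vanish, hence zero by \<open>determined\<close>.\<close>
    define s where "s i = P i c - (\<Sum>j\<in>set D'. P j c * ev j i)" for i
    have "s \<in> K"
    proof -
      have "(\<Sum>i\<in>F. M i a * s i) = 0" if "a \<in> E" for a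
      proof -
        have "(\<Sum>i\<in>F. M i a * s i) =
            (\<Sum>i\<in>F. M i a * P i c) - (\<Sum>j\<in>set D'. P j c * (\<Sum>i\<in>F. M i a * ev j i))"
          unfolding s_def
          by (simp add: right_diff_distrib sum_subtractf sum_distrib_left mult_ac) (rule sum.swap)
        also have "\<dots> = 0"
          using P[OF c] ev that unfolding K by simp
        finally show ?thesis .
      qed
      moreover have "s i = 0" if "i \<notin> F" for i
        using P[OF c] ev that unfolding K s_def by simp
      ultimately show ?thesis unfolding K by simp
    qed
    moreover have "s i = 0" if "i \<in> set D'" for i
      using that by (simp add: s_def ev_D' if_distrib cong: if_cong)
    ultimately have "s = (\<lambda>i. 0)" by (rule determined)
    then have Pe: "P i c = (\<Sum>j\<in>set D'. P j c * ev j i)" for i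
      unfolding s_def by (metis eq_iff_diff_eq_0)
    have 1: "(\<lambda>i. P i c) = (\<lambda>i. \<Sum>b\<in>set Vs. P i b * v b)"
    proof
      fix i
      have "P i c = (\<Sum>j\<in>set D'. P j c * (\<Sum>b\<in>set Vs. P i b * w j b))"
        unfolding Pe[of i] using w by (intro sum.cong refl) simp
      also have "\<dots> = (\<Sum>b\<in>set Vs. P i b * v b)"
        by (simp add: v_def sum_distrib_left mult_ac) (rule sum.swap)
      finally show "P i c = (\<Sum>b\<in>set Vs. P i b * v b)" .
    qed
    have 2: "(\<lambda>i. P i c) = (\<lambda>i. \<Sum>b\<in>set Vs. P i b * u b)"
      using c by (simp add: u_def if_distrib cong: if_cong)
    \<comment> \<open>Both express the column \<open>c\<close> in the basis of columns, where
      coordinates are unique.\<close>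
    have "v = u"
    proof -
      have "\<forall>b. b \<notin> set Vs \<longrightarrow> v b = 0" "\<forall>b. b \<notin> set Vs \<longrightarrow> u b = 0"
        using c by (auto simp: v_def u_def)
      with basis[OF P[OF c]] 1 2 show ?thesis by blast
    qed
    then have "v c' = u c'" by simp
    then show ?thesis using c' unfolding v_def u_def by simp
  qed
  \<comment> \<open>\<open>PW\<close> and \<open>WP\<close> say that two matrices are inverse to
    each other; if the lengths differed, a unit matrix would factor through too few labels.\<close>
  have "\<not> length Vs < length D'"
  proof
    assume "length Vs < length D'"
    then have "mdet (\<lambda>i j. \<Sum>c\<in>set Vs. P i c * w j c) D' D' = 0"
      by (intro mdet_mult_thin) (use dist in auto)
    moreover have "mdet (\<lambda>i j. \<Sum>c\<in>set Vs. P i c * w j c) D' D' = mdet (\<lambda>i j. if i = j then 1 else 0) D' D'"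
      by (intro mdet_cong) (simp add: PW)
    ultimately show False using dist(1) by simp
  qed
  moreover have "\<not> length D' < length Vs"
  proof
    assume "length D' < length Vs"
    then have "mdet (\<lambda>c' c. \<Sum>j\<in>set D'. w j c' * P j c) Vs Vs = 0"
      by (intro mdet_mult_thin) (use dist in auto)
    moreover have "mdet (\<lambda>c' c. \<Sum>j\<in>set D'. w j c' * P j c) Vs Vs = mdet (\<lambda>i j. if i = j then 1 else 0) Vs Vs"
      by (intro mdet_cong) (simp add: WP)
    ultimately show False using dist(3) by simp
  qed
  ultimately show ?thesis by simp
qed

section \<open>Rank one extensions of a matrix\<close>

text \<open>Row \<open>f0\<close> is \<open>K f0\<close> times \<open>lam\<close>, so subtracting
  \<open>K i / K f0\<close> times it from row \<open>i\<close> removes the rank one term.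
  \<open>U\<close> undoes these row operations and has determinant 1; \<open>T\<close> is the
  reduced matrix, in which only row \<open>f0\<close> has an entry in column
  \<open>e0\<close>.\<close>

lemma mdet_rank_one_extension:
  assumes "length D = length C" "distinct D" "f0 \<notin> set D" "e0 \<notin> set C" "K f0 \<noteq> (0 :: real)"
    and MY: "\<And>i a. i \<in> set D \<Longrightarrow> a \<in> set C \<Longrightarrow> MY i a = M i a + K i * lam a"
      "\<And>a. a \<in> insert e0 (set C) \<Longrightarrow> MY f0 a = K f0 * lam a"
      "\<And>i. i \<in> set D \<Longrightarrow> MY i e0 = K i * lam e0"
  shows "mdet MY (D @ [f0]) (C @ [e0]) = mdet M D C * (K f0 * lam e0)"
proof -
  define U where "U r k = (if r = k then 1 else if k = f0 then K r / K f0 else 0)" for r k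
  define T where "T k c = (if k = f0 then K f0 * lam c else if c = e0 then 0 else M k c)" for k c
  have "mdet MY (D @ [f0]) (C @ [e0]) =
      mdet (\<lambda>r c. \<Sum>k\<in>set (D @ [f0]). U r k * T k c) (D @ [f0]) (C @ [e0])"
  proof (intro mdet_cong)
    fix r c assume r: "r \<in> set (D @ [f0])" and c: "c \<in> set (C @ [e0])"
    have "(\<Sum>k\<in>set (D @ [f0]). U r k * T k c) = U r f0 * T f0 c + (\<Sum>k\<in>set D. U r k * T k c)"
      using assms(3) by simp
    also have "(\<Sum>k\<in>set D. U r k * T k c) = (\<Sum>k\<in>set D. if r = k then T k c else 0)"
      using assms(3) by (intro sum.cong) (auto simp: U_def)
    finally show "MY r c = (\<Sum>k\<in>set (D @ [f0]). U r k * T k c)"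
      using r c assms by (auto simp: U_def T_def)
  qed
  also have "\<dots> = mdet U (D @ [f0]) (D @ [f0]) * mdet T (D @ [f0]) (C @ [e0])"
    by (rule mdet_mult) (use assms in auto)
  also have "mdet U (D @ [f0]) (D @ [f0]) = mdet U D D * mdet U [f0] [f0]"
    by (rule mdet_block') (use assms in \<open>auto simp: U_def\<close>)
  also have "mdet U D D = mdet (\<lambda>r c. if r = c then 1 else 0) D D"
    using assms(3) by (intro mdet_cong) (auto simp: U_def)
  also have "mdet T (D @ [f0]) (C @ [e0]) = mdet T D C * mdet T [f0] [e0]"
    by (rule mdet_block) (use assms in \<open>auto simp: T_def\<close>)
  also have "mdet T D C = mdet M D C"
    using assms(3,4) by (intro mdet_cong) (auto simp: T_def)
  finally show ?thesis using assms(2) by (simp add: U_def T_def)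
qed

text \<open>The linear algebra of the move without its geometry. \<open>M\<close> and
  \<open>MY\<close> stand for the derivatives of the deficit angles before and after,
  \<open>P\<close> and \<open>PY\<close> for those of the areas by the deviations; \<open>f0\<close>
  is the face \<open>ABC\<close>, \<open>fs\<close> the other three new faces, \<open>e0\<close> the
  edge \<open>AB\<close>, \<open>new\<close> the three components of its deviation. \<open>K\<close>
  and \<open>lam\<close> are the two factors of the rank one change.\<close>

locale rank_one_extension =
  fixes M MY :: "'f \<Rightarrow> 'e \<Rightarrow> real" and P PY :: "'f \<Rightarrow> 'v \<Rightarrow> real"
    and F F' :: "'f set" and E E' :: "'e set" and f0 :: 'f and fs :: "'f list" and e0 :: 'e
    and K :: "'f \<Rightarrow> real" and lam :: "'e \<Rightarrow> real" and Vs new :: "'v list"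
    and C C' C2 C2' :: "'e list" and D D' D2 D2' :: "'f list"
  assumes E': "E' = insert e0 E" "e0 \<notin> E"
    and F': "F' = F \<union> set (f0 # fs)" "F \<inter> set (f0 # fs) = {}" "distinct (f0 # fs)"
    and MY_old: "\<And>i a. i \<in> F \<Longrightarrow> a \<in> E \<Longrightarrow> MY i a = M i a + K i * lam a"
    and MY_new: "\<And>i a. i \<in> F' \<Longrightarrow> a \<in> E' \<Longrightarrow> i \<notin> F \<or> a = e0 \<Longrightarrow> MY i a = K i * lam a"
    and nonzero: "K f0 \<noteq> 0" "lam e0 \<noteq> 0"
    and length_new: "length new = length fs"
    and P_old: "\<And>i c. i \<in> F \<Longrightarrow> c \<in> set Vs \<Longrightarrow> PY i c = P i c"
    and P_new: "\<And>i c. i \<in> F \<Longrightarrow> c \<in> set new \<Longrightarrow> PY i c = 0"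
    and K_PY: "\<And>c. c \<in> set (Vs @ new) \<Longrightarrow> (\<Sum>i\<in>F'. K i * PY i c) = 0"
    and M_P: "\<And>a c. a \<in> E \<Longrightarrow> c \<in> set Vs \<Longrightarrow> (\<Sum>i\<in>F. M i a * P i c) = 0"
    and CD: "distinct (C @ C')" "set (C @ C') = E" "distinct (D @ D')" "set (D @ D') = F"
      "length D = length C" "mdet M D C \<noteq> 0" "spans_cols M F E C"
    and CD2: "distinct (C2 @ C2')" "set (C2 @ C2') = E'" "distinct (D2 @ D2')" "set (D2 @ D2') = F'"
      "length D2 = length C2" "mdet MY D2 C2 \<noteq> 0" "spans_cols MY F' E' C2"
    and length_Vs: "length Vs = length D'"
begin

lemma finite_F: "finite F" "finite F'"
  using CD(4) CD2(4) by (metis List.finite_set)+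

lemma minor_extension: "mdet MY (D @ [f0]) (C @ [e0]) = mdet M D C * (K f0 * lam e0)"
proof (rule mdet_rank_one_extension)
  have "set D \<subseteq> F" "set C \<subseteq> E" using CD by auto
  then show "\<And>i a. i \<in> set D \<Longrightarrow> a \<in> set C \<Longrightarrow> MY i a = M i a + K i * lam a"
    "\<And>a. a \<in> insert e0 (set C) \<Longrightarrow> MY f0 a = K f0 * lam a"
    "\<And>i. i \<in> set D \<Longrightarrow> MY i e0 = K i * lam e0"
    "f0 \<notin> set D" "e0 \<notin> set C"
    using MY_old MY_new E' F' by auto
qed (use CD nonzero in auto)

text \<open>Combining columns with \<open>G\<close> reproduces the part of \<open>MY\<close> that
  comes from \<open>M\<close> but misses the rank one part by a multiple of \<open>K\<close>; the
  column of \<open>e0\<close> is itself a multiple of \<open>K\<close> and corrects this.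
  \<open>M'\<close> extends \<open>M\<close> by zero to the new faces, so that one formula covers
  all rows.\<close>

lemma spans_extension: "spans_cols MY F' E' (C @ [e0])"
proof -
  have CE: "set C \<subseteq> E" using CD by auto
  then have e0C: "e0 \<notin> set C" using E' by auto
  obtain G where G: "\<forall>i\<in>F. \<forall>a\<in>E. M i a = (\<Sum>c\<in>set C. M i c * G c a)"
    using CD(7) unfolding spans_cols_def by blast
  define H where "H c a = (if c = e0 then if a = e0 then 1 else
      (lam a - (\<Sum>b\<in>set C. lam b * G b a)) / lam e0 else if a = e0 then 0 else G c a)" for c a
  have "MY i a = (\<Sum>c\<in>set (C @ [e0]). MY i c * H c a)" if i: "i \<in> F'" and a: "a \<in> E'" for i a
  proof -
    define M' where "M' i a = (if i \<in> F then M i a else 0)" for i a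
    have MY': "MY i a = M' i a + K i * lam a" if "a \<in> E" for a
      using MY_old MY_new that i E' by (auto simp: M'_def)
    have M': "M' i a = (\<Sum>c\<in>set C. M' i c * G c a)" if "a \<in> E"
      using G that by (auto simp: M'_def)
    have 0: "MY i e0 = K i * lam e0" using MY_new i E' by auto
    have "(\<Sum>c\<in>set (C @ [e0]). MY i c * H c a) = MY i e0 * H e0 a + (\<Sum>c\<in>set C. MY i c * H c a)"
      using e0C by simp
    also have "(\<Sum>c\<in>set C. MY i c * H c a) =
        (\<Sum>c\<in>set C. (M' i c + K i * lam c) * (if a = e0 then 0 else G c a))"
      using e0C CE MY' by (intro sum.cong) (auto simp: H_def)
    also have "MY i e0 * H e0 a + \<dots> = MY i a"
    proof (cases "a = e0")
      case False
      then have "a \<in> E" using a E' by simp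
      have "(\<Sum>c\<in>set C. (M' i c + K i * lam c) * G c a) = M' i a + K i * (\<Sum>c\<in>set C. lam c * G c a)"
        by (subst M'[OF \<open>a \<in> E\<close>]) (simp add: algebra_simps sum.distrib sum_distrib_left)
      then show ?thesis
        using False MY'[OF \<open>a \<in> E\<close>] 0 nonzero by (simp add: H_def field_simps)
    qed (simp add: H_def)
    finally show ?thesis by simp
  qed
  then show ?thesis unfolding spans_cols_def by blast
qed

text \<open>Both \<open>C2\<close> and \<open>C @ [e0]\<close> span and carry nonzero minors, so
  \<open>spans_cols_length_le\<close> applies in both directions: the rank grows by exactly
  one.\<close>

lemma length_C2: "length C2 = Suc (length C)"
proof -
  have "distinct (C @ [e0])" "set (C @ [e0]) \<subseteq> E'" "set (D @ [f0]) \<subseteq> F'"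
    using CD E' F' by auto
  moreover have "mdet MY (D @ [f0]) (C @ [e0]) \<noteq> 0"
    unfolding minor_extension using CD nonzero by simp
  ultimately have "length (C @ [e0]) \<le> length C2" "length C2 \<le> length (C @ [e0])"
    using spans_cols_length_le[OF CD2(7), of "D @ [f0]" "C @ [e0]"]
      spans_cols_length_le[OF spans_extension, of D2 C2] CD2 CD by auto
  then show ?thesis by simp
qed

text \<open>The number of edges and the rank both grow by one; thus the length forms before and
  after the move have the same degree, as forgetting \<open>e0\<close> requires.\<close>

lemma length_C2': "length C2' = length C'"
proof -
  have "length (C2 @ C2') = Suc (length (C @ C'))"
    by (metis CD(1,2) CD2(1,2) E' List.finite_set card_insert_disjoint distinct_card)
  then show ?thesis using length_C2 by simp
qed

text \<open>The new faces outnumber the growth of the rank by \<open>length fs\<close>, which is the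
  number of new deviation components.\<close>

lemma length_D2': "length D2' = length (Vs @ new)"
proof -
  have "length (D2 @ D2') = length (D @ D') + length (f0 # fs)"
    using F' CD(3,4) CD2(3,4) finite_F
    by (metis List.finite_set card_Un_disjoint distinct_card)
  then show ?thesis using length_C2 CD CD2 length_Vs length_new by simp
qed

text \<open>The rank one part is annihilated by \<open>K_PY\<close>. What remains involves old faces
  and old edges only: old columns lie in the old kernel, and new columns vanish on old
  faces.\<close>

lemma PY_kernel: "(\<Sum>i\<in>F'. MY i a * PY i c) = 0" if "a \<in> E'" "c \<in> set (Vs @ new)"
proof -
  define M' where "M' i = (if i \<in> F \<and> a \<in> E then M i a else 0)" for i
  have "(\<Sum>i\<in>F'. MY i a * PY i c) = (\<Sum>i\<in>F'. M' i * PY i c + lam a * (K i * PY i c))"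
  proof (intro sum.cong refl)
    fix i assume "i \<in> F'"
    then have "MY i a = M' i + K i * lam a"
      using MY_old MY_new that E' by (auto simp: M'_def)
    then show "MY i a * PY i c = M' i * PY i c + lam a * (K i * PY i c)"
      by (simp add: algebra_simps)
  qed
  also have "\<dots> = (\<Sum>i\<in>F'. M' i * PY i c)"
    using K_PY[OF that(2)] by (simp add: sum.distrib flip: sum_distrib_left)
  also have "\<dots> = (\<Sum>i\<in>F. M' i * PY i c)"
    using F' finite_F by (intro sum.mono_neutral_right) (auto simp: M'_def)
  also have "\<dots> = 0"
  proof (cases "a \<in> E \<and> c \<in> set Vs")
    case True
    then have "(\<Sum>i\<in>F. M' i * PY i c) = (\<Sum>i\<in>F. M i a * P i c)"
      using P_old by (intro sum.cong) (auto simp: M'_def)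
    then show ?thesis using M_P True by simp
  next
    case False
    then show ?thesis using P_new that by (intro sum.neutral) (auto simp: M'_def)
  qed
  finally show ?thesis .
qed

text \<open>The given choice after the move is traded for \<open>C @ [e0]\<close> and
  \<open>D @ [f0]\<close>, whose complements are \<open>C'\<close> and \<open>D' @ fs\<close>. There
  the minor is known, and the area matrix is block triangular because the new columns vanish on
  \<open>D'\<close>.\<close>

lemma mdet_extension:
  "\<exists>e\<in>{1, -1 :: real}. \<forall>(W :: 'e \<Rightarrow> 'm \<Rightarrow> real) N. length N = length C' \<longrightarrow>
     (\<forall>i\<in>F'. \<forall>n\<in>set N. (\<Sum>a\<in>E'. MY i a * W a n) = 0) \<longrightarrow>
     mdet W C2' N * mdet PY D2' (Vs @ new) / mdet MY D2 C2 =
     e * (mdet W C' N * (mdet P D' Vs * mdet PY fs new) / (mdet M D C * (K f0 * lam e0)))"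
proof -
  have C: "distinct ((C @ [e0]) @ C')" "set ((C @ [e0]) @ C') = E'"
    using CD E' by auto
  have D: "distinct ((D @ [f0]) @ (D' @ fs))" "set ((D @ [f0]) @ (D' @ fs)) = F'"
    using CD F' by auto
  have lens: "length (D @ [f0]) = length (C @ [e0])" "length D2 = length (C @ [e0])"
    "length C2 = length (C @ [e0])"
    using CD CD2 length_C2 by auto
  have nz: "mdet MY (D @ [f0]) (C @ [e0]) \<noteq> 0"
    unfolding minor_extension using CD nonzero by simp
  obtain e :: real where e: "e \<in> {1, -1}"
    "\<forall>(W :: 'e \<Rightarrow> 'm \<Rightarrow> real) (S :: 'f \<Rightarrow> 'v \<Rightarrow> real) N N'.
       length N = length C' \<longrightarrow> length N' = length (D' @ fs) \<longrightarrow>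
       (\<forall>i\<in>F'. \<forall>n\<in>set N. (\<Sum>a\<in>E'. MY i a * W a n) = 0) \<longrightarrow>
       (\<forall>a\<in>E'. \<forall>n\<in>set N'. (\<Sum>i\<in>F'. MY i a * S i n) = 0) \<longrightarrow>
       mdet W C2' N * mdet S D2' N' / mdet MY D2 C2 =
       e * (mdet W C' N * mdet S (D' @ fs) N' / mdet MY (D @ [f0]) (C @ [e0]))"
    using mdet_independent_of_choice[OF C CD2(1,2) D CD2(3,4) lens nz CD2(6,7)] by blast
  show ?thesis
  proof (rule bexI[OF _ e(1)], intro allI impI)
    fix W :: "'e \<Rightarrow> 'm \<Rightarrow> real" and N
    assume N: "length N = length C'" and W: "\<forall>i\<in>F'. \<forall>n\<in>set N. (\<Sum>a\<in>E'. MY i a * W a n) = 0"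
    have "mdet W C2' N * mdet PY D2' (Vs @ new) / mdet MY D2 C2 =
       e * (mdet W C' N * mdet PY (D' @ fs) (Vs @ new) / mdet MY (D @ [f0]) (C @ [e0]))"
      by (rule e(2)[rule_format]) (use N W PY_kernel length_Vs length_new in auto)
    also have "mdet PY (D' @ fs) (Vs @ new) = mdet PY D' Vs * mdet PY fs new"
      by (rule mdet_block) (use length_Vs length_new P_new CD in auto)
    also have "mdet PY D' Vs = mdet P D' Vs"
      using P_old CD by (intro mdet_cong) auto
    finally show "mdet W C2' N * mdet PY D2' (Vs @ new) / mdet MY D2 C2 =
       e * (mdet W C' N * (mdet P D' Vs * mdet PY fs new) / (mdet M D C * (K f0 * lam e0)))"
      unfolding minor_extension .
  qed
qed

end

section \<open>Simplices in four-space\<close>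

definition det4 :: "real^4 \<Rightarrow> real^4 \<Rightarrow> real^4 \<Rightarrow> real^4 \<Rightarrow> real" where
  "det4 u v w z = Determinants.det (vector [u, v, w, z] :: real^4^4)"

lemma vector_4 [simp]:
  "(vector [x, y, z, w] :: 'a::zero^4) $ 1 = x"
  "(vector [x, y, z, w] :: 'a::zero^4) $ 2 = y"
  "(vector [x, y, z, w] :: 'a::zero^4) $ 3 = z"
  "(vector [x, y, z, w] :: 'a::zero^4) $ 4 = w"
  unfolding vector_def by auto

lemma det_4:
  "Determinants.det (A :: real^4^4) =
    A$1$1 * (A$2$2 * (A$3$3 * A$4$4 - A$3$4 * A$4$3) - A$2$3 * (A$3$2 * A$4$4 - A$3$4 * A$4$2) +
             A$2$4 * (A$3$2 * A$4$3 - A$3$3 * A$4$2)) -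
    A$1$2 * (A$2$1 * (A$3$3 * A$4$4 - A$3$4 * A$4$3) - A$2$3 * (A$3$1 * A$4$4 - A$3$4 * A$4$1) +
             A$2$4 * (A$3$1 * A$4$3 - A$3$3 * A$4$1)) +
    A$1$3 * (A$2$1 * (A$3$2 * A$4$4 - A$3$4 * A$4$2) - A$2$2 * (A$3$1 * A$4$4 - A$3$4 * A$4$1) +
             A$2$4 * (A$3$1 * A$4$2 - A$3$2 * A$4$1)) -
    A$1$4 * (A$2$1 * (A$3$2 * A$4$3 - A$3$3 * A$4$2) - A$2$2 * (A$3$1 * A$4$3 - A$3$3 * A$4$1) +
             A$2$3 * (A$3$1 * A$4$2 - A$3$2 * A$4$1))"
proof -
  have f1234: "finite {2::4, 3, 4}" "1 \<notin> {2::4, 3, 4}" by auto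
  have f234: "finite {3::4, 4}" "2 \<notin> {3::4, 4}" by auto
  have f34: "finite {4::4}" "3 \<notin> {4::4}" by auto
  show ?thesis
    unfolding Determinants.det_def UNIV_4
    unfolding sum_over_permutations_insert[OF f1234] sum_over_permutations_insert[OF f234]
      sum_over_permutations_insert[OF f34]
    unfolding permutes_sing
    by (simp add: sign_swap_id permutation_swap_id sign_compose sign_id swap_id_eq permutation_compose)
      (simp add: field_simps)
qed

lemma det4_eq:
  "det4 u v w z =
    u$1 * (v$2 * (w$3 * z$4 - w$4 * z$3) - v$3 * (w$2 * z$4 - w$4 * z$2) +
             v$4 * (w$2 * z$3 - w$3 * z$2)) -
    u$2 * (v$1 * (w$3 * z$4 - w$4 * z$3) - v$3 * (w$1 * z$4 - w$4 * z$1) +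
             v$4 * (w$1 * z$3 - w$3 * z$1)) +
    u$3 * (v$1 * (w$2 * z$4 - w$4 * z$2) - v$2 * (w$1 * z$4 - w$4 * z$1) +
             v$4 * (w$1 * z$2 - w$2 * z$1)) -
    u$4 * (v$1 * (w$2 * z$3 - w$3 * z$2) - v$2 * (w$1 * z$3 - w$3 * z$1) +
             v$3 * (w$1 * z$2 - w$2 * z$1))"
  unfolding det4_def det_4 by simp

lemma det4_add: "det4 u v w (x + y) = det4 u v w x + det4 u v w y"
  unfolding det4_eq by (simp add: algebra_simps)

lemma det4_scale: "det4 u v w (c *\<^sub>R x) = c * det4 u v w x"
  unfolding det4_eq by (simp add: algebra_simps)

lemma linear_det4: "linear (det4 u v w)"
  by (intro linearI) (simp_all add: det4_add det4_scale)

lemma det4_swap: "det4 v u w z = - det4 u v w z" "det4 u w v z = - det4 u v w z"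
  "det4 u v z w = - det4 u v w z"
  unfolding det4_eq by (simp_all add: algebra_simps)

lemma det4_diff:
  "det4 u v w (x - y) = det4 u v w x - det4 u v w y"
  "det4 u v (x - y) w = det4 u v x w - det4 u v y w"
  "det4 u (x - y) v w = det4 u x v w - det4 u y v w"
proof -
  show 1: "det4 u v w (x - y) = det4 u v w x - det4 u v w y" for u v w
    by (rule linear_diff[OF linear_det4])
  show 2: "det4 u v (x - y) w = det4 u v x w - det4 u v y w" for u v w
    using 1[of u v w] det4_swap(3)[of u v "x - y" w] det4_swap(3)[of u v x w]
      det4_swap(3)[of u v y w] by linarith
  show "det4 u (x - y) v w = det4 u x v w - det4 u y v w"
    using 2[of u v w] det4_swap(2)[of u "x - y" v w] det4_swap(2)[of u x v w]
      det4_swap(2)[of u y v w] by linarith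
qed

lemma det4_repeat [simp]:
  "det4 u u v w = 0" "det4 u v u w = 0" "det4 u v w u = 0" "det4 u v v w = 0" "det4 u v w v = 0"
  "det4 u v w w = 0"
proof -
  show 1: "det4 u u v w = 0" for u v w using det4_swap(1)[of u u v w] by linarith
  show 2: "det4 u v u w = 0" for u v w using det4_swap(2)[of u v u w] 1 by simp
  show "det4 u v w u = 0" using det4_swap(3)[of u v u w] 2 by simp
  show 3: "det4 u v v w = 0" for u v w using det4_swap(2)[of u v v w] by linarith
  show "det4 u v w v = 0" using det4_swap(3)[of u v v w] 3 by simp
  show "det4 u v w w = 0" using det4_swap(3)[of u v w w] by linarith
qed

lemma det4_shear: "det4 u v (w - s *\<^sub>R u - t *\<^sub>R v) (z - s' *\<^sub>R u - t' *\<^sub>R v) = det4 u v w z"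
proof -
  have 1: "det4 u v w (z - s' *\<^sub>R u - t' *\<^sub>R v) = det4 u v w z" for w z s' t'
    by (simp add: det4_diff det4_scale)
  show ?thesis
    using 1[of z w s t] 1[of "w - s *\<^sub>R u - t *\<^sub>R v" z s' t']
      det4_swap(3)[of u v "w - s *\<^sub>R u - t *\<^sub>R v" z] det4_swap(3)[of u v w z] by linarith
qed

lemma det4_matrix: "det4 (R *v u) (R *v v) (R *v w) (R *v z) = Determinants.det R * det4 u v w z"
proof -
  let ?B = "vector [R *v u, R *v v, R *v w, R *v z] :: real^4^4"
  let ?A = "vector [u, v, w, z] :: real^4^4"
  have "?B $ i = R *v (?A $ i)" for i
    using exhaust_4[of i] by auto
  then have "?B $ i $ j = (?A ** transpose R) $ i $ j" for i j
    by (simp add: matrix_matrix_mult_def matrix_vector_mult_def transpose_def mult_ac)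
  then have "?B = ?A ** transpose R"
    by (simp add: Finite_Cartesian_Product.vec_eq_iff)
  then show ?thesis
    unfolding det4_def by (simp add: Determinants.det_mul Determinants.det_transpose)
qed

text \<open>The square is the Gram determinant, which splits into two blocks because
  \<open>u, v\<close> are orthogonal to \<open>h, k\<close>.\<close>

lemma det4_gram:
  assumes "u \<bullet> h = 0" "u \<bullet> k = 0" "v \<bullet> h = 0" "v \<bullet> k = 0"
  shows "(det4 u v h k)\<^sup>2 =
    ((u \<bullet> u) * (v \<bullet> v) - (u \<bullet> v)\<^sup>2) * ((h \<bullet> h) * (k \<bullet> k) - (h \<bullet> k)\<^sup>2)"
proof -
  let ?A = "vector [u, v, h, k] :: real^4^4"
  have entry: "(?A ** transpose ?A) $ i $ j = ?A $ i \<bullet> ?A $ j" for i j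
    by (simp add: matrix_matrix_mult_def transpose_def inner_vec_def)
  have "(det4 u v h k)\<^sup>2 = Determinants.det (?A ** transpose ?A)"
    by (simp add: det4_def Determinants.det_mul Determinants.det_transpose power2_eq_square)
  also have "\<dots> = ((u \<bullet> u) * (v \<bullet> v) - (u \<bullet> v)\<^sup>2) * ((h \<bullet> h) * (k \<bullet> k) - (h \<bullet> k)\<^sup>2)"
    unfolding det_4 entry
    using assms by (simp add: inner_commute algebra_simps power2_eq_square)
  finally show ?thesis .
qed

section \<open>Oriented volumes and affine dependencies\<close>

text \<open>24 times the signed volume of the simplex.\<close>

definition orvol :: "real^4 \<Rightarrow> real^4 \<Rightarrow> real^4 \<Rightarrow> real^4 \<Rightarrow> real^4 \<Rightarrow> real" where
  "orvol a b c d e = det4 (b - a) (c - a) (d - a) (e - a)"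

text \<open>Only the first exchange moves the base point \<open>a\<close>; the others swap rows of
  the determinant.\<close>

lemma orvol_swap:
  "orvol b a c d e = - orvol a b c d e" "orvol a c b d e = - orvol a b c d e"
  "orvol a b d c e = - orvol a b c d e" "orvol a b c e d = - orvol a b c d e"
proof -
  have "det4 (- u) (v - u) (w - u) (z - u) = - det4 u v w z" for u v w z
    unfolding det4_eq vector_minus_component vector_uminus_component
    by (simp add: algebra_simps)
  from this[of "b - a" "c - a" "d - a" "e - a"] show "orvol b a c d e = - orvol a b c d e"
    unfolding orvol_def by simp
  show "orvol a c b d e = - orvol a b c d e" "orvol a b d c e = - orvol a b c d e"
    "orvol a b c e d = - orvol a b c d e"
    unfolding orvol_def by (rule det4_swap)+
qed

text \<open>A rotation has determinant 1, so signed volumes do not depend on the lift; a reflection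
  would change the sign.\<close>

lemma orvol_motion:
  assumes "motion m"
  shows "orvol (m a) (m b) (m c) (m d) (m e) = orvol a b c d e"
proof -
  obtain R t where R: "rotation_matrix R" "m = (\<lambda>x. R *v x + t)"
    using assms unfolding motion_def by blast
  have "m x - m y = R *v (x - y)" for x y
    unfolding R by (simp add: matrix_vector_mult_diff_distrib)
  then show ?thesis
    using R(1) unfolding orvol_def rotation_matrix_def by (simp add: det4_matrix)
qed

lemma dist_motion:
  assumes "motion m"
  shows "dist (m x) (m y) = dist x y"
proof -
  obtain R t where R: "orthogonal_matrix R" "m = (\<lambda>x. R *v x + t)"
    using assms unfolding motion_def rotation_matrix_def by blast
  have "orthogonal_transformation ((*v) R)"
    using R(1) by (simp add: orthogonal_transformation_matrix)
  then show ?thesis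
    unfolding R(2) dist_norm
    by (simp add: orthogonal_transformation_norm flip: matrix_vector_mult_diff_distrib)
qed

text \<open>Apply the linear form \<open>det4 (q b - q a) (q c - q a) (q d - q a)\<close> to the
  dependency: the terms of \<open>a, b, c, d\<close> drop out. Hence the coefficients of an affine
  dependency are, up to signs and a common factor, the volumes of the opposite simplices.\<close>

lemma orvol_dependency:
  assumes "distinct [a, b, c, d, x, y]"
    and "(\<Sum>z\<in>{a, b, c, d, x, y}. \<mu> z) = 0" "(\<Sum>z\<in>{a, b, c, d, x, y}. \<mu> z *\<^sub>R q z) = 0"
  shows "\<mu> x * orvol (q a) (q b) (q c) (q d) (q x) + \<mu> y * orvol (q a) (q b) (q c) (q d) (q y) = 0"
proof -
  let ?l = "det4 (q b - q a) (q c - q a) (q d - q a)"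
  let ?S = "{a, b, c, d, x, y}"
  have [simp]: "?l 0 = 0" "?l (q b - q a) = 0" "?l (q c - q a) = 0" "?l (q d - q a) = 0"
    unfolding det4_eq by (simp_all add: algebra_simps)
  have "(\<Sum>z\<in>?S. \<mu> z *\<^sub>R (q z - q a)) = 0"
    using assms(2,3) by (simp only: scaleR_diff_right sum_subtractf flip: scaleR_left.sum) simp
  then have "0 = ?l (\<Sum>z\<in>?S. \<mu> z *\<^sub>R (q z - q a))" by simp
  also have "\<dots> = (\<Sum>z\<in>?S. \<mu> z * ?l (q z - q a))"
    by (simp add: linear_sum[OF linear_det4] det4_scale)
  also have "\<dots> = \<mu> x * ?l (q x - q a) + \<mu> y * ?l (q y - q a)"
    using assms(1) by simp
  finally show ?thesis unfolding orvol_def by simp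
qed

lemma det4_nonzero:
  assumes "distinct [u, v, w, z]" "independent {u, v, w, z}"
  shows "det4 u v w z \<noteq> 0"
proof
  let ?A = "vector [u, v, w, z] :: real^4^4"
  assume "det4 u v w z = 0"
  then have "\<not> invertible ?A"
    unfolding det4_def by (simp add: invertible_det_nz)
  then have "\<not> (\<exists>B. ?A ** B = Finite_Cartesian_Product.mat 1)"
    by (simp add: invertible_right_inverse)
  then obtain c i where c: "(\<Sum>i\<in>UNIV. c i *s Finite_Cartesian_Product.row i ?A) = 0" "c i \<noteq> 0"
    unfolding matrix_right_invertible_independent_rows by blast
  have row: "Finite_Cartesian_Product.row i ?A = ?A $ i" for i
    by (simp add: Finite_Cartesian_Product.row_def Finite_Cartesian_Product.vec_eq_iff)
  have "c 1 *s u + c 2 *s v + c 3 *s w + c 4 *s z = 0"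
    using c(1) unfolding row sum_4 by simp
  then have *: "c 1 *\<^sub>R u + c 2 *\<^sub>R v + c 3 *\<^sub>R w + c 4 *\<^sub>R z = 0"
    by (simp add: scalar_mult_eq_scaleR)
  have neq: "u \<noteq> v" "u \<noteq> w" "u \<noteq> z" "v \<noteq> w" "v \<noteq> z" "w \<noteq> z"
    "v \<noteq> u" "w \<noteq> u" "z \<noteq> u" "w \<noteq> v" "z \<noteq> v" "z \<noteq> w"
    using assms(1) by auto
  define f where "f x = (if x = u then c 1 else if x = v then c 2 else if x = w then c 3 else c 4)" for x
  have "(\<Sum>x\<in>{u, v, w, z}. f x *\<^sub>R x) = 0"
    using * neq by (simp add: f_def add.assoc)
  then have "\<forall>x\<in>{u, v, w, z}. f x = 0"
    using assms(2) independent_explicit_finite_subsets[of "{u, v, w, z}"] by blast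
  then have "c 1 = 0 \<and> c 2 = 0 \<and> c 3 = 0 \<and> c 4 = 0"
    using neq by (simp add: f_def)
  then show False using c(2) by (metis exhaust_4)
qed

lemma orvol_nonzero:
  assumes "distinct [a, b, c, d, e]" "\<not> affine_dependent {a, b, c, d, e}"
  shows "orvol a b c d e \<noteq> 0"
proof -
  have "\<not> dependent ((\<lambda>x. -a + x) ` ({a, b, c, d, e} - {a}))"
    using assms(2) affine_dependent_iff_dependent2[of a "{a, b, c, d, e}"] by simp
  moreover have "(\<lambda>x. -a + x) ` ({a, b, c, d, e} - {a}) = {b - a, c - a, d - a, e - a}"
    using assms(1) by auto
  ultimately show ?thesis
    unfolding orvol_def using assms(1) by (intro det4_nonzero) auto
qed

lemma content_orvol:
  assumes "distinct [a, b, c, d, e]"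
  shows "measure lebesgue (convex hull {a, b, c, d, e}) = \<bar>orvol a b c d e\<bar> / 24"
proof -
  define f :: "4 \<Rightarrow> real^4" where "f i = vector [b, c, d, e] $ i" for i
  have f: "f 1 = b" "f 2 = c" "f 3 = d" "f 4 = e" by (simp_all add: f_def)
  have bij: "bij_betw f UNIV ({a, b, c, d, e} - {a})"
    unfolding bij_betw_def inj_on_def UNIV_4 using assms by (auto simp: f)
  have "measure lborel (convex hull {a, b, c, d, e}) =
      \<bar>Determinants.det (\<chi> i j. f j $ i - a $ i)\<bar> / fact (CARD(4))"
    using assms by (intro content_simplex[OF _ _ _ bij]) auto
  also have "(\<chi> i j. f j $ i - a $ i) = Finite_Cartesian_Product.transpose (vector [b - a, c - a, d - a, e - a])"
    by (simp add: Finite_Cartesian_Product.vec_eq_iff forall_4 Finite_Cartesian_Product.transpose_def f)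
  also have "\<bar>Determinants.det \<dots>\<bar> = \<bar>orvol a b c d e\<bar>"
    by (simp add: Determinants.det_transpose orvol_def det4_def)
  also have "fact (CARD(4)) = (24 :: real)" by (simp add: fact_numeral)
  also have "measure lborel (convex hull {a, b, c, d, e}) = measure lebesgue (convex hull {a, b, c, d, e})"
  proof -
    have "compact (convex hull {a, b, c, d, e})"
      by (intro finite_imp_compact_convex_hull) auto
    then show ?thesis
      by (intro measure_completion[symmetric]) (auto dest: compact_imp_closed)
  qed
  finally show ?thesis .
qed

text \<open>Cramer's rule for the orthogonal projection to the plane spanned by \<open>u\<close> and \<open>v\<close>; for dependent
  \<open>u\<close> and \<open>v\<close> the coordinates are 0 by the convention for division.\<close>

definition gram :: "real^4 \<Rightarrow> real^4 \<Rightarrow> real" where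
  "gram u v = (u \<bullet> u) * (v \<bullet> v) - (u \<bullet> v)\<^sup>2"

definition proj_coord :: "real^4 \<Rightarrow> real^4 \<Rightarrow> real^4 \<Rightarrow> real" where
  "proj_coord u v w = ((v \<bullet> v) * (u \<bullet> w) - (u \<bullet> v) * (v \<bullet> w)) / gram u v"

definition perp :: "real^4 \<Rightarrow> real^4 \<Rightarrow> real^4 \<Rightarrow> real^4" where
  "perp u v w = w - proj_coord u v w *\<^sub>R u - proj_coord v u w *\<^sub>R v"

lemma gram_commute: "gram v u = gram u v"
  unfolding gram_def by (simp add: inner_commute mult.commute)

lemma gram_nonneg: "gram u v \<ge> 0"
  unfolding gram_def using Cauchy_Schwarz_ineq[of u v] by simp

lemma linear_proj_coord: "linear (proj_coord u v)"
  unfolding proj_coord_def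
  by (intro linearI) (simp_all add: inner_add_right algebra_simps add_divide_distrib diff_divide_distrib)

lemma linear_perp: "linear (perp u v)"
  unfolding perp_def
  by (intro linearI)
    (simp_all add: linear_add[OF linear_proj_coord] linear_scale[OF linear_proj_coord] algebra_simps)

lemma proj_coord_base:
  assumes "gram u v \<noteq> 0"
  shows "proj_coord u v u = 1" "proj_coord u v v = 0"
  using assms unfolding proj_coord_def gram_def
  by (simp_all add: power2_eq_square mult.commute inner_commute)

lemma gram_proj_coord:
  assumes "gram u v \<noteq> 0"
  shows "gram u v * proj_coord u v w = (v \<bullet> v) * (u \<bullet> w) - (u \<bullet> v) * (v \<bullet> w)"
    "gram u v * proj_coord v u w = (u \<bullet> u) * (v \<bullet> w) - (u \<bullet> v) * (u \<bullet> w)"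
  using assms unfolding proj_coord_def gram_commute[of v u] by (simp_all add: inner_commute)

lemma inner_perp:
  assumes "gram u v \<noteq> 0"
  shows "u \<bullet> perp u v w = 0" "v \<bullet> perp u v w = 0"
proof -
  have 1: "u \<bullet> perp u v w = 0" if "gram u v \<noteq> 0" for u v
  proof -
    note st = gram_proj_coord[OF that, of w]
    have "gram u v * (u \<bullet> perp u v w) = gram u v * (u \<bullet> w)
        - (gram u v * proj_coord u v w) * (u \<bullet> u) - (gram u v * proj_coord v u w) * (u \<bullet> v)"
      unfolding perp_def by (simp add: inner_diff_right algebra_simps)
    also have "\<dots> = 0" unfolding st unfolding gram_def by (simp add: algebra_simps power2_eq_square)
    finally show ?thesis using that by simp
  qed
  have "perp v u w = perp u v w" unfolding perp_def by simp
  then show "u \<bullet> perp u v w = 0" "v \<bullet> perp u v w = 0"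
    using 1[of u v] 1[of v u] assms gram_commute[of u v] by simp_all
qed

text \<open>The inner product of the perpendiculars is a Schur complement with respect to the Gram
  matrix of \<open>u, v\<close>; it is a function of inner products alone, hence of squared
  lengths.\<close>

lemma inner_perp_perp:
  assumes "gram u v \<noteq> 0"
  shows "perp u v w \<bullet> perp u v z = w \<bullet> z -
    ((v \<bullet> v) * (u \<bullet> w) * (u \<bullet> z) - (u \<bullet> v) * ((u \<bullet> w) * (v \<bullet> z) + (v \<bullet> w) * (u \<bullet> z)) +
     (u \<bullet> u) * (v \<bullet> w) * (v \<bullet> z)) / gram u v"
proof -
  have "perp u v w \<bullet> perp u v z = w \<bullet> perp u v z"
    using inner_perp[OF assms] by (subst perp_def) (simp add: inner_diff_left)
  also have "\<dots> = w \<bullet> z - proj_coord u v z * (u \<bullet> w) - proj_coord v u z * (v \<bullet> w)"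
    unfolding perp_def by (simp add: inner_diff_right inner_commute)
  also have "\<dots> = w \<bullet> z - (proj_coord u v z * (u \<bullet> w) + proj_coord v u z * (v \<bullet> w))" by simp
  also have "proj_coord u v z * (u \<bullet> w) + proj_coord v u z * (v \<bullet> w) =
      ((v \<bullet> v) * (u \<bullet> w) * (u \<bullet> z) - (u \<bullet> v) * ((u \<bullet> w) * (v \<bullet> z) + (v \<bullet> w) * (u \<bullet> z)) +
       (u \<bullet> u) * (v \<bullet> w) * (v \<bullet> z)) / gram u v"
  proof -
    have "(proj_coord u v z * (u \<bullet> w) + proj_coord v u z * (v \<bullet> w)) * gram u v =
        (gram u v * proj_coord u v z) * (u \<bullet> w) + (gram u v * proj_coord v u z) * (v \<bullet> w)"
      by (simp add: algebra_simps)
    then show ?thesis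
      unfolding nonzero_eq_divide_eq[OF assms] gram_proj_coord[OF assms] by (simp add: algebra_simps)
  qed
  finally show ?thesis .
qed

text \<open>By Pythagoras the foot computed by Cramer's rule is the closest point; this connects
  \<open>dihedral_angle\<close> with \<open>perp\<close>.\<close>

lemma closest_point_plane:
  assumes "gram (b - a) (c - a) \<noteq> 0"
  shows "z - closest_point (affine hull {a, b, c}) z = perp (b - a) (c - a) (z - a)"
proof -
  let ?u = "b - a" and ?v = "c - a"
  define p where "p = z - perp ?u ?v (z - a)"
  have p: "p = a + proj_coord ?u ?v (z - a) *\<^sub>R ?u + proj_coord ?v ?u (z - a) *\<^sub>R ?v"
    unfolding p_def perp_def by simp
  have hull: "x \<in> affine hull {a, b, c} \<longleftrightarrow> (\<exists>s t. x = a + s *\<^sub>R ?u + t *\<^sub>R ?v)" for x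
  proof -
    have "x \<in> affine hull {a, b, c} \<longleftrightarrow>
        (\<exists>r s t. r + s + t = 1 \<and> x = r *\<^sub>R a + s *\<^sub>R b + t *\<^sub>R c)"
      unfolding affine_hull_3 by auto
    also have "\<dots> \<longleftrightarrow> (\<exists>s t. x = a + s *\<^sub>R ?u + t *\<^sub>R ?v)"
    proof
      assume "\<exists>r s t. r + s + t = 1 \<and> x = r *\<^sub>R a + s *\<^sub>R b + t *\<^sub>R c"
      then obtain r s t where "r + s + t = 1" "x = r *\<^sub>R a + s *\<^sub>R b + t *\<^sub>R c" by blast
      moreover from this have "r = 1 - s - t" by simp
      ultimately have "x = a + s *\<^sub>R ?u + t *\<^sub>R ?v"
        by (simp only:) (simp add: algebra_simps)
      then show "\<exists>s t. x = a + s *\<^sub>R ?u + t *\<^sub>R ?v" by blast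
    next
      assume "\<exists>s t. x = a + s *\<^sub>R ?u + t *\<^sub>R ?v"
      then obtain s t where "x = a + s *\<^sub>R ?u + t *\<^sub>R ?v" by blast
      then have "(1 - s - t) + s + t = 1 \<and> x = (1 - s - t) *\<^sub>R a + s *\<^sub>R b + t *\<^sub>R c"
        by (simp add: algebra_simps)
      then show "\<exists>r s t. r + s + t = 1 \<and> x = r *\<^sub>R a + s *\<^sub>R b + t *\<^sub>R c" by blast
    qed
    finally show ?thesis .
  qed
  have "p = closest_point (affine hull {a, b, c}) z"
  proof (rule closest_point_unique)
    show "p \<in> affine hull {a, b, c}" unfolding hull using p by blast
    show "\<forall>x\<in>affine hull {a, b, c}. dist z p \<le> dist z x"
    proof
      fix x assume "x \<in> affine hull {a, b, c}"
      then obtain s t where x: "x = a + s *\<^sub>R ?u + t *\<^sub>R ?v" unfolding hull by blast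
      define h where "h = perp ?u ?v (z - a)"
      define k where "k = (proj_coord ?u ?v (z - a) - s) *\<^sub>R ?u + (proj_coord ?v ?u (z - a) - t) *\<^sub>R ?v"
      have "z - p = h" unfolding p_def h_def by simp
      moreover have "z - x = h + k"
        unfolding x h_def k_def perp_def by (simp add: algebra_simps)
      moreover have "h \<bullet> k = 0"
        using inner_perp[OF assms, of "z - a"] unfolding h_def k_def
        by (simp add: inner_add_right inner_commute)
      then have "(norm (h + k))\<^sup>2 = (norm h)\<^sup>2 + (norm k)\<^sup>2"
        by (simp add: power2_norm_eq_inner inner_add_left inner_add_right inner_commute)
      then have "norm h \<le> norm (h + k)"
        by (simp add: power2_le_imp_le)
      ultimately show "dist z p \<le> dist z x" by (simp add: dist_norm)
    qed
  qed (auto simp: affine_imp_convex)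
  then have "z - closest_point (affine hull {a, b, c}) z = z - p" by simp
  then show ?thesis unfolding p_def by simp
qed

text \<open>Base times height: shearing replaces two edges by their perpendiculars to the plane of
  the other two, and the Gram determinant splits.\<close>

lemma orvol_sq:
  assumes "gram (b - a) (c - a) \<noteq> 0"
  shows "(orvol a b c d e)\<^sup>2 = gram (b - a) (c - a) *
    gram (perp (b - a) (c - a) (d - a)) (perp (b - a) (c - a) (e - a))"
proof -
  have "orvol a b c d e =
      det4 (b - a) (c - a) (perp (b - a) (c - a) (d - a)) (perp (b - a) (c - a) (e - a))"
    unfolding orvol_def perp_def by (simp only: det4_shear)
  then show ?thesis
    using inner_perp[OF assms] by (simp add: det4_gram gram_def)
qed

text \<open>The equality case of Cauchy-Schwarz.\<close>

lemma gram_eq_0: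
  assumes "gram u v = 0" "u \<noteq> 0"
  shows "v = ((u \<bullet> v) / (u \<bullet> u)) *\<^sub>R u"
proof -
  define s where "s = (u \<bullet> v) / (u \<bullet> u)"
  have s: "s * (u \<bullet> u) = u \<bullet> v" using assms(2) unfolding s_def by simp
  have "(v - s *\<^sub>R u) \<bullet> (v - s *\<^sub>R u) = v \<bullet> v - 2 * s * (u \<bullet> v) + s * (s * (u \<bullet> u))"
    by (simp add: inner_diff_left inner_diff_right inner_commute algebra_simps)
  also have "\<dots> = v \<bullet> v - s * (u \<bullet> v)" unfolding s by simp
  also have "\<dots> = gram u v / (u \<bullet> u)"
    using assms(2) unfolding s_def gram_def by (simp add: field_simps power2_eq_square)
  finally show ?thesis using assms(1) unfolding s_def[symmetric] by simp
qed

lemma orvol_nonzero_gram: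
  assumes "orvol a b c d e \<noteq> 0"
  shows "gram (b - a) (c - a) > 0"
proof -
  let ?u = "b - a" and ?v = "c - a"
  have "gram ?u ?v \<noteq> 0"
  proof
    assume g: "gram ?u ?v = 0"
    have "orvol a b c d e = 0"
    proof (cases "?u = 0")
      case True
      then show ?thesis unfolding orvol_def det4_eq by simp
    next
      case False
      then obtain s where "?v = s *\<^sub>R ?u" using gram_eq_0[OF g] by metis
      then show ?thesis unfolding orvol_def
        using linear_scale[OF linear_det4, of ?u "d - a" "e - a" s ?u]
          det4_swap(2)[of ?u "d - a" ?v "e - a"] det4_swap(3)[of ?u "d - a" ?v "e - a"]
          det4_swap(3)[of ?u "d - a" "e - a" ?v]
        by simp
    qed
    then show False using assms by simp
  qed
  then show ?thesis using gram_nonneg[of ?u ?v] by simp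
qed

lemma orvol_nonzero_perp:
  assumes "orvol a b c d e \<noteq> 0"
  shows "gram (perp (b - a) (c - a) (d - a)) (perp (b - a) (c - a) (e - a)) > 0"
    "perp (b - a) (c - a) (d - a) \<noteq> 0" "perp (b - a) (c - a) (e - a) \<noteq> 0"
proof -
  have "gram (b - a) (c - a) > 0" by (rule orvol_nonzero_gram[OF assms])
  moreover have "(orvol a b c d e)\<^sup>2 > 0" using assms by simp
  ultimately show 1: "gram (perp (b - a) (c - a) (d - a)) (perp (b - a) (c - a) (e - a)) > 0"
    using orvol_sq[of b a c d e] by (simp add: zero_less_mult_iff)
  then show "perp (b - a) (c - a) (d - a) \<noteq> 0" "perp (b - a) (c - a) (e - a) \<noteq> 0"
    by (auto simp: gram_def)
qed

lemma dihedral_angle_eq: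
  assumes "gram (b - a) (c - a) \<noteq> 0"
  shows "dihedral_angle {a, b, c} x y =
    (let h = perp (b - a) (c - a) in
     arccos (h (x - a) \<bullet> h (y - a) / (sqrt (h (x - a) \<bullet> h (x - a)) * sqrt (h (y - a) \<bullet> h (y - a)))))"
  unfolding dihedral_angle_def Let_def closest_point_plane[OF assms] norm_eq_sqrt_inner ..

section \<open>Dihedral angles and edge lengths\<close>

text \<open>The projection coordinates \<open>\<alpha>, \<beta>\<close> need not be differentiated, because the residuals of the normal
  equations vanish at \<open>t\<close>.\<close>

lemma has_real_derivative_schur_complement:
  fixes K11 :: "real \<Rightarrow> real"
  assumes d: "(K11 has_real_derivative k11) (at t)" "(K12 has_real_derivative k12) (at t)"
    "(K22 has_real_derivative k22) (at t)" "(bp has_real_derivative bp') (at t)"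
    "(br has_real_derivative br') (at t)" "(cp has_real_derivative cp') (at t)"
    "(cr has_real_derivative cr') (at t)" "(pr has_real_derivative pr') (at t)"
    and nz: "K11 t * K22 t - (K12 t)\<^sup>2 \<noteq> 0"
    and normal: "bp t = \<alpha> * K11 t + \<beta> * K12 t" "cp t = \<alpha> * K12 t + \<beta> * K22 t"
      "br t = \<alpha>' * K11 t + \<beta>' * K12 t" "cr t = \<alpha>' * K12 t + \<beta>' * K22 t"
  shows "((\<lambda>x. pr x - (K22 x * bp x * br x - K12 x * (bp x * cr x + cp x * br x) + K11 x * cp x * cr x)
      / (K11 x * K22 x - (K12 x)\<^sup>2)) has_real_derivative
    pr' - \<alpha> * br' - \<beta> * cr' - \<alpha>' * bp' - \<beta>' * cp' + \<alpha> * \<alpha>' * k11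
      + (\<alpha> * \<beta>' + \<beta> * \<alpha>') * k12 + \<beta> * \<beta>' * k22) (at t)"
proof -
  define N' where "N' = (k22 * bp t + K22 t * bp') * br t + K22 t * bp t * br'
      - (k12 * (bp t * cr t + cp t * br t) +
         K12 t * (bp' * cr t + bp t * cr' + (cp' * br t + cp t * br')))
      + ((k11 * cp t + K11 t * cp') * cr t + K11 t * cp t * cr')"
  define D where "D = K11 t * K22 t - (K12 t)\<^sup>2"
  define D' where "D' = k11 * K22 t + K11 t * k22 - 2 * K12 t * k12"
  define Q where "Q = \<alpha> * \<alpha>' * K11 t + (\<alpha> * \<beta>' + \<beta> * \<alpha>') * K12 t + \<beta> * \<beta>' * K22 t"
  define R where "R = \<alpha> * br' + \<beta> * cr' + \<alpha>' * bp' + \<beta>' * cp' - \<alpha> * \<alpha>' * k11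
      - (\<alpha> * \<beta>' + \<beta> * \<alpha>') * k12 - \<beta> * \<beta>' * k22"
  \<comment> \<open>With the numerator equal to \<open>D * Q\<close>, the quotient rule gives
    \<open>(N' - Q * D') / D\<close>, and \<open>NR\<close> cancels the last
    \<open>D\<close>.\<close>
  have N: "K22 t * bp t * br t - K12 t * (bp t * cr t + cp t * br t) + K11 t * cp t * cr t = D * Q"
    unfolding normal D_def Q_def by (simp add: algebra_simps power2_eq_square)
  have NR: "N' - Q * D' = D * R"
    unfolding N'_def normal D_def D'_def Q_def R_def by (simp add: algebra_simps power2_eq_square)
  have "((\<lambda>x. K22 x * bp x * br x - K12 x * (bp x * cr x + cp x * br x) + K11 x * cp x * cr x)
      has_real_derivative N') (at t)"
    unfolding N'_def by (rule derivative_eq_intros d refl | simp add: algebra_simps)+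
  moreover have "((\<lambda>x. K11 x * K22 x - (K12 x)\<^sup>2) has_real_derivative D') (at t)"
    unfolding D'_def by (rule derivative_eq_intros d refl | simp add: algebra_simps)+
  ultimately have "((\<lambda>x. pr x - (K22 x * bp x * br x - K12 x * (bp x * cr x + cp x * br x) + K11 x * cp x * cr x)
      / (K11 x * K22 x - (K12 x)\<^sup>2)) has_real_derivative
      pr' - (N' * D - (D * Q) * D') / (D * D)) (at t)"
    using nz unfolding N[symmetric] unfolding D_def by (intro DERIV_diff d DERIV_divide)
  also have "(N' * D - (D * Q) * D') / (D * D) = R"
  proof -
    have "N' * D - (D * Q) * D' = (D * D) * R"
      using NR by (simp add: algebra_simps)
    then show ?thesis using nz unfolding D_def by simp
  qed
  finally show ?thesis unfolding R_def by (simp add: algebra_simps)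
qed

text \<open>For \<open>f\<close> the inner product and \<open>g, h\<close> the squared norms of two
  perpendiculars, the root in the denominator is that of their Gram determinant, which
  \<open>orvol_sq\<close> turns into a volume.\<close>

lemma has_real_derivative_angle:
  fixes f g h :: "real \<Rightarrow> real"
  assumes d: "(f has_real_derivative f') (at t)" "(g has_real_derivative g') (at t)"
    "(h has_real_derivative h') (at t)"
    and pos: "g t > 0" "h t > 0" "g t * h t - (f t)\<^sup>2 > 0"
  shows "((\<lambda>x. arccos (f x / (sqrt (g x) * sqrt (h x)))) has_real_derivative
    - (f' - f t * (g' / g t + h' / h t) / 2) / sqrt (g t * h t - (f t)\<^sup>2)) (at t)"
proof -
  define r where "r = sqrt (g t) * sqrt (h t)"
  have r: "r > 0" "r * r = g t * h t" unfolding r_def using pos by (simp_all add: mult_ac flip: mult.assoc)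
  define x where "x = f t / r"
  have "1 - x\<^sup>2 = (g t * h t - (f t)\<^sup>2) / (r * r)"
    using r pos unfolding x_def by (simp add: field_simps power2_eq_square)
  then have sq: "sqrt (1 - x\<^sup>2) = sqrt (g t * h t - (f t)\<^sup>2) / r" "1 - x\<^sup>2 > 0"
    using r pos by (simp_all add: real_sqrt_divide r_def real_sqrt_mult)
  then have "x\<^sup>2 < 1" by simp
  then have x: "- 1 < x" "x < 1" by (simp_all add: abs_square_less_1 abs_less_iff)
  have "((\<lambda>x. sqrt (g x) * sqrt (h x)) has_real_derivative r * (g' / g t + h' / h t) / 2) (at t)"
  proof -
    have "inverse (sqrt (g t)) / 2 * g' * sqrt (h t) + inverse (sqrt (h t)) / 2 * h' * sqrt (g t) =
        r * (g' / g t + h' / h t) / 2"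
    proof -
      define P Q where "P = sqrt (g t)" and "Q = sqrt (h t)"
      have "P > 0" "Q > 0" "g t = P * P" "h t = Q * Q" using pos unfolding P_def Q_def by simp_all
      then show ?thesis
        unfolding r_def P_def[symmetric] Q_def[symmetric] by (simp add: field_simps)
    qed
    moreover have "((\<lambda>x. sqrt (g x) * sqrt (h x)) has_real_derivative
        inverse (sqrt (g t)) / 2 * g' * sqrt (h t) + inverse (sqrt (h t)) / 2 * h' * sqrt (g t)) (at t)"
      by (intro DERIV_mult DERIV_chain2[OF DERIV_real_sqrt] d pos)
    ultimately show ?thesis by (simp only:)
  qed
  then have "((\<lambda>x. f x / (sqrt (g x) * sqrt (h x))) has_real_derivative
      (f' * r - f t * (r * (g' / g t + h' / h t) / 2)) / (r * r)) (at t)"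
    using r unfolding r_def by (intro DERIV_divide d) auto
  also have "(f' * r - f t * (r * (g' / g t + h' / h t) / 2)) / (r * r) =
      (f' - f t * (g' / g t + h' / h t) / 2) / r"
  proof -
    have "(f' * r - f t * (r * X / 2)) / (r * r) = (f' - f t * X / 2) / r" for X
      using r(1) by (simp add: field_simps)
    then show ?thesis .
  qed
  finally have "((\<lambda>x. arccos (f x / (sqrt (g x) * sqrt (h x)))) has_real_derivative
      inverse (- sqrt (1 - x\<^sup>2)) * ((f' - f t * (g' / g t + h' / h t) / 2) / r)) (at t)"
    using x unfolding x_def r_def by (intro DERIV_chain2[OF DERIV_arccos])
  also have "inverse (- sqrt (1 - x\<^sup>2)) * ((f' - f t * (g' / g t + h' / h t) / 2) / r) =
      - (f' - f t * (g' / g t + h' / h t) / 2) / sqrt (g t * h t - (f t)\<^sup>2)"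
    unfolding sq using r pos by (simp add: field_simps)
  finally show ?thesis .
qed

section \<open>Dihedral angles as functions of squared lengths\<close>

definition realizes :: "('v \<Rightarrow> real^4) \<Rightarrow> 'v set \<Rightarrow> ('v set \<Rightarrow> real) \<Rightarrow> bool" where
  "realizes q s l \<longleftrightarrow> (\<forall>x\<in>s. \<forall>y\<in>s. x \<noteq> y \<longrightarrow> (dist (q x) (q y))\<^sup>2 = l {x, y})"

text \<open>A singleton is no edge and the value of \<open>l\<close> on it carries no information,
  so the case of equal vertices is set to 0 by hand.\<close>

definition edge_length :: "('v set \<Rightarrow> real) \<Rightarrow> 'v \<Rightarrow> 'v \<Rightarrow> real" where
  "edge_length l p r = (if p = r then 0 else l {p, r})"

text \<open>The law of cosines: the inner product of the edges from \<open>a\<close> to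
  \<open>p\<close> and from \<open>a\<close> to \<open>r\<close>.\<close>

definition edge_inner :: "('v set \<Rightarrow> real) \<Rightarrow> 'v \<Rightarrow> 'v \<Rightarrow> 'v \<Rightarrow> real" where
  "edge_inner l a p r = (edge_length l a p + edge_length l a r - edge_length l p r) / 2"

text \<open>The formula of \<open>inner_perp_perp\<close> with the inner products replaced by
  functions of the squared lengths; it can be differentiated without reference to a
  realization.\<close>

definition perp_inner :: "('v set \<Rightarrow> real) \<Rightarrow> 'v \<Rightarrow> 'v \<Rightarrow> 'v \<Rightarrow> 'v \<Rightarrow> 'v \<Rightarrow> real" where
  "perp_inner l a b c p r = (let g = edge_inner l a in
     g p r - (g c c * g b p * g b r - g b c * (g b p * g c r + g c p * g b r) + g b b * g c p * g c r)
       / (g b b * g c c - (g b c)\<^sup>2))"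

lemma edge_inner_eq:
  assumes "realizes q s l" "a \<in> s" "p \<in> s" "r \<in> s"
  shows "edge_inner l a p r = (q p - q a) \<bullet> (q r - q a)"
proof -
  have "edge_length l x y = (q x - q y) \<bullet> (q x - q y)" if "x \<in> s" "y \<in> s" for x y
    using assms(1) that unfolding realizes_def edge_length_def
    by (auto simp: dist_norm power2_norm_eq_inner)
  then show ?thesis
    unfolding edge_inner_def using assms
    by (simp add: inner_diff_left inner_diff_right inner_commute)
qed

lemma perp_inner_eq:
  assumes "realizes q s l" "{a, b, c, p, r} \<subseteq> s" "gram (q b - q a) (q c - q a) \<noteq> 0"
  shows "perp_inner l a b c p r =
    perp (q b - q a) (q c - q a) (q p - q a) \<bullet> perp (q b - q a) (q c - q a) (q r - q a)"
  unfolding perp_inner_def Let_def inner_perp_perp[OF assms(3)] gram_def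
  using assms(2) by (simp add: edge_inner_eq[OF assms(1)])

text \<open>Every realization of the lengths yields the same angle, in either order of
  \<open>d\<close> and \<open>e\<close>; together with the existence of one realization this makes
  the definite description meaningful.\<close>

lemma dihedral_of_lengths_eq:
  assumes dist: "distinct [a, b, c, d, e]" and s: "s = {a, b, c, d, e}" and i: "i = {a, b, c}"
    and ex: "realizes q s l"
    and nz: "edge_inner l a b b * edge_inner l a c c - (edge_inner l a b c)\<^sup>2 \<noteq> 0"
  shows "dihedral_of_lengths s i l =
    arccos (perp_inner l a b c d e / (sqrt (perp_inner l a b c d d) * sqrt (perp_inner l a b c e e)))"
    (is "_ = ?\<theta>")
proof -
  have angle: "dihedral_angle (q ` i) (q x) (q y) = ?\<theta>"
    if q: "realizes q s l" and xy: "x = d \<and> y = e \<or> x = e \<and> y = d" for q x y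
  proof -
    have g: "gram (q b - q a) (q c - q a) \<noteq> 0"
      using nz edge_inner_eq[OF q, of a] unfolding s gram_def by simp
    show ?thesis
      using xy perp_inner_eq[OF q _ g] unfolding i s
      by (auto simp: dihedral_angle_eq[OF g] Let_def inner_commute mult.commute)
  qed
  have si: "s - i = {d, e}" using dist unfolding s i by auto
  show ?thesis unfolding dihedral_of_lengths_def
  proof (rule the_equality)
    show "\<exists>(q :: 'a \<Rightarrow> real^4) x y. (\<forall>x\<in>s. \<forall>y\<in>s. x \<noteq> y \<longrightarrow> (dist (q x) (q y))\<^sup>2 = l {x, y}) \<and>
        x \<noteq> y \<and> s - i = {x, y} \<and> ?\<theta> = dihedral_angle (q ` i) (q x) (q y)"
      using angle[OF ex, of d e] si dist ex unfolding realizes_def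
      by (intro exI[of _ q] exI[of _ d] exI[of _ e]) simp
  next
    fix \<theta>
    assume "\<exists>(q :: 'a \<Rightarrow> real^4) x y. (\<forall>x\<in>s. \<forall>y\<in>s. x \<noteq> y \<longrightarrow> (dist (q x) (q y))\<^sup>2 = l {x, y}) \<and>
        x \<noteq> y \<and> s - i = {x, y} \<and> \<theta> = dihedral_angle (q ` i) (q x) (q y)"
    then obtain q :: "'a \<Rightarrow> real^4" and x y where "realizes q s l" "s - i = {x, y}"
      "\<theta> = dihedral_angle (q ` i) (q x) (q y)"
      unfolding realizes_def by blast
    then show "\<theta> = ?\<theta>" using angle[of q x y] unfolding si by (auto simp: doubleton_eq_iff)
  qed
qed

text \<open>The coefficients of the perpendicular dropped from \<open>q d\<close> onto the plane of \<open>q a, q b, q c\<close>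
  as a combination of the vertices.\<close>

definition perp_coeff :: "('v \<Rightarrow> real^4) \<Rightarrow> 'v \<Rightarrow> 'v \<Rightarrow> 'v \<Rightarrow> 'v \<Rightarrow> 'v \<Rightarrow> real" where
  "perp_coeff q a b c d z = (let u = q b - q a; v = q c - q a; w = q d - q a in
     if z = a then proj_coord u v w + proj_coord v u w - 1
     else if z = b then - proj_coord u v w
     else if z = c then - proj_coord v u w
     else if z = d then 1 else 0)"

lemma has_real_derivative_edge_length:
  "((\<lambda>t. edge_length (l(e := t)) p r) has_real_derivative (if p \<noteq> r \<and> {p, r} = e then 1 else 0)) (at t)"
  unfolding edge_length_def by (cases "p = r"; cases "{p, r} = e") simp_all

text \<open>The coefficients \<open>perp_coeff\<close> sum to zero, and the inner product of two
  combinations of points with zero-sum coefficients \<open>k\<close> and \<open>k'\<close> is -1/2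
  times the sum of \<open>k x * k' y\<close> times the squared distance of \<open>x\<close> and
  \<open>y\<close>. By \<open>has_real_derivative_schur_complement\<close> the coefficients may be
  kept fixed, so the derivative is the coefficient of the squared length of
  \<open>{x, y}\<close>.\<close>

lemma has_real_derivative_perp_inner:
  assumes dist: "distinct [a, b, c]" "p \<notin> {a, b, c}" "r \<notin> {a, b, c}"
    and q: "realizes q s l" "{a, b, c, p, r} \<subseteq> s"
    and g: "gram (q b - q a) (q c - q a) \<noteq> 0" and xy: "x \<noteq> y"
  shows "((\<lambda>t. perp_inner (l({x, y} := t)) a b c p r) has_real_derivative
    - (perp_coeff q a b c p x * perp_coeff q a b c r y + perp_coeff q a b c p y * perp_coeff q a b c r x) / 2)
    (at (l {x, y}))"
proof -
  define g where "g p r t = edge_inner (l({x, y} := t)) a p r" for p r t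
  define \<gamma> where "\<gamma> p r = (if p \<noteq> r \<and> {p, r} = {x, y} then 1 else 0 :: real)" for p r
  define \<delta> where "\<delta> p r = (\<gamma> a p + \<gamma> a r - \<gamma> p r) / 2" for p r
  let ?t = "l {x, y}"
  let ?u = "q b - q a" and ?v = "q c - q a"
  have d: "(g p r has_real_derivative \<delta> p r) (at ?t)" for p r
    unfolding g_def edge_inner_def \<delta>_def \<gamma>_def
    by (intro DERIV_cdivide DERIV_diff DERIV_add has_real_derivative_edge_length)
  have gt: "g p r ?t = (q p - q a) \<bullet> (q r - q a)" if "{a, p, r} \<subseteq> s" for p r
    unfolding g_def using edge_inner_eq[OF q(1)] that by simp
  have s: "a \<in> s" "b \<in> s" "c \<in> s" "p \<in> s" "r \<in> s" using q(2) by auto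
  have normal: "g b z ?t = proj_coord ?u ?v (q z - q a) * g b b ?t + proj_coord ?v ?u (q z - q a) * g b c ?t"
    "g c z ?t = proj_coord ?u ?v (q z - q a) * g b c ?t + proj_coord ?v ?u (q z - q a) * g c c ?t"
    if "z \<in> s" for z
    using inner_perp[OF assms(6), of "q z - q a"] s that unfolding perp_def
    by (simp_all add: gt inner_diff_right inner_commute)
  have nz: "g b b ?t * g c c ?t - (g b c ?t)\<^sup>2 \<noteq> 0"
    using assms(6) s by (simp add: gt gram_def)
  have "((\<lambda>t. perp_inner (l({x, y} := t)) a b c p r) has_real_derivative
    \<delta> p r - proj_coord ?u ?v (q p - q a) * \<delta> b r - proj_coord ?v ?u (q p - q a) * \<delta> c r
      - proj_coord ?u ?v (q r - q a) * \<delta> b p - proj_coord ?v ?u (q r - q a) * \<delta> c p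
      + proj_coord ?u ?v (q p - q a) * proj_coord ?u ?v (q r - q a) * \<delta> b b
      + (proj_coord ?u ?v (q p - q a) * proj_coord ?v ?u (q r - q a) +
         proj_coord ?v ?u (q p - q a) * proj_coord ?u ?v (q r - q a)) * \<delta> b c
      + proj_coord ?v ?u (q p - q a) * proj_coord ?v ?u (q r - q a) * \<delta> c c) (at ?t)"
    unfolding perp_inner_def Let_def g_def[symmetric]
    by (intro has_real_derivative_schur_complement d nz normal s)
  also have "\<delta> p r - proj_coord ?u ?v (q p - q a) * \<delta> b r - proj_coord ?v ?u (q p - q a) * \<delta> c r
      - proj_coord ?u ?v (q r - q a) * \<delta> b p - proj_coord ?v ?u (q r - q a) * \<delta> c p
      + proj_coord ?u ?v (q p - q a) * proj_coord ?u ?v (q r - q a) * \<delta> b b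
      + (proj_coord ?u ?v (q p - q a) * proj_coord ?v ?u (q r - q a) +
         proj_coord ?v ?u (q p - q a) * proj_coord ?u ?v (q r - q a)) * \<delta> b c
      + proj_coord ?v ?u (q p - q a) * proj_coord ?v ?u (q r - q a) * \<delta> c c =
      - (perp_coeff q a b c p x * perp_coeff q a b c r y + perp_coeff q a b c p y * perp_coeff q a b c r x) / 2"
  proof -
    define A where "A z = proj_coord ?u ?v (q z - q a)" for z
    define B where "B z = proj_coord ?v ?u (q z - q a)" for z
    have pc: "perp_coeff q a b c z w = (if w = a then A z + B z - 1 else if w = b then - A z
      else if w = c then - B z else if w = z then 1 else 0)" for z w
      unfolding perp_coeff_def A_def B_def Let_def ..
    have neq: "a \<noteq> b" "a \<noteq> c" "b \<noteq> c" "p \<noteq> a" "p \<noteq> b" "p \<noteq> c" "r \<noteq> a" "r \<noteq> b" "r \<noteq> c"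
      "b \<noteq> a" "c \<noteq> a" "c \<noteq> b" "a \<noteq> p" "b \<noteq> p" "c \<noteq> p" "a \<noteq> r" "b \<noteq> r" "c \<noteq> r"
      using dist by auto
    consider "x = a" | "x = b" | "x = c" | "x \<notin> {a, b, c}" by auto
    then show ?thesis
    proof cases
      case 1
      then show ?thesis unfolding A_def[symmetric] B_def[symmetric] \<delta>_def \<gamma>_def pc
        using neq xy by (cases "p = r") (auto simp: doubleton_eq_iff field_simps)
    next
      case 2
      then show ?thesis unfolding A_def[symmetric] B_def[symmetric] \<delta>_def \<gamma>_def pc
        using neq xy by (cases "p = r") (auto simp: doubleton_eq_iff field_simps)
    next
      case 3
      then show ?thesis unfolding A_def[symmetric] B_def[symmetric] \<delta>_def \<gamma>_def pc
        using neq xy by (cases "p = r") (auto simp: doubleton_eq_iff field_simps)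
    next
      case 4
      then show ?thesis unfolding A_def[symmetric] B_def[symmetric] \<delta>_def \<gamma>_def pc
        using neq xy by (cases "p = r") (auto simp: doubleton_eq_iff field_simps)
    qed
  qed
  finally show ?thesis .
qed

text \<open>Rotate \<open>q x\<close> about the plane through \<open>q p, q r, q w\<close>. Without a realization the definition of
  \<open>dihedral_of_lengths\<close> would give a junk value.\<close>

lemma realizes_nearby:
  assumes dist: "distinct [x, y, p, r, w]" and q: "realizes q {x, y, p, r, w} l"
    and nz: "orvol (q p) (q r) (q w) (q x) (q y) \<noteq> 0"
  shows "\<forall>\<^sub>F t in nhds (l {x, y}). \<exists>q'. realizes q' {x, y, p, r, w} (l({x, y} := t))"
proof -
  let ?u = "q r - q p" and ?v = "q w - q p"
  define hx where "hx = perp ?u ?v (q x - q p)"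
  define hy where "hy = perp ?u ?v (q y - q p)"
  define \<pi>x where "\<pi>x = q x - hx"
  define \<pi>y where "\<pi>y = q y - hy"
  have g: "gram ?u ?v \<noteq> 0" using orvol_nonzero_gram[OF nz] by simp
  have gh: "gram hx hy > 0" and hy: "hy \<noteq> 0"
    using orvol_nonzero_perp[OF nz] unfolding hx_def hy_def by auto
  have uv: "?u \<bullet> hx = 0" "?v \<bullet> hx = 0" "?u \<bullet> hy = 0" "?v \<bullet> hy = 0"
    unfolding hx_def hy_def by (rule inner_perp[OF g])+
  define \<alpha>0 where "\<alpha>0 = (hx \<bullet> hy) / (hy \<bullet> hy)"
  \<comment> \<open>\<open>hy\<close> and \<open>k\<close> are an orthogonal basis of the plane
    normal to the axis of rotation, and \<open>hx\<close> has the coordinates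
    \<open>\<alpha>0\<close> and 1 in it.\<close>
  define k where "k = hx - \<alpha>0 *\<^sub>R hy"
  have khy: "hy \<bullet> k = 0" unfolding k_def \<alpha>0_def using hy by (simp add: inner_diff_right inner_commute)
  have k0: "k \<noteq> 0"
  proof
    assume "k = 0"
    then have "hx = \<alpha>0 *\<^sub>R hy" unfolding k_def by simp
    then have "gram hx hy = 0" unfolding gram_def by (simp add: power2_eq_square)
    then show False using gh by simp
  qed
  have kk: "hx \<bullet> hx = \<alpha>0\<^sup>2 * (hy \<bullet> hy) + k \<bullet> k"
  proof -
    have "hx = \<alpha>0 *\<^sub>R hy + k" unfolding k_def by simp
    then have "hx \<bullet> hx = (\<alpha>0 *\<^sub>R hy + k) \<bullet> (\<alpha>0 *\<^sub>R hy + k)" by simp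
    then show ?thesis
      using khy by (simp add: inner_add_left inner_add_right inner_commute power2_eq_square)
  qed
  \<comment> \<open>The law of cosines prescribes the \<open>hy\<close>-coordinate of the rotated
    perpendicular for the new squared length \<open>t\<close>; \<open>rad t\<close> is the square of
    the \<open>k\<close>-coordinate that keeps its norm. At the old length it is 1, hence positive
    nearby.\<close>
  define \<alpha> where "\<alpha> t = \<alpha>0 - (t - l {x, y}) / (2 * (hy \<bullet> hy))" for t
  define rad where "rad t = (hx \<bullet> hx - (\<alpha> t)\<^sup>2 * (hy \<bullet> hy)) / (k \<bullet> k)" for t
  define h' where "h' t = \<alpha> t *\<^sub>R hy + sqrt (rad t) *\<^sub>R k" for t
  have plane: "\<exists>s1 s2. \<pi>x = q p + s1 *\<^sub>R ?u + s2 *\<^sub>R ?v" "\<exists>s1 s2. \<pi>y = q p + s1 *\<^sub>R ?u + s2 *\<^sub>R ?v"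
  proof -
    have "q z - perp ?u ?v (q z - q p) =
        q p + proj_coord ?u ?v (q z - q p) *\<^sub>R ?u + proj_coord ?v ?u (q z - q p) *\<^sub>R ?v" for z
      unfolding perp_def by simp
    then show "\<exists>s1 s2. \<pi>x = q p + s1 *\<^sub>R ?u + s2 *\<^sub>R ?v"
      "\<exists>s1 s2. \<pi>y = q p + s1 *\<^sub>R ?u + s2 *\<^sub>R ?v"
      unfolding \<pi>x_def \<pi>y_def hx_def hy_def by blast+
  qed
  have plane': "\<exists>s1 s2. \<pi>x - z = s1 *\<^sub>R ?u + s2 *\<^sub>R ?v" if "z \<in> {q p, q r, q w, \<pi>y}" for z
  proof -
    obtain s1 s2 where s: "\<pi>x = q p + s1 *\<^sub>R ?u + s2 *\<^sub>R ?v" using plane(1) by blast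
    obtain t1 t2 where t: "\<pi>y = q p + t1 *\<^sub>R ?u + t2 *\<^sub>R ?v" using plane(2) by blast
    have "\<pi>x - q p = s1 *\<^sub>R ?u + s2 *\<^sub>R ?v" using s by simp
    moreover have "\<pi>x - q r = (s1 - 1) *\<^sub>R ?u + s2 *\<^sub>R ?v" using s by (simp add: algebra_simps)
    moreover have "\<pi>x - q w = s1 *\<^sub>R ?u + (s2 - 1) *\<^sub>R ?v" using s by (simp add: algebra_simps)
    moreover have "\<pi>x - \<pi>y = (s1 - t1) *\<^sub>R ?u + (s2 - t2) *\<^sub>R ?v"
      unfolding s t by (simp add: algebra_simps)
    ultimately show ?thesis using that by blast
  qed
  have orth: "(\<pi>x - z) \<bullet> (a1 *\<^sub>R hx + a2 *\<^sub>R hy) = 0" if "z \<in> {q p, q r, q w, \<pi>y}" for z a1 a2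
    using plane'[OF that] uv by (auto simp: inner_add_left inner_add_right)
  have split: "(norm ((\<pi>x - z) + (a1 *\<^sub>R hx + a2 *\<^sub>R hy)))\<^sup>2 =
      (norm (\<pi>x - z))\<^sup>2 + (norm (a1 *\<^sub>R hx + a2 *\<^sub>R hy))\<^sup>2"
    if "z \<in> {q p, q r, q w, \<pi>y}" for z a1 a2
    using orth[OF that, of a1 a2]
    by (simp add: power2_norm_eq_inner inner_add_left[of "\<pi>x - z"] inner_add_right[of _ "\<pi>x - z"] inner_commute)
  have h'_comb: "h' t = sqrt (rad t) *\<^sub>R hx + (\<alpha> t - sqrt (rad t) * \<alpha>0) *\<^sub>R hy" for t
    unfolding h'_def k_def by (simp add: algebra_simps)
  have real: "realizes (q(x := \<pi>x + h' t)) {x, y, p, r, w} (l({x, y} := t))" if rad: "rad t \<ge> 0" for t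
  proof -
    have h'_sq: "(norm (h' t))\<^sup>2 = (norm hx)\<^sup>2"
    proof -
      have "(norm (h' t))\<^sup>2 = (\<alpha> t)\<^sup>2 * (hy \<bullet> hy) + rad t * (k \<bullet> k)"
        unfolding h'_def power2_norm_eq_inner using khy rad
        by (simp add: inner_add_left inner_add_right inner_commute power2_eq_square flip: mult.assoc)
      also have "\<dots> = hx \<bullet> hx" unfolding rad_def using k0 by simp
      finally show ?thesis by (simp add: power2_norm_eq_inner)
    qed
    have far: "(dist (\<pi>x + h' t) z)\<^sup>2 = (dist (q x) z)\<^sup>2" if "z \<in> {q p, q r, q w}" for z
    proof -
      have "(norm ((\<pi>x - z) + h' t))\<^sup>2 = (norm (\<pi>x - z))\<^sup>2 + (norm (h' t))\<^sup>2"
        unfolding h'_comb by (rule split) (use that in auto)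
      also have "\<dots> = (norm ((\<pi>x - z) + (1 *\<^sub>R hx + 0 *\<^sub>R hy)))\<^sup>2"
        unfolding h'_sq by (subst split) (use that in auto)
      finally show ?thesis unfolding dist_norm \<pi>x_def by (simp add: algebra_simps)
    qed
    have near: "(dist (\<pi>x + h' t) (q y))\<^sup>2 = t"
    proof -
      have "(norm ((\<pi>x - \<pi>y) + (sqrt (rad t) *\<^sub>R hx + (\<alpha> t - sqrt (rad t) * \<alpha>0 - 1) *\<^sub>R hy)))\<^sup>2 =
          (norm (\<pi>x - \<pi>y))\<^sup>2 + (norm (sqrt (rad t) *\<^sub>R hx + (\<alpha> t - sqrt (rad t) * \<alpha>0 - 1) *\<^sub>R hy))\<^sup>2"
        by (rule split) simp
      also have "sqrt (rad t) *\<^sub>R hx + (\<alpha> t - sqrt (rad t) * \<alpha>0 - 1) *\<^sub>R hy = h' t - hy"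
        unfolding h'_comb by (simp add: algebra_simps)
      also have "(\<pi>x - \<pi>y) + (h' t - hy) = \<pi>x + h' t - q y" unfolding \<pi>y_def by simp
      also have "(norm (h' t - hy))\<^sup>2 = (norm (h' t))\<^sup>2 + hy \<bullet> hy - 2 * \<alpha> t * (hy \<bullet> hy)"
      proof -
        have "h' t \<bullet> hy = \<alpha> t * (hy \<bullet> hy)"
          unfolding h'_def using khy by (simp add: inner_add_left inner_add_right inner_commute)
        then show ?thesis
          by (simp add: power2_norm_eq_inner inner_diff_left inner_diff_right inner_commute)
      qed
      finally have 1: "(dist (\<pi>x + h' t) (q y))\<^sup>2 =
          (norm (\<pi>x - \<pi>y))\<^sup>2 + (hx \<bullet> hx + hy \<bullet> hy - 2 * \<alpha> t * (hy \<bullet> hy))"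
        unfolding dist_norm h'_sq by (simp add: power2_norm_eq_inner)
      have "(norm ((\<pi>x - \<pi>y) + (1 *\<^sub>R hx + (- 1) *\<^sub>R hy)))\<^sup>2 =
          (norm (\<pi>x - \<pi>y))\<^sup>2 + (norm (1 *\<^sub>R hx + (- 1) *\<^sub>R hy))\<^sup>2"
        by (rule split) simp
      also have "(\<pi>x - \<pi>y) + (1 *\<^sub>R hx + (- 1) *\<^sub>R hy) = q x - q y" unfolding \<pi>x_def \<pi>y_def by simp
      also have "(norm (1 *\<^sub>R hx + (- 1) *\<^sub>R hy))\<^sup>2 = hx \<bullet> hx + hy \<bullet> hy - 2 * \<alpha>0 * (hy \<bullet> hy)"
        unfolding \<alpha>0_def using hy
        by (simp add: power2_norm_eq_inner inner_diff_left inner_diff_right inner_commute)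
      finally have 2: "l {x, y} = (norm (\<pi>x - \<pi>y))\<^sup>2 + (hx \<bullet> hx + hy \<bullet> hy - 2 * \<alpha>0 * (hy \<bullet> hy))"
        using q dist unfolding realizes_def dist_norm by simp
      have "2 * \<alpha> t * (hy \<bullet> hy) = 2 * \<alpha>0 * (hy \<bullet> hy) - (t - l {x, y})"
        unfolding \<alpha>_def using hy by (simp add: field_simps)
      then show ?thesis using 1 2 by simp
    qed
    show ?thesis unfolding realizes_def
    proof (intro ballI impI)
      fix a b assume ab: "a \<in> {x, y, p, r, w}" "b \<in> {x, y, p, r, w}" "a \<noteq> b"
      have old: "(dist (q a) (q b))\<^sup>2 = l {a, b}" using q ab unfolding realizes_def by blast
      consider "{a, b} = {x, y}" | "a = x" "b \<in> {p, r, w}" | "b = x" "a \<in> {p, r, w}"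
        | "a \<noteq> x" "b \<noteq> x" using ab by auto
      then show "(dist ((q(x := \<pi>x + h' t)) a) ((q(x := \<pi>x + h' t)) b))\<^sup>2 = (l({x, y} := t)) {a, b}"
      proof cases
        case 1
        then show ?thesis using near dist by (auto simp: doubleton_eq_iff dist_commute)
      next
        case 2
        then show ?thesis using far[of "q b"] old dist by (auto simp: doubleton_eq_iff)
      next
        case 3
        then show ?thesis using far[of "q a"] old dist by (auto simp: doubleton_eq_iff dist_commute)
      next
        case 4
        then show ?thesis using old by (auto simp: doubleton_eq_iff)
      qed
    qed
  qed
  have "(\<lambda>t. rad t) \<midarrow>l {x, y}\<rightarrow> rad (l {x, y})"
    unfolding rad_def \<alpha>_def using k0 hy by (intro isContD) (auto intro!: continuous_intros)
  moreover have "rad (l {x, y}) = 1"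
    unfolding rad_def \<alpha>_def using k0 kk by simp
  ultimately have "\<forall>\<^sub>F t in at (l {x, y}). rad t > 0"
    by (intro order_tendstoD(1)) auto
  then have "\<forall>\<^sub>F t in nhds (l {x, y}). rad t > 0"
    using \<open>rad (l {x, y}) = 1\<close> by (simp add: eventually_nhds_conv_at)
  then show ?thesis
    by eventually_elim (use real in \<open>metis less_imp_le\<close>)
qed

section \<open>Slopes of dihedral angles and their sum around a face\<close>

text \<open>The derivative of the dihedral angle by the squared length of \<open>{x, y}\<close>,
  obtained by inserting \<open>has_real_derivative_perp_inner\<close> into
  \<open>has_real_derivative_angle\<close>.\<close>

definition dihedral_slope :: "('v \<Rightarrow> real^4) \<Rightarrow> 'v \<Rightarrow> 'v \<Rightarrow> 'v \<Rightarrow> 'v \<Rightarrow> 'v \<Rightarrow> 'v \<Rightarrow> 'v \<Rightarrow> real" where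
  "dihedral_slope q a b c d e x y =
    (let k = perp_coeff q a b c; h = (\<lambda>z. perp (q b - q a) (q c - q a) (q z - q a)) in
     (k d x * k e y + k d y * k e x
      - h d \<bullet> h e * (k d x * k d y / (h d \<bullet> h d) + k e x * k e y / (h e \<bullet> h e)))
     / (2 * sqrt (gram (h d) (h e))))"

lemma dihedral_of_lengths_cong:
  assumes "\<And>x y. x \<in> s \<Longrightarrow> y \<in> s \<Longrightarrow> x \<noteq> y \<Longrightarrow> l {x, y} = l' {x, y}"
  shows "dihedral_of_lengths s i l = dihedral_of_lengths s i l'"
  unfolding dihedral_of_lengths_def using assms by (intro arg_cong[where f = The]) (auto simp: fun_eq_iff)

text \<open>The explicit formula is known to represent \<open>dihedral_of_lengths\<close> where the
  base triangle is nondegenerate and the lengths are realizable; both hold near the given lengths,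
  so the derivative carries over.\<close>

lemma has_real_derivative_dihedral:
  assumes dist: "distinct [a, b, c, d, e]" and s: "s = {a, b, c, d, e}" and i: "i = {a, b, c}"
    and q: "realizes q s l" and indep: "inj_on q s" "\<not> affine_dependent (q ` s)" and xy: "x \<noteq> y"
  shows "((\<lambda>t. dihedral_of_lengths s i (l({x, y} := t))) has_real_derivative
    dihedral_slope q a b c d e x y) (at (l {x, y}))"
proof (cases "x \<in> s \<and> y \<in> s")
  case False
  \<comment> \<open>For a pair that is not an edge of the simplex the angle is constant, and the
    coefficients in the slope vanish.\<close>
  have "dihedral_of_lengths s i (l({x, y} := t)) = dihedral_of_lengths s i l" for t
    by (rule dihedral_of_lengths_cong) (use False in \<open>auto simp: doubleton_eq_iff\<close>)
  moreover have "perp_coeff q a b c z w = 0" if "z \<in> s" "w \<notin> s" for z w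
    using that unfolding perp_coeff_def s by auto
  then have "dihedral_slope q a b c d e x y = 0"
    using False unfolding dihedral_slope_def Let_def s by auto
  ultimately show ?thesis by simp
next
  case True
  have nonzero: "orvol (q a') (q b') (q c') (q d') (q e') \<noteq> 0"
    if "distinct [a', b', c', d', e']" "s = {a', b', c', d', e'}" for a' b' c' d' e'
  proof (rule orvol_nonzero)
    show "distinct [q a', q b', q c', q d', q e']"
      using indep(1) that unfolding inj_on_def by auto
    show "\<not> affine_dependent {q a', q b', q c', q d', q e'}"
      using indep(2) unfolding that(2) by simp
  qed
  have nz: "orvol (q a) (q b) (q c) (q d) (q e) \<noteq> 0" by (rule nonzero[OF dist s])
  let ?t = "l {x, y}"
  let ?h = "\<lambda>z. perp (q b - q a) (q c - q a) (q z - q a)"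
  let ?k = "perp_coeff q a b c"
  have g: "gram (q b - q a) (q c - q a) > 0" by (rule orvol_nonzero_gram[OF nz])
  have F: "perp_inner l a b c z w = ?h z \<bullet> ?h w" if "{z, w} \<subseteq> {d, e}" for z w
    using that g by (intro perp_inner_eq[OF q]) (auto simp: s)
  have d: "((\<lambda>t. perp_inner (l({x, y} := t)) a b c z w) has_real_derivative
      - (?k z x * ?k w y + ?k z y * ?k w x) / 2) (at ?t)" if "{z, w} \<subseteq> {d, e}" for z w
    using that g dist s xy by (intro has_real_derivative_perp_inner[OF _ _ _ q]) auto
  have h0: "gram (?h d) (?h e) > 0" "?h d \<bullet> ?h d > 0" "?h e \<bullet> ?h e > 0"
    using orvol_nonzero_perp[OF nz] by auto
  have "((\<lambda>t. arccos (perp_inner (l({x, y} := t)) a b c d e /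
        (sqrt (perp_inner (l({x, y} := t)) a b c d d) * sqrt (perp_inner (l({x, y} := t)) a b c e e))))
      has_real_derivative
      - (- (?k d x * ?k e y + ?k d y * ?k e x) / 2 - perp_inner (l({x, y} := ?t)) a b c d e *
        (- (?k d x * ?k d y + ?k d y * ?k d x) / 2 / perp_inner (l({x, y} := ?t)) a b c d d +
         - (?k e x * ?k e y + ?k e y * ?k e x) / 2 / perp_inner (l({x, y} := ?t)) a b c e e) / 2)
      / sqrt (perp_inner (l({x, y} := ?t)) a b c d d * perp_inner (l({x, y} := ?t)) a b c e e -
         (perp_inner (l({x, y} := ?t)) a b c d e)\<^sup>2)) (at ?t)"
    using h0 by (intro has_real_derivative_angle d) (simp_all add: F gram_def)
  also have "- (- (?k d x * ?k e y + ?k d y * ?k e x) / 2 - perp_inner (l({x, y} := ?t)) a b c d e *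
        (- (?k d x * ?k d y + ?k d y * ?k d x) / 2 / perp_inner (l({x, y} := ?t)) a b c d d +
         - (?k e x * ?k e y + ?k e y * ?k e x) / 2 / perp_inner (l({x, y} := ?t)) a b c e e) / 2)
      / sqrt (perp_inner (l({x, y} := ?t)) a b c d d * perp_inner (l({x, y} := ?t)) a b c e e -
         (perp_inner (l({x, y} := ?t)) a b c d e)\<^sup>2) = dihedral_slope q a b c d e x y"
    using h0 by (simp add: F dihedral_slope_def Let_def gram_def[of "?h d" "?h e", symmetric])
      (simp add: field_simps)
  finally have deriv: "((\<lambda>t. arccos (perp_inner (l({x, y} := t)) a b c d e /
        (sqrt (perp_inner (l({x, y} := t)) a b c d d) * sqrt (perp_inner (l({x, y} := t)) a b c e e))))
      has_real_derivative dihedral_slope q a b c d e x y) (at ?t)" .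
  define K where "K t = (let g = edge_inner (l({x, y} := t)) a in g b b * g c c - (g b c)\<^sup>2)" for t
  have K: "K ?t \<noteq> 0"
    using g edge_inner_eq[OF q, of a] s unfolding K_def Let_def gram_def by simp
  have "\<forall>\<^sub>F t in nhds ?t. K t \<noteq> 0"
  proof -
    have "continuous (at ?t) (\<lambda>t. edge_inner (l({x, y} := t)) a p r)" for p r
      unfolding edge_inner_def
      by (intro continuous_intros DERIV_isCont[OF has_real_derivative_edge_length]) auto
    then have "isCont K ?t" unfolding K_def Let_def by (intro continuous_intros)
    then have "\<forall>\<^sub>F t in at ?t. K t \<noteq> 0"
      using K by (simp add: isCont_def tendsto_imp_eventually_ne)
    then show ?thesis using K by (simp add: eventually_nhds_conv_at)
  qed
  moreover have "\<forall>\<^sub>F t in nhds ?t. \<exists>q'. realizes q' s (l({x, y} := t))"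
  proof -
    have "card (s - {x, y}) = 3"
      using True xy dist unfolding s by (subst card_Diff_subset) auto
    then obtain p r w where prw: "s - {x, y} = {p, r, w}" "p \<noteq> r" "p \<noteq> w" "r \<noteq> w"
      unfolding card_3_iff by blast
    then have s': "s = {x, y, p, r, w}" and dist': "distinct [x, y, p, r, w]" using True xy by auto
    have "orvol (q p) (q r) (q w) (q x) (q y) \<noteq> 0"
      by (rule nonzero) (use s' dist' in auto)
    then show ?thesis using realizes_nearby[OF dist'] q unfolding s' by blast
  qed
  ultimately have "\<forall>\<^sub>F t in nhds ?t. dihedral_of_lengths s i (l({x, y} := t)) =
      arccos (perp_inner (l({x, y} := t)) a b c d e /
        (sqrt (perp_inner (l({x, y} := t)) a b c d d) * sqrt (perp_inner (l({x, y} := t)) a b c e e)))"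
  proof eventually_elim
    case (elim t)
    then show ?case using dihedral_of_lengths_eq[OF dist s i] unfolding K_def Let_def by blast
  qed
  then show ?thesis using deriv by (simp add: DERIV_cong_ev)
qed

text \<open>Base times height gives the root in the slope as \<open>\<bar>m\<bar>\<close> over twice
  the area of the base. The sign of the simplex turns \<open>\<bar>m\<bar>\<close> into
  \<open>m\<close>, which makes the three angles at a face summable.\<close>

lemma dihedral_slope_eq:
  assumes g: "gram (q b - q a) (q c - q a) > 0"
    and v: "\<bar>orvol (q a) (q b) (q c) (q d) (q e)\<bar> = \<bar>m\<bar>" and m: "m \<noteq> 0"
  defines "k \<equiv> perp_coeff q a b c" and "h \<equiv> \<lambda>z. perp (q b - q a) (q c - q a) (q z - q a)"
  shows "sgn m * dihedral_slope q a b c d e x y =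
    sqrt (gram (q b - q a) (q c - q a)) / 2 / m *
    (k d x * k e y + k d y * k e x
      - (h d \<bullet> h e / (h d \<bullet> h d) * (k d x * k d y) + h d \<bullet> h e / (h e \<bullet> h e) * (k e x * k e y)))"
proof -
  let ?g = "gram (q b - q a) (q c - q a)"
  have "m\<^sup>2 = ?g * gram (h d) (h e)"
    using orvol_sq[of "q b" "q a" "q c" "q d" "q e"] g v unfolding h_def by (metis less_irrefl power2_abs)
  then have "\<bar>m\<bar> = sqrt ?g * sqrt (gram (h d) (h e))"
    by (metis real_sqrt_abs real_sqrt_mult)
  then have sq: "sqrt (gram (h d) (h e)) = \<bar>m\<bar> / sqrt ?g" using g by simp
  have sg: "sgn m / \<bar>m\<bar> = 1 / m" using m by (simp add: sgn_if abs_if)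
  have "sgn m * (N / (2 * sqrt (gram (h d) (h e)))) = sqrt ?g / 2 / m * N" for N
  proof -
    have "sgn m * (N / (2 * (\<bar>m\<bar> / sqrt ?g))) = sqrt ?g / 2 * (sgn m / \<bar>m\<bar>) * N"
      using m g by (simp add: field_simps)
    then show ?thesis unfolding sq sg by simp
  qed
  then show ?thesis
    unfolding dihedral_slope_def Let_def h_def[symmetric] k_def[symmetric]
    by (simp add: distrib_left)
qed

text \<open>Here \<open>dx\<close>, \<open>ex\<close>, \<open>fx\<close> stand for the coefficients
  of the vertex \<open>x\<close> in the three perpendiculars, and \<open>de\<close> for the inner
  product of those from \<open>d\<close> and \<open>e\<close> over the square of the one from
  \<open>d\<close>. After multiplication by \<open>ld * le * lf\<close> the mixed products on the
  right appear directly, and the three relations turn the remaining terms into the diagonal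
  ones.\<close>

lemma cluster_identity:
  fixes ld le lf :: real
  assumes "le * de + lf * df = - ld" "ld * ed + lf * ef = - le" "ld * fd + le * fe = - lf"
    and "ld \<noteq> 0" "le \<noteq> 0" "lf \<noteq> 0"
  shows "1 / lf * (dx * ey + dy * ex - (de * (dx * dy) + ed * (ex * ey)))
    + 1 / ld * (ex * fy + ey * fx - (ef * (ex * ey) + fe * (fx * fy)))
    + 1 / le * (dx * fy + dy * fx - (df * (dx * dy) + fd * (fx * fy))) =
    (ld * dx + le * ex + lf * fx) * (ld * dy + le * ey + lf * fy) / (ld * le * lf)"
proof -
  have "(ld * dx + le * ex + lf * fx) * (ld * dy + le * ey + lf * fy) =
    ld * le * (dx * ey + dy * ex - (de * (dx * dy) + ed * (ex * ey)))
    + le * lf * (ex * fy + ey * fx - (ef * (ex * ey) + fe * (fx * fy)))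
    + ld * lf * (dx * fy + dy * fx - (df * (dx * dy) + fd * (fx * fy)))"
  proof -
    have "ld * le * (dx * ey + dy * ex - (de * (dx * dy) + ed * (ex * ey)))
        + le * lf * (ex * fy + ey * fx - (ef * (ex * ey) + fe * (fx * fy)))
        + ld * lf * (dx * fy + dy * fx - (df * (dx * dy) + fd * (fx * fy))) =
        ld * le * (dx * ey + dy * ex) + le * lf * (ex * fy + ey * fx) + ld * lf * (dx * fy + dy * fx)
        - ld * (le * de + lf * df) * (dx * dy) - le * (ld * ed + lf * ef) * (ex * ey)
        - lf * (ld * fd + le * fe) * (fx * fy)"
      by (simp add: algebra_simps)
    then show ?thesis unfolding assms(1-3) by (simp add: algebra_simps)
  qed
  then show ?thesis using assms(4-6) by (simp add: field_simps)
qed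

text \<open>The perpendiculars at a face inherit the dependency \<open>\<mu>\<close>; inner products
  with each of them give the relations of \<open>cluster_identity\<close>, whose right side then
  factors into \<open>\<mu> x\<close> and \<open>\<mu> y\<close>.\<close>

lemma dihedral_slope_cluster:
  assumes dist: "distinct [a, b, c, d, e, f]"
    and dep: "(\<Sum>z\<in>{a, b, c, d, e, f}. \<mu> z) = 0" "(\<Sum>z\<in>{a, b, c, d, e, f}. \<mu> z *\<^sub>R q z) = 0"
    and nz: "\<mu> d \<noteq> 0" "\<mu> e \<noteq> 0" "\<mu> f \<noteq> 0"
    and vol: "\<bar>orvol (q a) (q b) (q c) (q d) (q e)\<bar> = \<bar>\<mu> f\<bar>"
      "\<bar>orvol (q a) (q b) (q c) (q e) (q f)\<bar> = \<bar>\<mu> d\<bar>"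
      "\<bar>orvol (q a) (q b) (q c) (q d) (q f)\<bar> = \<bar>\<mu> e\<bar>"
    and xy: "x \<in> {a, b, c, d, e, f}" "y \<in> {a, b, c, d, e, f}"
  shows "sgn (\<mu> f) * dihedral_slope q a b c d e x y + sgn (\<mu> d) * dihedral_slope q a b c e f x y
      + sgn (\<mu> e) * dihedral_slope q a b c d f x y =
    sqrt (gram (q b - q a) (q c - q a)) / 2 * (\<mu> x * \<mu> y) / (\<mu> d * \<mu> e * \<mu> f)"
proof -
  let ?u = "q b - q a" and ?v = "q c - q a"
  define k where "k = perp_coeff q a b c"
  define h where "h z = perp ?u ?v (q z - q a)" for z
  have ov: "orvol (q a) (q b) (q c) (q d) (q e) \<noteq> 0" "orvol (q a) (q b) (q c) (q e) (q f) \<noteq> 0"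
    using vol nz by auto
  have g: "gram ?u ?v > 0" by (rule orvol_nonzero_gram[OF ov(1)])
  have h0: "h d \<noteq> 0" "h e \<noteq> 0" "h f \<noteq> 0"
    using orvol_nonzero_perp[OF ov(1)] orvol_nonzero_perp[OF ov(2)] unfolding h_def by auto
  have dep': "(\<Sum>z\<in>{a, b, c, d, e, f}. \<mu> z *\<^sub>R (q z - q a)) = 0"
    using dep by (simp only: scaleR_diff_right sum_subtractf flip: scaleR_left.sum) simp
  have lin: "T d + T e + T f = - T b - T c"
    if "linear F" "T = (\<lambda>z. \<mu> z *\<^sub>R F (q z - q a))" for F :: "real^4 \<Rightarrow> 'x::real_vector" and T
  proof -
    have "0 = F (\<Sum>z\<in>{a, b, c, d, e, f}. \<mu> z *\<^sub>R (q z - q a))"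
      unfolding dep' using linear_0[OF that(1)] by simp
    also have "\<dots> = (\<Sum>z\<in>{a, b, c, d, e, f}. T z)"
      unfolding that(2) by (simp add: linear_sum[OF that(1)] linear_scale[OF that(1)])
    also have "\<dots> = T b + T c + T d + T e + T f"
      using dist linear_0[OF that(1)] unfolding that(2) by (simp add: add.assoc)
    finally show ?thesis by (simp add: algebra_simps eq_neg_iff_add_eq_0)
  qed
  have h_dep: "\<mu> d *\<^sub>R h d + \<mu> e *\<^sub>R h e + \<mu> f *\<^sub>R h f = 0"
    using lin[OF linear_perp[of ?u ?v] refl] g
    by (simp add: h_def perp_def proj_coord_base gram_commute[of ?v ?u])
  have coord: "\<mu> d * proj_coord ?u ?v (q d - q a) + \<mu> e * proj_coord ?u ?v (q e - q a)
      + \<mu> f * proj_coord ?u ?v (q f - q a) = - \<mu> b"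
    "\<mu> d * proj_coord ?v ?u (q d - q a) + \<mu> e * proj_coord ?v ?u (q e - q a)
      + \<mu> f * proj_coord ?v ?u (q f - q a) = - \<mu> c"
    using lin[OF linear_proj_coord[of ?u ?v] refl] lin[OF linear_proj_coord[of ?v ?u] refl] g
    by (simp_all add: proj_coord_base gram_commute[of ?v ?u])
  \<comment> \<open>The weighted sum of the three perpendiculars is zero; written out in the
    vertices, its coefficients are those of \<open>\<mu>\<close> itself: at \<open>d, e, f\<close>
    by construction, at \<open>b, c\<close> by \<open>coord\<close>, at \<open>a\<close> because the
    sum is zero.\<close>
  have \<mu>: "\<mu> z = \<mu> d * k d z + \<mu> e * k e z + \<mu> f * k f z" if z: "z \<in> {a, b, c, d, e, f}" for z
  proof -
    have neq: "a \<noteq> b" "a \<noteq> c" "a \<noteq> d" "a \<noteq> e" "a \<noteq> f" "b \<noteq> c" "b \<noteq> d" "b \<noteq> e" "b \<noteq> f" "c \<noteq> d"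
      "c \<noteq> e" "c \<noteq> f" "d \<noteq> e" "d \<noteq> f" "e \<noteq> f" "b \<noteq> a" "c \<noteq> a" "d \<noteq> a" "e \<noteq> a" "f \<noteq> a" "c \<noteq> b"
      "d \<noteq> b" "e \<noteq> b" "f \<noteq> b" "d \<noteq> c" "e \<noteq> c" "f \<noteq> c" "e \<noteq> d" "f \<noteq> d" "f \<noteq> e"
      using dist by auto
    have sum0: "\<mu> a = - \<mu> b - \<mu> c - \<mu> d - \<mu> e - \<mu> f"
      using dep(1) neq by simp
    consider "z = a" | "z = b" | "z = c" | "z \<in> {d, e, f}" using z by auto
    then show ?thesis
    proof cases
      case 1
      have "\<mu> d * k d a + \<mu> e * k e a + \<mu> f * k f a =
          (\<mu> d * proj_coord ?u ?v (q d - q a) + \<mu> e * proj_coord ?u ?v (q e - q a)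
             + \<mu> f * proj_coord ?u ?v (q f - q a))
          + (\<mu> d * proj_coord ?v ?u (q d - q a) + \<mu> e * proj_coord ?v ?u (q e - q a)
             + \<mu> f * proj_coord ?v ?u (q f - q a)) - \<mu> d - \<mu> e - \<mu> f"
        by (simp add: k_def perp_coeff_def Let_def algebra_simps)
      then show ?thesis unfolding coord 1 using sum0 by simp
    next
      case 2
      then show ?thesis using coord(1) neq by (simp add: k_def perp_coeff_def Let_def)
    next
      case 3
      then show ?thesis using coord(2) neq by (simp add: k_def perp_coeff_def Let_def)
    next
      case 4
      then show ?thesis using neq by (auto simp: k_def perp_coeff_def Let_def)
    qed
  qed
  have inner_dep: "\<mu> e * (h d \<bullet> h e / (h d \<bullet> h d)) + \<mu> f * (h d \<bullet> h f / (h d \<bullet> h d)) = - \<mu> d"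
    if h0: "h d \<noteq> 0" and dep: "\<mu> d *\<^sub>R h d + \<mu> e *\<^sub>R h e + \<mu> f *\<^sub>R h f = 0" for d e f
  proof -
    have "h d \<bullet> (\<mu> d *\<^sub>R h d + \<mu> e *\<^sub>R h e + \<mu> f *\<^sub>R h f) = 0" unfolding dep by simp
    then show ?thesis using h0 by (simp add: inner_add_right field_simps)
  qed
  have I1: "\<mu> e * (h d \<bullet> h e / (h d \<bullet> h d)) + \<mu> f * (h d \<bullet> h f / (h d \<bullet> h d)) = - \<mu> d"
    by (rule inner_dep[OF h0(1) h_dep])
  have I2: "\<mu> d * (h d \<bullet> h e / (h e \<bullet> h e)) + \<mu> f * (h e \<bullet> h f / (h e \<bullet> h e)) = - \<mu> e"
    using inner_dep[OF h0(2), of d f] h_dep by (simp add: inner_commute add_ac)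
  have I3: "\<mu> d * (h d \<bullet> h f / (h f \<bullet> h f)) + \<mu> e * (h e \<bullet> h f / (h f \<bullet> h f)) = - \<mu> f"
    using inner_dep[OF h0(3), of d e] h_dep by (simp add: inner_commute add_ac)
  note slope = dihedral_slope_eq[where q = q and a = a and b = b and c = c and d = d and e = e, OF g vol(1) nz(3), folded h_def k_def]
    dihedral_slope_eq[where q = q and a = a and b = b and c = c and d = e and e = f, OF g vol(2) nz(1), folded h_def k_def]
    dihedral_slope_eq[where q = q and a = a and b = b and c = c and d = d and e = f, OF g vol(3) nz(2), folded h_def k_def]
  note id = cluster_identity[OF I1 I2 I3 nz, of "k d x" "k e y" "k d y" "k e x" "k f y" "k f x"]
  define s where "s = sqrt (gram ?u ?v) / 2"
  have distrib: "s / l1 * n1 + s / l2 * n2 + s / l3 * n3 = s * (1 / l1 * n1 + 1 / l2 * n2 + 1 / l3 * n3)"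
    for l1 l2 l3 n1 n2 n3
    by (simp add: distrib_left)
  show ?thesis
    unfolding slope s_def[symmetric] distrib id \<mu>[OF xy(1), symmetric] \<mu>[OF xy(2), symmetric] by simp
qed

section \<open>Areas and edge deviations\<close>

lemma triangle_area_gram: "triangle_area a b c = sqrt (gram (b - a) (c - a)) / 2"
  unfolding triangle_area_def gram_def by (simp add: power2_norm_eq_inner)

lemma gram_shear: "gram (- u) (v - u) = gram u v"
  unfolding gram_def
  by (simp add: inner_diff_left inner_diff_right inner_commute algebra_simps power2_eq_square)

lemma triangle_area_swap: "triangle_area b a c = triangle_area a b c" "triangle_area a c b = triangle_area a b c"
  using gram_shear[of "b - a" "c - a"] gram_commute[of "c - a" "b - a"]
  unfolding triangle_area_gram by simp_all

lemma triangle_area_motion: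
  assumes "motion m"
  shows "triangle_area (m a) (m b) (m c) = triangle_area a b c"
proof -
  have area: "triangle_area a b c = sqrt ((dist b a)\<^sup>2 * (dist c a)\<^sup>2
      - (((dist b a)\<^sup>2 + (dist c a)\<^sup>2 - (dist b c)\<^sup>2) / 2)\<^sup>2) / 2" for a b c :: "real^4"
  proof -
    have inner: "(b - a) \<bullet> (c - a) = ((dist b a)\<^sup>2 + (dist c a)\<^sup>2 - (dist b c)\<^sup>2) / 2"
      unfolding dist_norm power2_norm_eq_inner
      by (simp add: inner_diff_left inner_diff_right inner_commute)
    show ?thesis unfolding triangle_area_def inner unfolding dist_norm ..
  qed
  show ?thesis
    unfolding area[of "m a"] area[of a] dist_motion[OF assms] ..
qed

text \<open>Only one vertex of the midpoint triangle moves, and \<open>w\<close> is orthogonal to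
  the opposite side, which is parallel to \<open>a - b\<close>; so the mixed inner product stays
  constant and only the square of one side varies in the Gram determinant.\<close>

lemma has_real_derivative_triangle_area_midpoints:
  assumes "triangle_area a b c > 0" "(a - b) \<bullet> w = 0"
  shows "((\<lambda>\<tau>. 4 * triangle_area (midpoint a b + \<tau> *\<^sub>R w) (midpoint b c) (midpoint c a) - triangle_area a b c)
    has_real_derivative (dist a b)\<^sup>2 * ((a - c) \<bullet> w) / (2 * triangle_area a b c)) (at 0)"
proof -
  let ?p = "\<lambda>\<tau>. midpoint a b + \<tau> *\<^sub>R w - midpoint b c" and ?r = "midpoint c a - midpoint b c"
  have p: "?p \<tau> = (1/2) *\<^sub>R (a - c) + \<tau> *\<^sub>R w" for \<tau>
    unfolding midpoint_def by (simp add: algebra_simps)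
  have r: "?r = (1/2) *\<^sub>R (a - b)" unfolding midpoint_def by (simp add: algebra_simps)
  have area: "triangle_area (midpoint a b + \<tau> *\<^sub>R w) (midpoint b c) (midpoint c a) =
      sqrt (gram (?p \<tau>) ?r) / 2" for \<tau>
    using triangle_area_swap(1) unfolding triangle_area_gram by metis
  have gr: "gram (?p \<tau>) ?r = ((a - c) \<bullet> (a - c) / 4 + \<tau> * ((a - c) \<bullet> w) + \<tau>\<^sup>2 * (w \<bullet> w)) *
      ((a - b) \<bullet> (a - b)) / 4 - ((a - c) \<bullet> (a - b))\<^sup>2 / 16" for \<tau>
  proof -
    have pp: "?p \<tau> \<bullet> ?p \<tau> = (a - c) \<bullet> (a - c) / 4 + \<tau> * ((a - c) \<bullet> w) + \<tau>\<^sup>2 * (w \<bullet> w)"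
      unfolding p by (simp only: inner_add_left inner_add_right inner_scaleR_left inner_scaleR_right
          inner_commute[of w "a - c"]) (simp add: field_simps power2_eq_square)
    have pr: "?p \<tau> \<bullet> ?r = (a - c) \<bullet> (a - b) / 4"
      unfolding p r using assms(2)
      by (simp only: inner_add_left inner_scaleR_left inner_scaleR_right inner_commute[of w "a - b"]) simp
    have rr: "?r \<bullet> ?r = (a - b) \<bullet> (a - b) / 4" unfolding r by simp
    show ?thesis unfolding gram_def pp pr rr by (simp add: power_divide)
  qed
  have d: "((\<lambda>\<tau>. gram (?p \<tau>) ?r) has_real_derivative ((a - c) \<bullet> w) * ((a - b) \<bullet> (a - b)) / 4) (at 0)"
    unfolding gr by (auto intro!: derivative_eq_intros)
  have g0: "gram (?p 0) ?r = (triangle_area a b c / 2)\<^sup>2"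
  proof -
    have "gram (?p 0) ?r =
        ((a - c) \<bullet> (a - c) / 4) * ((a - b) \<bullet> (a - b)) / 4 - ((a - c) \<bullet> (a - b))\<^sup>2 / 16"
      using gr[of 0] by simp
    also have "\<dots> = gram (c - a) (b - a) / 16"
      unfolding gram_def
      by (simp add: inner_diff_left inner_diff_right inner_commute field_simps power2_eq_square)
    also have "\<dots> = (triangle_area a b c / 2)\<^sup>2"
      unfolding triangle_area_gram gram_commute[of "c - a"] by (simp add: power_divide gram_nonneg)
    finally show ?thesis .
  qed
  have sg: "sqrt (gram (?p 0) ?r) = triangle_area a b c / 2"
    unfolding g0 real_sqrt_abs using assms(1) by simp
  have "gram (?p 0) ?r > 0" unfolding g0 using assms(1) by simp
  then have "((\<lambda>\<tau>. sqrt (gram (?p \<tau>) ?r)) has_real_derivative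
      inverse (sqrt (gram (?p 0) ?r)) / 2 * (((a - c) \<bullet> w) * ((a - b) \<bullet> (a - b)) / 4)) (at 0)"
    by (intro DERIV_chain2[OF DERIV_real_sqrt] d)
  then have "((\<lambda>\<tau>. 4 * (sqrt (gram (?p \<tau>) ?r) / 2) - triangle_area a b c) has_real_derivative
      4 * (inverse (sqrt (gram (?p 0) ?r)) / 2 * (((a - c) \<bullet> w) * ((a - b) \<bullet> (a - b)) / 4) / 2) - 0) (at 0)"
    by (intro DERIV_diff DERIV_cmult DERIV_cdivide DERIV_const)
  also have "4 * (inverse (sqrt (gram (?p 0) ?r)) / 2 * (((a - c) \<bullet> w) * ((a - b) \<bullet> (a - b)) / 4) / 2) - 0 =
      (dist a b)\<^sup>2 * ((a - c) \<bullet> w) / (2 * triangle_area a b c)"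
    unfolding sg dist_norm power2_norm_eq_inner using assms(1) by (simp add: field_simps)
  finally show ?thesis unfolding area .
qed

text \<open>Multiply by \<open>det4 u (m 0) (m 1) (m 2)\<close>, whose absolute value is
  \<open>norm u\<close>: the product is a determinant of inner products with first row
  \<open>u \<bullet> u, 0, 0, 0\<close>.\<close>

lemma det4_orthonormal:
  assumes on: "\<And>j k. j < 3 \<Longrightarrow> k < 3 \<Longrightarrow> m j \<bullet> m k = (if j = k then 1 else 0)"
    and perp: "\<And>k. k < 3 \<Longrightarrow> u \<bullet> m k = 0" and u: "u \<noteq> 0"
  shows "\<bar>det4 u x y z\<bar> = norm u *
    \<bar>(x \<bullet> m 0) * ((y \<bullet> m 1) * (z \<bullet> m 2) - (y \<bullet> m 2) * (z \<bullet> m 1))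
     - (x \<bullet> m 1) * ((y \<bullet> m 0) * (z \<bullet> m 2) - (y \<bullet> m 2) * (z \<bullet> m 0))
     + (x \<bullet> m 2) * ((y \<bullet> m 0) * (z \<bullet> m 1) - (y \<bullet> m 1) * (z \<bullet> m (0::nat)))\<bar>"
    (is "_ = norm u * \<bar>?d x y z\<bar>")
proof -
  have prod: "det4 u x y z * det4 u (m 0) (m 1) (m 2) = (u \<bullet> u) * ?d x y z" for x y z
  proof -
    let ?A = "vector [u, x, y, z] :: real^4^4" and ?B = "vector [u, m 0, m 1, m 2] :: real^4^4"
    have entry: "(?A ** Finite_Cartesian_Product.transpose ?B) $ i $ j = ?A $ i \<bullet> ?B $ j" for i j
      by (simp add: matrix_matrix_mult_def Finite_Cartesian_Product.transpose_def inner_vec_def)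
    have "det4 u x y z * det4 u (m 0) (m 1) (m 2) =
        Determinants.det (?A ** Finite_Cartesian_Product.transpose ?B)"
      by (simp add: det4_def Determinants.det_mul Determinants.det_transpose)
    also have "\<dots> = (u \<bullet> u) * ?d x y z"
      unfolding det_4 entry using perp by simp
    finally show ?thesis .
  qed
  have "?d (m 0) (m 1) (m 2) = 1" by (simp add: on)
  then have "(det4 u (m 0) (m 1) (m 2))\<^sup>2 = (norm u)\<^sup>2"
    using prod[of "m 0" "m 1" "m 2"] unfolding power2_norm_eq_inner by (simp add: power2_eq_square)
  then have "\<bar>det4 u (m 0) (m 1) (m 2)\<bar> = norm u" by (metis abs_norm_cancel real_sqrt_abs)
  then have "\<bar>det4 u x y z\<bar> * norm u = norm u * norm u * \<bar>?d x y z\<bar>"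
    using arg_cong[OF prod[of x y z], of abs]
    by (simp add: abs_mult power2_norm_eq_inner[symmetric] power2_eq_square)
  then show ?thesis using u by simp
qed

section \<open>Metric quantities and lifts\<close>

text \<open>The first element of \<open>xs\<close> is brought to the front of \<open>ys\<close> by
  adjacent swaps, and the tails are treated by induction. Invariance is asked only of lists with the
  multiset \<open>M\<close>, because an orientation is alternating only on orderings of
  simplices.\<close>

lemma adjacent_swaps_invariant:
  assumes "\<And>us x y vs. mset (us @ x # y # vs) = M \<Longrightarrow> f (us @ x # y # vs) = f (us @ y # x # vs)"
    and "mset xs = M" "mset ys = M"
  shows "f xs = f ys"
  using assms
proof (induction xs arbitrary: f ys M)
  case Nil
  then show ?case by simp
next
  case (Cons x xs)
  have "x \<in> set ys" using Cons.prems(2,3) by (metis list.set_intros(1) set_mset_mset)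
  then obtain us vs where ys: "ys = us @ x # vs" by (meson split_list)
  have move: "f (us @ x # vs) = f (x # us @ vs)" if "mset (us @ x # vs) = M" for us vs
    using that
  proof (induction us arbitrary: vs rule: rev_induct)
    case (snoc u us)
    have "f (us @ u # x # vs) = f (us @ x # u # vs)"
      by (rule Cons.prems(1)) (use snoc.prems in \<open>simp add: add_mset_commute\<close>)
    also have "\<dots> = f (x # us @ u # vs)"
      by (rule snoc.IH) (use snoc.prems in \<open>simp add: add_mset_commute\<close>)
    finally show ?case by simp
  qed simp
  have "f (x # xs) = f (x # us @ vs)"
  proof (rule Cons.IH[of "M - {#x#}" "\<lambda>l. f (x # l)"])
    show "f (x # us @ x' # y # vs) = f (x # us @ y # x' # vs)" if "mset (us @ x' # y # vs) = M - {#x#}"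
      for us x' y vs
    proof -
      have "x \<in># M" using Cons.prems(2) by auto
      then have "mset ((x # us) @ x' # y # vs) = M" using that by simp
      from Cons.prems(1)[OF this] show ?thesis by simp
    qed
    show "mset xs = M - {#x#}" using Cons.prems(2) by auto
    show "mset (us @ vs) = M - {#x#}" using Cons.prems(3) ys by auto
  qed
  then show ?case using move[of us vs] ys Cons.prems(3) by simp
qed

lemma det4_zero [simp]:
  "det4 0 v w z = 0" "det4 u 0 w z = 0" "det4 u v 0 z = 0" "det4 u v w 0 = 0"
  unfolding det4_eq by simp_all

definition orvol_list :: "('v \<Rightarrow> real^4) \<Rightarrow> 'v list \<Rightarrow> real" where
  "orvol_list q xs = orvol (q (xs ! 0)) (q (xs ! 1)) (q (xs ! 2)) (q (xs ! 3)) (q (xs ! 4))"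

lemma orientation_orvol_swap:
  assumes o: "orientation K sg" and xs: "xs = us @ x # y # vs" "distinct xs" "length xs = 5" "set xs \<in> K"
  shows "sg (us @ y # x # vs) * orvol_list q (us @ y # x # vs) = sg xs * orvol_list q xs"
proof -
  let ?k = "length us"
  have k: "?k < 4" using xs by simp
  have "xs[?k := xs ! Suc ?k, Suc ?k := xs ! ?k] = us @ y # x # vs"
    unfolding xs(1) by (simp add: nth_append list_update_append)
  moreover have "sg (xs[?k := xs ! Suc ?k, Suc ?k := xs ! ?k]) = - sg xs"
    using o xs(2-4) k unfolding orientation_def by simp
  ultimately have 1: "sg (us @ y # x # vs) = - sg xs" by simp
  have "?k = 0 \<or> ?k = 1 \<or> ?k = 2 \<or> ?k = 3" using k by arith
  then have "orvol_list q (us @ y # x # vs) = - orvol_list q xs"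
  proof (elim disjE)
    assume "length us = 0"
    then show ?thesis unfolding xs(1) orvol_list_def
      by (simp add: nth_append) (rule orvol_swap(1))
  next
    assume "length us = 1"
    then show ?thesis unfolding xs(1) orvol_list_def
      by (simp add: nth_append) (rule orvol_swap(2))
  next
    assume "length us = 2"
    then show ?thesis unfolding xs(1) orvol_list_def
      by (simp add: nth_append) (rule orvol_swap(3))
  next
    assume "length us = 3"
    then show ?thesis unfolding xs(1) orvol_list_def
      by (simp add: nth_append) (rule orvol_swap(4))
  qed
  with 1 show ?thesis by simp
qed

text \<open>Sign and volume are both alternating, so their product does not depend on the ordering.
  Thus the ordering picked by \<open>SOME\<close> in \<open>simplex_sign\<close> can be replaced by
  any other.\<close>

lemma orientation_orvol_invariant:
  assumes o: "orientation K sg" and "distinct xs" "length xs = 5" "set xs \<in> K"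
    and "distinct ys" "set ys = set xs"
  shows "sg ys * orvol_list q ys = sg xs * orvol_list q xs"
proof -
  have "mset ys = mset xs" using assms set_eq_iff_mset_eq_distinct by blast
  then show ?thesis
  proof (rule adjacent_swaps_invariant[where f = "\<lambda>xs. sg xs * orvol_list q xs" and M = "mset xs", rotated])
    fix us x y vs
    assume *: "mset (us @ x # y # vs) = mset xs"
    have "distinct (us @ x # y # vs)" "length (us @ x # y # vs) = 5" "set (us @ x # y # vs) = set xs"
      using assms(2,3) mset_eq_imp_distinct_iff[OF *] mset_eq_length[OF *] mset_eq_setD[OF *] by auto
    then show "sg (us @ x # y # vs) * orvol_list q (us @ x # y # vs) =
        sg (us @ y # x # vs) * orvol_list q (us @ y # x # vs)"
      using orientation_orvol_swap[OF o refl] assms(4) by simp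
  qed simp
qed

section \<open>Equivariant placements and the choice of lifts\<close>

locale equivariant_complex =
  fixes X :: "('v, 'u) placed_complex" and \<rho> :: "('u \<Rightarrow> 'u) \<Rightarrow> real^4 \<Rightarrow> real^4"
  assumes complex: "abstract_complex (simplices X)" and cover: "universal_cover X"
    and equivariant: "equivariant_placement X \<rho>"
begin

lemma deck_image_cover: "g \<in> deck_group X \<Longrightarrow> g ` t \<in> cover X \<longleftrightarrow> t \<in> cover X"
  unfolding deck_group_def by blast

lemma proj_deck [simp]: "g \<in> deck_group X \<Longrightarrow> proj X (g u) = proj X u"
  unfolding deck_group_def by (metis (mono_tags, lifting) comp_apply mem_Collect_eq)

lemma place_deck: "g \<in> deck_group X \<Longrightarrow> place X (g u) = \<rho> g (place X u)"
  using equivariant unfolding equivariant_placement_def by blast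

lemma motion_deck: "g \<in> deck_group X \<Longrightarrow> motion (\<rho> g)"
  using equivariant unfolding equivariant_placement_def by blast

lemma deck_transitive: "proj X u = proj X w \<Longrightarrow> \<exists>g\<in>deck_group X. g u = w"
  using cover unfolding universal_cover_def by blast

lemma cover_unique: "s \<in> simplices X \<Longrightarrow> proj X u \<in> s \<Longrightarrow> \<exists>!t. t \<in> cover X \<and> u \<in> t \<and> proj X ` t = s"
  using cover unfolding universal_cover_def by blast

lemma proj_cover: "t \<in> cover X \<Longrightarrow> proj X ` t \<in> simplices X"
  and inj_proj_cover: "t \<in> cover X \<Longrightarrow> inj_on (proj X) t"
  and surj_proj: "\<exists>u. proj X u = v"
  using cover unfolding universal_cover_def surj_def by (blast, blast, metis)

lemma complex_cover: "abstract_complex (cover X)"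
  using cover unfolding universal_cover_def by blast

lemma cover_nonempty: "t \<in> cover X \<Longrightarrow> t \<noteq> {}"
  using complex_cover unfolding abstract_complex_def by simp

lemma cover_subset: "t \<in> cover X \<Longrightarrow> r \<subseteq> t \<Longrightarrow> r \<noteq> {} \<Longrightarrow> r \<in> cover X"
  using complex_cover[unfolded abstract_complex_def, THEN conjunct2, THEN conjunct1] by blast

lemma simplex_subset: "s \<in> simplices X \<Longrightarrow> r \<subseteq> s \<Longrightarrow> r \<noteq> {} \<Longrightarrow> r \<in> simplices X"
  using complex[unfolded abstract_complex_def, THEN conjunct2, THEN conjunct1] by blast

lemma simplex_nonempty: "s \<in> simplices X \<Longrightarrow> s \<noteq> {}"
  using complex unfolding abstract_complex_def by simp

lemma cover_eq: "t \<in> cover X \<Longrightarrow> t' \<in> cover X \<Longrightarrow> proj X ` t = proj X ` t' \<Longrightarrow> u \<in> t \<Longrightarrow> u \<in> t' \<Longrightarrow> t = t'"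
  using cover_unique[of "proj X ` t" u] proj_cover by (metis imageI)

text \<open>A simplex of the cover is determined by its projection and one vertex, so it suffices to
  follow a single vertex.\<close>

lemma deck_image_eq:
  assumes "g \<in> deck_group X" "t \<in> cover X" "t' \<in> cover X" "proj X ` t = proj X ` t'" "u \<in> t" "g u \<in> t'"
  shows "g ` t = t'"
proof (rule cover_eq[OF _ assms(3)])
  show "g ` t \<in> cover X" using assms deck_image_cover by blast
  show "proj X ` g ` t = proj X ` t'" using assms by (simp add: image_image)
qed (use assms in auto)

lemma lifts_deck_equivalent:
  assumes "t \<in> cover X" "t' \<in> cover X" "proj X ` t = proj X ` t'"
  shows "\<exists>g\<in>deck_group X. g ` t = t'"
proof -
  obtain u where u: "u \<in> t" using cover_nonempty assms by blast
  then obtain w where w: "w \<in> t'" "proj X w = proj X u" using assms(3) by (metis imageE imageI)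
  obtain g where g: "g \<in> deck_group X" "g u = w" using deck_transitive w by metis
  then show ?thesis using deck_image_eq[OF g(1) assms u] w by blast
qed

lemma lift_X: "s \<in> simplices X \<Longrightarrow> lift X s \<in> cover X \<and> proj X ` lift X s = s"
proof -
  assume s: "s \<in> simplices X"
  then obtain v where "v \<in> s" using simplex_nonempty by blast
  moreover obtain u where "proj X u = v" using surj_proj by blast
  ultimately have "\<exists>t. t \<in> cover X \<and> proj X ` t = s" using cover_unique[OF s, of u] by blast
  then show ?thesis unfolding lift_def by (rule someI_ex)
qed

text \<open>\<open>\<sigma>\<close> is a section of the covering over \<open>r\<close>, and \<open>\<sigma> ` r\<close> is equivalent under the deck group to
  the lift of \<open>r\<close> chosen in \<open>Z\<close>; the metric quantities of \<open>Z\<close> can then be read off from \<open>\<sigma>\<close>.\<close>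

definition models :: "('v, 'u) placed_complex \<Rightarrow> ('v \<Rightarrow> 'u) \<Rightarrow> 'v set \<Rightarrow> bool" where
  "models Z \<sigma> r \<longleftrightarrow> proj Z = proj X \<and> place Z = place X \<and> (\<forall>x\<in>r. proj X (\<sigma> x) = x) \<and>
     (\<exists>g\<in>deck_group X. lift Z r = g ` \<sigma> ` r)"

text \<open>The chosen lift differs from the section by a deck transformation, which acts on the
  positions as a motion; the same argument serves areas, volumes and signs.\<close>

lemma sq_length_models:
  assumes "models Z \<sigma> {x, y}" "x \<noteq> y"
  shows "sq_length Z {x, y} = (dist (place X (\<sigma> x)) (place X (\<sigma> y)))\<^sup>2"
proof -
  obtain g where g: "g \<in> deck_group X" "lift Z {x, y} = {g (\<sigma> x), g (\<sigma> y)}" "place Z = place X"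
    "proj X (\<sigma> x) = x" "proj X (\<sigma> y) = y"
    using assms unfolding models_def by auto
  have neq: "g (\<sigma> x) \<noteq> g (\<sigma> y)" using g assms(2) proj_deck by metis
  have d: "dist (place Z (g (\<sigma> x))) (place Z (g (\<sigma> y))) = dist (place X (\<sigma> x)) (place X (\<sigma> y))"
    unfolding g(3) place_deck[OF g(1)] by (rule dist_motion[OF motion_deck[OF g(1)]])
  show ?thesis unfolding sq_length_def g(2)
  proof (rule the_equality)
    show "\<exists>u w. {g (\<sigma> x), g (\<sigma> y)} = {u, w} \<and> u \<noteq> w \<and>
        (dist (place X (\<sigma> x)) (place X (\<sigma> y)))\<^sup>2 = (dist (place Z u) (place Z w))\<^sup>2"
      by (intro exI[of _ "g (\<sigma> x)"] exI[of _ "g (\<sigma> y)"]) (use neq d in simp)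
  next
    fix l
    assume "\<exists>u w. {g (\<sigma> x), g (\<sigma> y)} = {u, w} \<and> u \<noteq> w \<and> l = (dist (place Z u) (place Z w))\<^sup>2"
    then show "l = (dist (place X (\<sigma> x)) (place X (\<sigma> y)))\<^sup>2"
      using d by (auto simp: doubleton_eq_iff dist_commute)
  qed
qed

lemma face_area_models:
  assumes "models Z \<sigma> {x, y, z}" "distinct [x, y, z]"
  shows "face_area Z {x, y, z} = triangle_area (place X (\<sigma> x)) (place X (\<sigma> y)) (place X (\<sigma> z))"
proof -
  obtain g where g: "g \<in> deck_group X" "lift Z {x, y, z} = {g (\<sigma> x), g (\<sigma> y), g (\<sigma> z)}"
    "place Z = place X" "proj X (\<sigma> x) = x" "proj X (\<sigma> y) = y" "proj X (\<sigma> z) = z"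
    using assms unfolding models_def by auto
  let ?a = "g (\<sigma> x)" and ?b = "g (\<sigma> y)" and ?c = "g (\<sigma> z)"
  have "proj X ?a = x" "proj X ?b = y" "proj X ?c = z" using g by simp_all
  then have neq: "distinct [?a, ?b, ?c]" using assms(2) by auto
  have perm: "triangle_area (p u) (p v) (p w) = triangle_area (p ?a) (p ?b) (p ?c)"
    if "{?a, ?b, ?c} = {u, v, w}" "distinct [u, v, w]" for p :: "'u \<Rightarrow> real^4" and u v w
  proof -
    have "u \<in> {?a, ?b, ?c}" "v \<in> {?a, ?b, ?c}" "w \<in> {?a, ?b, ?c}" using that by auto
    then show ?thesis using that(2) triangle_area_swap by auto
  qed
  have area: "triangle_area (place Z ?a) (place Z ?b) (place Z ?c) =
      triangle_area (place X (\<sigma> x)) (place X (\<sigma> y)) (place X (\<sigma> z))"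
    unfolding g(3) place_deck[OF g(1)] by (rule triangle_area_motion[OF motion_deck[OF g(1)]])
  show ?thesis unfolding face_area_def g(2)
  proof (intro the_equality)
    show "\<exists>u v w. {?a, ?b, ?c} = {u, v, w} \<and> distinct [u, v, w] \<and>
        triangle_area (place X (\<sigma> x)) (place X (\<sigma> y)) (place X (\<sigma> z)) =
        triangle_area (place Z u) (place Z v) (place Z w)"
      by (intro exI[of _ ?a] exI[of _ ?b] exI[of _ ?c]) (use neq area in simp)
  next
    fix s
    assume "\<exists>u v w. {?a, ?b, ?c} = {u, v, w} \<and> distinct [u, v, w] \<and>
      s = triangle_area (place Z u) (place Z v) (place Z w)"
    then show "s = triangle_area (place X (\<sigma> x)) (place X (\<sigma> y)) (place X (\<sigma> z))"
      using perm[of _ _ _ "place Z"] area by metis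
  qed
qed

lemma simplex_volume_models:
  assumes "models Z \<sigma> {a, b, c, d, e}" "distinct [a, b, c, d, e]"
    and "orvol (place X (\<sigma> a)) (place X (\<sigma> b)) (place X (\<sigma> c)) (place X (\<sigma> d)) (place X (\<sigma> e)) = m" "m \<noteq> 0"
  shows "simplex_volume Z {a, b, c, d, e} = \<bar>m\<bar> / 24"
proof -
  obtain g where g: "g \<in> deck_group X" "lift Z {a, b, c, d, e} = g ` \<sigma> ` {a, b, c, d, e}"
    "place Z = place X"
    using assms unfolding models_def by auto
  let ?p = "\<lambda>x. place X (g (\<sigma> x))"
  have p: "place Z ` lift Z {a, b, c, d, e} = {?p a, ?p b, ?p c, ?p d, ?p e}"
    unfolding g(2,3) by auto
  have o: "orvol (?p a) (?p b) (?p c) (?p d) (?p e) = m"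
    unfolding place_deck[OF g(1)] using orvol_motion[OF motion_deck[OF g(1)]] assms(3) by simp
  have "distinct [?p a, ?p b, ?p c, ?p d, ?p e]"
    using o assms(4) unfolding orvol_def by auto
  then show ?thesis unfolding simplex_volume_def p using content_orvol o by simp
qed

text \<open>Motions preserve the signed volume, and \<open>orientation_orvol_invariant\<close>
  passes from the ordering picked in the definition to \<open>xs\<close>.\<close>

lemma simplex_sign_models:
  assumes m: "models Z \<sigma> (set xs)" and o: "orientation (simplices Z) (orient Z)"
    and xs: "distinct xs" "length xs = 5" "set xs \<in> simplices Z"
  shows "simplex_sign Z (set xs) = sgn (orient Z xs * orvol_list (place X \<circ> \<sigma>) xs)"
proof -
  define ys where "ys = (SOME ys. distinct ys \<and> set ys = set xs)"
  have ys: "distinct ys \<and> set ys = set xs"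
    unfolding ys_def by (rule someI_ex) (use xs in blast)
  then have len: "length ys = 5" using xs by (metis distinct_card)
  obtain g where g: "g \<in> deck_group X" "lift Z (set xs) = g ` \<sigma> ` set xs" "place Z = place X"
    "proj Z = proj X" and sec: "\<And>x. x \<in> set xs \<Longrightarrow> proj X (\<sigma> x) = x"
    using m unfolding models_def by auto
  have inj: "inj_on (proj X) (g ` \<sigma> ` set xs)"
    using g(1) sec by (intro inj_onI) (auto)
  have inv: "the_inv_into (lift Z (set xs)) (proj Z) (ys ! k) = g (\<sigma> (ys ! k))" if "k < 5" for k
  proof -
    have "ys ! k \<in> set xs" using ys len that by (metis nth_mem)
    then show ?thesis unfolding g(2,4)
      using the_inv_into_f_f[OF inj, of "g (\<sigma> (ys ! k))"] sec g(1) by simp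
  qed
  define q where "q k = place Z (the_inv_into (lift Z (set xs)) (proj Z) (ys ! k))" for k
  have q: "q k = \<rho> g ((place X \<circ> \<sigma>) (ys ! k))" if "k < 5" for k
    unfolding q_def inv[OF that] g(3) place_deck[OF g(1)] by simp
  have "simplex_sign Z (set xs) = orient Z ys * sgn (orvol (q 0) (q 1) (q 2) (q 3) (q 4))"
    unfolding simplex_sign_def Let_def ys_def[symmetric] q_def[symmetric] orvol_def det4_def ..
  also have "orvol (q 0) (q 1) (q 2) (q 3) (q 4) = orvol_list (place X \<circ> \<sigma>) ys"
    unfolding orvol_list_def by (simp add: q orvol_motion[OF motion_deck[OF g(1)]] del: comp_apply)
  also have "orient Z ys * sgn (orvol_list (place X \<circ> \<sigma>) ys) =
      sgn (orient Z ys * orvol_list (place X \<circ> \<sigma>) ys)"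
  proof -
    have "orient Z ys \<in> {1, -1}" using o ys len xs unfolding orientation_def by simp
    then show ?thesis by (auto simp: sgn_mult)
  qed
  also have "orient Z ys * orvol_list (place X \<circ> \<sigma>) ys = orient Z xs * orvol_list (place X \<circ> \<sigma>) xs"
    by (rule orientation_orvol_invariant[OF o xs]) (use ys in auto)
  finally show ?thesis .
qed

end

text \<open>The transpositions \<open>s1\<close> and \<open>s2\<close> generate all orderings of the
  triangle, so the description has one value.\<close>

lemma generated_dS_eq:
  assumes "distinct [x, y, z]"
  shows "generated_dS Z {x, y, z} v =
    4 * triangle_area (midpoint (place Z x) (place Z y) + v {x, y})
          (midpoint (place Z y) (place Z z) + v {y, z}) (midpoint (place Z z) (place Z x) + v {z, x})
    - triangle_area (place Z x) (place Z y) (place Z z)"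
proof -
  define P where "P x y z = 4 * triangle_area (midpoint (place Z x) (place Z y) + v {x, y})
          (midpoint (place Z y) (place Z z) + v {y, z}) (midpoint (place Z z) (place Z x) + v {z, x})
    - triangle_area (place Z x) (place Z y) (place Z z)" for x y z
  have s1: "P b a c = P a b c" for a b c
    unfolding P_def
    using triangle_area_swap(2)[of "midpoint (place Z b) (place Z a) + v {b, a}"
        "midpoint (place Z a) (place Z c) + v {a, c}" "midpoint (place Z c) (place Z b) + v {c, b}"]
      triangle_area_swap(1)[of "place Z b" "place Z a" "place Z c"]
    by (simp add: midpoint_sym insert_commute)
  have s2: "P a c b = P a b c" for a b c
    unfolding P_def
    using triangle_area_swap[of "midpoint (place Z a) (place Z b) + v {a, b}"
        "midpoint (place Z b) (place Z c) + v {b, c}" "midpoint (place Z c) (place Z a) + v {c, a}"]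
      triangle_area_swap(2)[of "midpoint (place Z b) (place Z c) + v {b, c}"
         "midpoint (place Z a) (place Z b) + v {a, b}" "midpoint (place Z c) (place Z a) + v {c, a}"]
      triangle_area_swap(1)[of "midpoint (place Z c) (place Z a) + v {c, a}"
        "midpoint (place Z b) (place Z c) + v {b, c}" "midpoint (place Z a) (place Z b) + v {a, b}"]
      triangle_area_swap(2)[of "place Z a" "place Z b" "place Z c"]
    by (simp add: midpoint_sym insert_commute)
  have "generated_dS Z {x, y, z} v = P x y z"
    unfolding generated_dS_def P_def[symmetric]
  proof (intro the_equality)
    show "\<exists>a b c. {x, y, z} = {a, b, c} \<and> distinct [a, b, c] \<and> P x y z = P a b c"
      using assms by blast
  next
    fix s assume "\<exists>a b c. {x, y, z} = {a, b, c} \<and> distinct [a, b, c] \<and> s = P a b c"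
    then obtain a b c where abc: "{x, y, z} = {a, b, c}" "distinct [a, b, c]" "s = P a b c" by blast
    then have "a \<in> {x, y, z}" "b \<in> {x, y, z}" "c \<in> {x, y, z}" by auto
    then have "P a b c = P x y z"
      using abc(2) s1[of x y z] s1[of x z y] s1[of y z x] s2[of x y z] s2[of y x z] s2[of z x y] by auto
    then show "s = P x y z" using abc(3) by simp
  qed
  then show ?thesis unfolding P_def .
qed

text \<open>\<open>m w - m 0\<close> is the linear part of \<open>m\<close> applied to
  \<open>w\<close>; this is how frames are transported.\<close>

lemma motion_inner:
  assumes "motion m"
  shows "(m a - m b) \<bullet> (m w - m 0) = (a - b) \<bullet> w"
proof -
  obtain R t where R: "orthogonal_matrix R" "m = (\<lambda>x. R *v x + t)"
    using assms unfolding motion_def rotation_matrix_def by blast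
  have "orthogonal_transformation ((*v) R)"
    using R(1) by (simp add: orthogonal_transformation_matrix)
  then show ?thesis
    unfolding R(2) by (simp add: orthogonal_transformation_def flip: matrix_vector_mult_diff_distrib)
qed

lemma deriv_generated_dS_other:
  assumes "distinct [x, y, z]" "a \<noteq> f ` {x, y}" "a \<noteq> f ` {y, z}" "a \<noteq> f ` {z, x}"
  shows "deriv (\<lambda>\<tau>. generated_dS Z {x, y, z} (\<lambda>e. if f ` e = a then \<tau> *\<^sub>R w e else 0)) 0 = 0"
  unfolding generated_dS_eq[OF assms(1)] using assms by (simp add: eq_commute)

context equivariant_complex
begin

text \<open>The frame is carried along by the same motion as the positions, so the section
  \<open>\<sigma>\<close> and the chosen lift give the same inner products.\<close>

lemma d_S_d_v_models:
  assumes m: "models Z \<sigma> {x, y, z}" and dist: "distinct [x, y, z]"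
    and n: "\<And>g. g \<in> deck_group X \<Longrightarrow> n (g ` \<sigma> ` {x, y}) k = \<rho> g (n (\<sigma> ` {x, y}) k) - \<rho> g 0"
    and perp: "(place X (\<sigma> x) - place X (\<sigma> y)) \<bullet> n (\<sigma> ` {x, y}) k = 0"
    and pos: "triangle_area (place X (\<sigma> x)) (place X (\<sigma> y)) (place X (\<sigma> z)) > 0"
  shows "d_S_d_v Z n {x, y, z} ({x, y}, k) =
    (dist (place X (\<sigma> x)) (place X (\<sigma> y)))\<^sup>2 * ((place X (\<sigma> x) - place X (\<sigma> z)) \<bullet> n (\<sigma> ` {x, y}) k)
      / (2 * triangle_area (place X (\<sigma> x)) (place X (\<sigma> y)) (place X (\<sigma> z)))"
proof -
  obtain g where g: "g \<in> deck_group X" "lift Z {x, y, z} = g ` \<sigma> ` {x, y, z}" "place Z = place X"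
    "proj Z = proj X" "\<forall>w\<in>{x, y, z}. proj X (\<sigma> w) = w"
    using m unfolding models_def by blast
  let ?a = "g (\<sigma> x)" and ?b = "g (\<sigma> y)" and ?c = "g (\<sigma> z)"
  have p: "proj X ?a = x" "proj X ?b = y" "proj X ?c = z" using g by simp_all
  then have dist': "distinct [?a, ?b, ?c]" using dist by auto
  have proj: "proj X ` {?a, ?b} = {x, y}" "proj X ` {?b, ?c} \<noteq> {x, y}" "proj X ` {?c, ?a} \<noteq> {x, y}"
    using p dist by (auto simp: doubleton_eq_iff)
  have lift: "lift Z {x, y, z} = {?a, ?b, ?c}" using g(2) by simp
  have pl: "place X (g u) = \<rho> g (place X u)" for u by (rule place_deck[OF g(1)])
  note mot = motion_deck[OF g(1)]
  let ?w = "n {?a, ?b} k"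
  have w: "?w = \<rho> g (n (\<sigma> ` {x, y}) k) - \<rho> g 0"
    using n[OF g(1)] by simp
  have area: "triangle_area (place X ?a) (place X ?b) (place X ?c) =
      triangle_area (place X (\<sigma> x)) (place X (\<sigma> y)) (place X (\<sigma> z))"
    unfolding pl by (rule triangle_area_motion[OF mot])
  have inner: "(place X (g u) - place X (g u')) \<bullet> ?w = (place X u - place X u') \<bullet> n (\<sigma> ` {x, y}) k" for u u'
    unfolding w pl by (rule motion_inner[OF mot])
  have "((\<lambda>\<tau>. 4 * triangle_area (midpoint (place X ?a) (place X ?b) + \<tau> *\<^sub>R ?w)
        (midpoint (place X ?b) (place X ?c)) (midpoint (place X ?c) (place X ?a))
      - triangle_area (place X ?a) (place X ?b) (place X ?c)) has_real_derivative
      (dist (place X ?a) (place X ?b))\<^sup>2 * ((place X ?a - place X ?c) \<bullet> ?w)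
        / (2 * triangle_area (place X ?a) (place X ?b) (place X ?c))) (at 0)"
    by (rule has_real_derivative_triangle_area_midpoints) (use pos perp area inner in simp_all)
  then have "deriv (\<lambda>\<tau>. 4 * triangle_area (midpoint (place X ?a) (place X ?b) + \<tau> *\<^sub>R ?w)
        (midpoint (place X ?b) (place X ?c)) (midpoint (place X ?c) (place X ?a))
      - triangle_area (place X ?a) (place X ?b) (place X ?c)) 0 =
      (dist (place X ?a) (place X ?b))\<^sup>2 * ((place X ?a - place X ?c) \<bullet> ?w)
        / (2 * triangle_area (place X ?a) (place X ?b) (place X ?c))"
    by (rule DERIV_imp_deriv)
  moreover have "d_S_d_v Z n {x, y, z} ({x, y}, k) =
      deriv (\<lambda>\<tau>. 4 * triangle_area (midpoint (place X ?a) (place X ?b) + \<tau> *\<^sub>R ?w)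
        (midpoint (place X ?b) (place X ?c)) (midpoint (place X ?c) (place X ?a))
      - triangle_area (place X ?a) (place X ?b) (place X ?c)) 0"
    unfolding d_S_d_v_def prod.case lift generated_dS_eq[OF dist'] g(3,4)
    using proj by (simp only: if_True if_False add_0_right simp_thms)
  moreover have "dist (place X ?a) (place X ?b) = dist (place X (\<sigma> x)) (place X (\<sigma> y))"
    unfolding pl by (rule dist_motion[OF mot])
  ultimately show ?thesis unfolding area inner by simp
qed

lemma d_S_d_v_models_other:
  assumes m: "models Z \<sigma> {x, y, z}" and dist: "distinct [x, y, z]"
    and a: "a \<noteq> {x, y}" "a \<noteq> {y, z}" "a \<noteq> {x, z}"
  shows "d_S_d_v Z n {x, y, z} (a, k) = 0"
proof -
  obtain g where g: "g \<in> deck_group X" "lift Z {x, y, z} = g ` \<sigma> ` {x, y, z}" "place Z = place X"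
    "proj Z = proj X" "\<forall>w\<in>{x, y, z}. proj X (\<sigma> w) = w"
    using m unfolding models_def by blast
  let ?a = "g (\<sigma> x)" and ?b = "g (\<sigma> y)" and ?c = "g (\<sigma> z)"
  have p: "proj X ?a = x" "proj X ?b = y" "proj X ?c = z" using g by simp_all
  then have dist': "distinct [?a, ?b, ?c]" using dist by auto
  have lift: "lift Z {x, y, z} = {?a, ?b, ?c}" using g(2) by simp
  show ?thesis
    unfolding d_S_d_v_def prod.case lift
    by (rule deriv_generated_dS_other[OF dist']) (use a p g(4) in \<open>simp_all add: insert_commute\<close>)
qed

lemma models_subset:
  assumes "s \<in> simplices X" "\<sigma> ` s \<in> cover X" "\<And>x. x \<in> s \<Longrightarrow> proj X (\<sigma> x) = x"
    and "r \<subseteq> s" "r \<noteq> {}" and Z: "lift Z r = lift X r" "place Z = place X" "proj Z = proj X"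
  shows "models Z \<sigma> r"
proof -
  have r: "r \<in> simplices X" by (rule simplex_subset[OF assms(1,4,5)])
  have sec: "proj X (\<sigma> x) = x" if "x \<in> r" for x using assms(3,4) that by blast
  have "\<sigma> ` r \<in> cover X"
    by (rule cover_subset[OF assms(2) image_mono[OF assms(4)]]) (use assms(5) in simp)
  moreover have "proj X ` \<sigma> ` r = (\<lambda>x. x) ` r"
    unfolding image_image by (rule image_cong) (use sec in auto)
  then have "proj X ` \<sigma> ` r = r" by simp
  ultimately obtain g where "g \<in> deck_group X" "g ` \<sigma> ` r = lift X r"
    using lifts_deck_equivalent[of "\<sigma> ` r" "lift X r"] lift_X[OF r] by auto
  then show ?thesis unfolding models_def using sec Z by auto
qed

text \<open>The section of the covering over a single simplex that is given by its chosen
  lift.\<close>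

definition section_of :: "'v set \<Rightarrow> 'v \<Rightarrow> 'u" where
  "section_of s = the_inv_into (lift X s) (proj X)"

lemma section_of:
  assumes "s \<in> simplices X"
  shows "section_of s ` s = lift X s" "\<And>x. x \<in> s \<Longrightarrow> proj X (section_of s x) = x"
proof -
  have inj: "inj_on (proj X) (lift X s)" and im: "proj X ` lift X s = s"
    using lift_X[OF assms] inj_proj_cover by auto
  show "section_of s ` s = lift X s"
    unfolding section_of_def using the_inv_into_onto[OF inj] im by simp
  show "proj X (section_of s x) = x" if "x \<in> s" for x
    unfolding section_of_def using f_the_inv_into_f[OF inj, of x] im that by simp
qed

end

section \<open>Derivatives of deficit angles\<close>

definition dihedral_deriv :: "('v set \<Rightarrow> real) \<Rightarrow> 'v set \<Rightarrow> 'v set \<Rightarrow> 'v set \<Rightarrow> real" where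
  "dihedral_deriv l s i a = deriv (\<lambda>t. dihedral_of_lengths s i (l(a := t))) (l a)"

definition realizable :: "'v set \<Rightarrow> ('v set \<Rightarrow> real) \<Rightarrow> bool" where
  "realizable s l \<longleftrightarrow>
     (\<exists>q :: 'v \<Rightarrow> real^4. realizes q s l \<and> inj_on q s \<and> \<not> affine_dependent (q ` s))"

lemma simplex_face_labels:
  assumes "card s = 5" "card i = 3" "i \<subseteq> s"
  obtains a b c d e where "distinct [a, b, c, d, e]" "s = {a, b, c, d, e}" "i = {a, b, c}"
proof -
  obtain a b c where i: "i = {a, b, c}" "a \<noteq> b" "a \<noteq> c" "b \<noteq> c"
    using assms(2) unfolding card_3_iff by blast
  have "finite s" using assms(1) by (metis card.infinite zero_neq_numeral)
  then have "card (s - i) = 2" using assms by (simp add: card_Diff_subset finite_subset)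
  then obtain d e where de: "s - i = {d, e}" "d \<noteq> e" unfolding card_2_iff by blast
  then have "s = {a, b, c, d, e}" "d \<notin> i" "e \<notin> i" using assms(3) i by auto
  then show thesis by (intro that[of a b c d e]) (use i de in auto)
qed

lemma dihedral_differentiable:
  assumes "card s = 5" "card i = 3" "i \<subseteq> s" "card a = 2" "realizable s l"
  shows "((\<lambda>t. dihedral_of_lengths s i (l(a := t))) has_real_derivative dihedral_deriv l s i a) (at (l a))"
proof -
  obtain q :: "'a \<Rightarrow> real^4" where q: "realizes q s l" "inj_on q s" "\<not> affine_dependent (q ` s)"
    using assms(5) unfolding realizable_def by blast
  obtain v w x y z where lab: "distinct [v, w, x, y, z]" "s = {v, w, x, y, z}" "i = {v, w, x}"
    using simplex_face_labels assms by metis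
  obtain u u' where a: "a = {u, u'}" "u \<noteq> u'" using assms(4) unfolding card_2_iff by blast
  have "((\<lambda>t. dihedral_of_lengths s i (l(a := t))) has_real_derivative
      dihedral_slope q v w x y z u u') (at (l a))"
    unfolding a(1) by (rule has_real_derivative_dihedral[OF lab q a(2)])
  then show ?thesis unfolding dihedral_deriv_def using DERIV_imp_deriv by metis
qed

text \<open>To pass \<open>deriv\<close> through the sum every dihedral angle is shown to be
  differentiable, which is why the 4-simplices at \<open>i\<close> are assumed realizable.\<close>

lemma d_omega_d_L_eq:
  assumes i: "card i = 3" and a: "card a = 2"
    and real: "\<And>s. s \<in> four_simplices Z \<Longrightarrow> i \<subseteq> s \<Longrightarrow> realizable s (sq_length Z)"
    and fin: "finite (four_simplices Z)"
  shows "d_omega_d_L Z i a =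
    - (\<Sum>s | s \<in> four_simplices Z \<and> i \<subseteq> s. simplex_sign Z s * dihedral_deriv (sq_length Z) s i a)"
proof -
  let ?l = "sq_length Z"
  have "((\<lambda>x. deficit Z i (?l(a := x))) has_real_derivative
      - (\<Sum>s | s \<in> four_simplices Z \<and> i \<subseteq> s. simplex_sign Z s * dihedral_deriv ?l s i a)) (at (?l a))"
    unfolding deficit_def
  proof (intro DERIV_minus DERIV_sum)
    fix s assume "s \<in> {s \<in> four_simplices Z. i \<subseteq> s}"
    then have "((\<lambda>x. dihedral_of_lengths s i (?l(a := x))) has_real_derivative dihedral_deriv ?l s i a) (at (?l a))"
      using real i a by (intro dihedral_differentiable) (auto simp: four_simplices_def)
    then show "((\<lambda>x. simplex_sign Z s * dihedral_of_lengths s i (?l(a := x))) has_real_derivative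
        simplex_sign Z s * dihedral_deriv ?l s i a) (at (?l a))"
      by (rule DERIV_cmult)
  qed
  then show ?thesis unfolding d_omega_d_L_def by (rule DERIV_imp_deriv)
qed

lemma dihedral_deriv_cong:
  assumes "\<And>x y. x \<in> s \<Longrightarrow> y \<in> s \<Longrightarrow> x \<noteq> y \<Longrightarrow> l {x, y} = l' {x, y}" and "l a = l' a"
  shows "dihedral_deriv l s i a = dihedral_deriv l' s i a"
proof -
  have "dihedral_of_lengths s i (l(a := t)) = dihedral_of_lengths s i (l'(a := t))" for t
    by (rule dihedral_of_lengths_cong) (use assms in simp)
  then show ?thesis unfolding dihedral_deriv_def assms(2) by simp
qed

lemma dihedral_deriv_other:
  assumes "\<not> a \<subseteq> s"
  shows "dihedral_deriv l s i a = 0"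
proof -
  have "dihedral_of_lengths s i (l(a := t)) = dihedral_of_lengths s i l" for t
    by (rule dihedral_of_lengths_cong) (use assms in auto)
  then show ?thesis unfolding dihedral_deriv_def by simp
qed

section \<open>The move\<close>

locale placed_move = equivariant_complex X \<rho>
  for X :: "('v::finite, 'u) placed_complex" and \<rho> :: "('u \<Rightarrow> 'u) \<Rightarrow> real^4 \<Rightarrow> real^4" +
  fixes Y :: "('v, 'u) placed_complex" and A B C D E F :: 'v and n :: "'u set \<Rightarrow> nat \<Rightarrow> real^4"
  assumes orient_X: "orientation (simplices X) (orient X)"
    and move: "move_2_4 X A B C D E F Y"
    and nondeg_X: "nondegenerate X" and nondeg_Y: "nondegenerate Y"
    and frame: "edge_frame Y \<rho> n"
begin

definition R :: "'v set" where "R = {C, D, E, F}"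

text \<open>The 4-simplices of the cluster are indexed by the vertex \<open>w\<close> that they
  omit: \<open>six - {w}\<close> is removed by the move for \<open>w\<close> in
  \<open>{A, B}\<close> and added for \<open>w\<close> in \<open>R\<close>.\<close>

definition six :: "'v set" where "six = {A, B, C, D, E, F}"

lemma distinct_six: "distinct [A, B, C, D, E, F]"
  using move unfolding move_2_4_def Let_def by (elim conjE) assumption

lemma neq: "A \<noteq> B" "A \<noteq> C" "A \<noteq> D" "A \<noteq> E" "A \<noteq> F" "B \<noteq> C" "B \<noteq> D" "B \<noteq> E" "B \<noteq> F" "C \<noteq> D"
  "C \<noteq> E" "C \<noteq> F" "D \<noteq> E" "D \<noteq> F" "E \<noteq> F" "B \<noteq> A" "C \<noteq> A" "D \<noteq> A" "E \<noteq> A" "F \<noteq> A" "C \<noteq> B"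
  "D \<noteq> B" "E \<noteq> B" "F \<noteq> B" "D \<noteq> C" "E \<noteq> C" "F \<noteq> C" "E \<noteq> D" "F \<noteq> D" "F \<noteq> E"
  using distinct_six by auto

lemma AR_simplex: "insert A R \<in> simplices X"
  using move unfolding move_2_4_def Let_def R_def by (elim conjE) assumption

lemma BR_simplex: "insert B R \<in> simplices X"
proof -
  have "{B, C, D, F, E} \<in> simplices X"
    using move unfolding move_2_4_def Let_def by (elim conjE) assumption
  then show ?thesis unfolding R_def by (simp add: insert_commute)
qed

lemma AB_not_simplex: "{A, B} \<notin> simplices X"
  using move unfolding move_2_4_def Let_def by (elim conjE) assumption

lemma removed_iff: "r \<in> removed_simplices A B R \<longleftrightarrow> r = insert A R \<or> r = insert B R \<or> r = R"
  unfolding removed_simplices_def by simp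

lemma six_R: "six = {A, B} \<union> R" and A_R: "A \<notin> R" "B \<notin> R"
  unfolding six_def R_def using neq by auto

lemma added_iff: "r \<in> added_simplices A B R \<longleftrightarrow> {A, B} \<subseteq> r \<and> r \<subset> six"
proof
  assume "r \<in> added_simplices A B R"
  then obtain T where "r = {A, B} \<union> T" "T \<subset> R" unfolding added_simplices_def by blast
  then show "{A, B} \<subseteq> r \<and> r \<subset> six" unfolding six_R using A_R by auto
next
  assume r: "{A, B} \<subseteq> r \<and> r \<subset> six"
  then have "r = {A, B} \<union> (r - {A, B})" "r - {A, B} \<subset> R" unfolding six_R by auto
  then show "r \<in> added_simplices A B R" unfolding added_simplices_def by blast
qed

lemma simplices_Y: "simplices Y = (simplices X - removed_simplices A B R) \<union> added_simplices A B R"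
  using move unfolding move_2_4_def Let_def R_def by (elim conjE) assumption

lemma cover_Y: "cover Y = {t \<in> cover X. proj X ` t \<notin> removed_simplices A B R} \<union>
        {t. \<exists>tA\<in>cover X. \<exists>tB\<in>cover X.
              proj X ` tA = insert A R \<and> proj X ` tB = insert B R \<and> proj X ` (tA \<inter> tB) = R \<and>
              t \<subseteq> tA \<union> tB \<and> proj X ` t \<in> added_simplices A B R}"
  using move unfolding move_2_4_def Let_def R_def by (elim conjE) assumption

lemma proj_Y: "proj Y = proj X"
  using move unfolding move_2_4_def Let_def by (elim conjE) assumption

lemma place_Y: "place Y = place X"
  using move unfolding move_2_4_def Let_def by (elim conjE) assumption

lemma orient_Y: "orientation (simplices Y) (orient Y)"
  using move unfolding move_2_4_def Let_def by (elim conjE) assumption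

lemma orient_common: "distinct xs \<Longrightarrow> length xs = 5 \<Longrightarrow> set xs \<in> simplices X \<inter> simplices Y \<Longrightarrow>
    orient Y xs = orient X xs"
proof -
  have "\<forall>xs. distinct xs \<and> length xs = 5 \<and> set xs \<in> simplices X \<inter> simplices Y \<longrightarrow>
      orient Y xs = orient X xs"
    using move unfolding move_2_4_def Let_def by (elim conjE) assumption
  then show "distinct xs \<Longrightarrow> length xs = 5 \<Longrightarrow> set xs \<in> simplices X \<inter> simplices Y \<Longrightarrow>
    orient Y xs = orient X xs" by blast
qed

lemma orient_replace: "length ts = 4 \<Longrightarrow> distinct (x # ts) \<Longrightarrow> distinct (y # ts) \<Longrightarrow>
    set (x # ts) \<in> simplices X - simplices Y \<Longrightarrow> set (y # ts) \<in> simplices Y - simplices X \<Longrightarrow>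
    orient Y (y # ts) = orient X (x # ts)"
proof -
  have "\<forall>x y ts. length ts = 4 \<and> distinct (x # ts) \<and> distinct (y # ts) \<and>
         set (x # ts) \<in> simplices X - simplices Y \<and>
         set (y # ts) \<in> simplices Y - simplices X \<longrightarrow> orient Y (y # ts) = orient X (x # ts)"
    using move unfolding move_2_4_def Let_def by (elim conjE) assumption
  then show "length ts = 4 \<Longrightarrow> distinct (x # ts) \<Longrightarrow> distinct (y # ts) \<Longrightarrow>
    set (x # ts) \<in> simplices X - simplices Y \<Longrightarrow> set (y # ts) \<in> simplices Y - simplices X \<Longrightarrow>
    orient Y (y # ts) = orient X (x # ts)" by blast
qed

section \<open>Edges, faces and 4-simplices after the move\<close>

lemma AB_subset: "{A, B} \<subseteq> r \<Longrightarrow> r \<notin> simplices X"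
  using simplex_subset[of r "{A, B}"] AB_not_simplex by blast

lemma card_six: "card six = 6" "finite six"
  unfolding six_def using neq by simp_all

lemma card_R: "card R = 4" "finite R"
  unfolding R_def using neq by simp_all

lemma minus_AB: "six - {B} = insert A R" "six - {A} = insert B R"
  unfolding six_R using A_R neq by auto

text \<open>Edges and faces are too small to be removed, so the move only adds to them.\<close>

lemma removed_card: "r \<in> removed_simplices A B R \<Longrightarrow> card r = 5 \<or> card r = 4"
  unfolding removed_iff using card_R A_R by auto

lemma small_simplices_Y:
  assumes "card r < 4"
  shows "r \<in> simplices Y \<longleftrightarrow> r \<in> simplices X \<or> {A, B} \<subseteq> r \<and> r \<subset> six"
proof -
  have "r \<notin> removed_simplices A B R" using removed_card[of r] assms by linarith
  then show ?thesis unfolding simplices_Y Un_iff Diff_iff added_iff by blast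
qed

lemma edges_Y: "edges Y = insert {A, B} (edges X)" "{A, B} \<notin> edges X"
proof -
  have "r = {A, B}" if "{A, B} \<subseteq> r" "card r = 2" for r
    using that neq(1) by (auto simp: card_2_iff doubleton_eq_iff)
  moreover have "{A, B} \<subset> six" unfolding six_R R_def using neq by auto
  moreover have "card {A, B} = 2" using neq(1) by simp
  ultimately have "r \<in> edges Y \<longleftrightarrow> r = {A, B} \<or> r \<in> edges X" for r
    using small_simplices_Y[of r] unfolding edges_def mem_Collect_eq by fastforce
  then show "edges Y = insert {A, B} (edges X)" by blast
  show "{A, B} \<notin> edges X" unfolding edges_def using AB_not_simplex by simp
qed

lemma faces_Y: "faces Y = faces X \<union> set [{A, B, C}, {A, B, D}, {A, B, E}, {A, B, F}]"
  "faces X \<inter> set [{A, B, C}, {A, B, D}, {A, B, E}, {A, B, F}] = {}"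
  "distinct [{A, B, C}, {A, B, D}, {A, B, E}, {A, B, F}]"
proof -
  have new: "r \<in> set [{A, B, C}, {A, B, D}, {A, B, E}, {A, B, F}]"
    if "{A, B} \<subseteq> r" "r \<subset> six" "card r = 3" for r
  proof -
    have "finite r" using that by (metis card.infinite zero_neq_numeral)
    then have "card (r - {A, B}) = 1" using that neq by (simp add: card_Diff_subset)
    then obtain w where w: "r - {A, B} = {w}" by (metis card_1_singletonE)
    then have "r = {A, B, w}" "w \<in> R" using that unfolding six_R by auto
    then show ?thesis unfolding R_def by auto
  qed
  have old: "{A, B, w} \<subset> six \<and> card {A, B, w} = 3" if "w \<in> R" for w
  proof -
    have "w \<noteq> A" "w \<noteq> B" using that A_R by auto
    then have "card {A, B, w} = 3" using neq(1) by simp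
    moreover have "{A, B, w} \<subseteq> six" using that unfolding six_R by auto
    ultimately show ?thesis using card_six by auto
  qed
  have "r \<in> faces Y \<longleftrightarrow> r \<in> faces X \<union> set [{A, B, C}, {A, B, D}, {A, B, E}, {A, B, F}]" for r
  proof -
    have "r \<in> faces Y \<longleftrightarrow> r \<in> faces X \<or> ({A, B} \<subseteq> r \<and> r \<subset> six \<and> card r = 3)"
      unfolding faces_def mem_Collect_eq using small_simplices_Y[of r] by fastforce
    also have "{A, B} \<subseteq> r \<and> r \<subset> six \<and> card r = 3 \<longleftrightarrow>
        r \<in> set [{A, B, C}, {A, B, D}, {A, B, E}, {A, B, F}]"
      using new[of r] old[of C] old[of D] old[of E] old[of F] unfolding R_def by auto
    finally show ?thesis by (simp only: Un_iff)
  qed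
  then show "faces Y = faces X \<union> set [{A, B, C}, {A, B, D}, {A, B, E}, {A, B, F}]" by blast
  show "faces X \<inter> set [{A, B, C}, {A, B, D}, {A, B, E}, {A, B, F}] = {}"
    unfolding faces_def using AB_subset by auto
  show "distinct [{A, B, C}, {A, B, D}, {A, B, E}, {A, B, F}]"
    using neq by (auto simp: set_eq_iff)
qed

lemma six_faces: "r \<in> faces Y" if "r \<subseteq> six" "card r = 3"
proof (cases "{A, B} \<subseteq> r")
  case True
  moreover have "r \<noteq> six" using that card_six by auto
  ultimately show ?thesis
    using that small_simplices_Y[of r] unfolding faces_def by auto
next
  case False
  then have "r \<subseteq> insert A R \<or> r \<subseteq> insert B R" using that unfolding six_R by auto
  moreover have "r \<noteq> {}" using that by auto
  ultimately have "r \<in> simplices X" using simplex_subset AR_simplex BR_simplex by metis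
  then show ?thesis using that small_simplices_Y[of r] unfolding faces_def by simp
qed

lemma six_edges: "r \<in> edges Y" if "r \<subseteq> six" "card r = 2"
proof (cases "{A, B} \<subseteq> r")
  case True
  moreover have "r \<noteq> six" using that card_six by auto
  ultimately show ?thesis
    using that small_simplices_Y[of r] unfolding edges_def by auto
next
  case False
  then have "r \<subseteq> insert A R \<or> r \<subseteq> insert B R" using that unfolding six_R by auto
  moreover have "r \<noteq> {}" using that by auto
  ultimately have "r \<in> simplices X" using simplex_subset AR_simplex BR_simplex by metis
  then show ?thesis using that small_simplices_Y[of r] unfolding edges_def by simp
qed

lemma four_simplices_X: "four_simplices X = (four_simplices X \<inter> four_simplices Y) \<union> (\<lambda>w. six - {w}) ` {A, B}"
  and four_simplices_Y: "four_simplices Y = (four_simplices X \<inter> four_simplices Y) \<union> (\<lambda>w. six - {w}) ` R"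
  and four_simplices_disjoint: "(\<lambda>w. six - {w}) ` {A, B} \<inter> four_simplices Y = {}"
    "(\<lambda>w. six - {w}) ` R \<inter> four_simplices X = {}"
proof -
  have c5: "card (six - {w}) = 5" if "w \<in> six" for w
    using that card_six by (simp add: card_Diff_singleton)
  have new: "r \<in> (\<lambda>w. six - {w}) ` R" if "{A, B} \<subseteq> r" "r \<subset> six" "card r = 5" for r
  proof -
    have "card (six - r) = 1" using that card_six by (simp add: card_Diff_subset finite_subset psubset_imp_subset)
    then obtain w where w: "six - r = {w}" by (metis card_1_singletonE)
    then have "r = six - {w}" "w \<in> R" using that unfolding six_R by auto
    then show ?thesis by blast
  qed
  have old: "{A, B} \<subseteq> six - {w}" "six - {w} \<subset> six" if "w \<in> R" for w
    using that A_R unfolding six_R by auto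
  have R6: "w \<in> six" if "w \<in> R \<or> w = A \<or> w = B" for w using that unfolding six_R by auto
  have rem: "six - {w} \<in> removed_simplices A B R" "six - {w} \<in> simplices X" if "w \<in> {A, B}" for w
  proof -
    have "w = A \<or> w = B" using that by simp
    then have "six - {w} = insert A R \<or> six - {w} = insert B R" using minus_AB by metis
    then show "six - {w} \<in> removed_simplices A B R" "six - {w} \<in> simplices X"
      unfolding removed_iff using AR_simplex BR_simplex by metis+
  qed
  have ns: "six - {w} \<notin> simplices Y" if "w \<in> {A, B}" for w
    using rem[OF that] that unfolding simplices_Y Un_iff Diff_iff added_iff by blast
  show "(\<lambda>w. six - {w}) ` {A, B} \<inter> four_simplices Y = {}"
    using ns unfolding four_simplices_def by auto
  show "(\<lambda>w. six - {w}) ` R \<inter> four_simplices X = {}"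
    using AB_subset old unfolding four_simplices_def by auto
  show "four_simplices X = (four_simplices X \<inter> four_simplices Y) \<union> (\<lambda>w. six - {w}) ` {A, B}"
  proof -
    have "r \<in> (\<lambda>w. six - {w}) ` {A, B}" if "r \<in> four_simplices X" "r \<notin> four_simplices Y" for r
    proof -
      have "r \<in> removed_simplices A B R" "card r = 5"
        using that unfolding four_simplices_def simplices_Y by blast+
      then have "r = insert A R \<or> r = insert B R" using card_R unfolding removed_iff by auto
      then show ?thesis unfolding minus_AB[symmetric] by blast
    qed
    moreover have "six - {w} \<in> four_simplices X" if "w \<in> {A, B}" for w
      using rem[OF that] c5[OF R6] that unfolding four_simplices_def by blast
    ultimately show ?thesis by blast
  qed
  show "four_simplices Y = (four_simplices X \<inter> four_simplices Y) \<union> (\<lambda>w. six - {w}) ` R"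
  proof -
    have "r \<in> (\<lambda>w. six - {w}) ` R" if "r \<in> four_simplices Y" "r \<notin> four_simplices X" for r
    proof -
      have "r \<in> added_simplices A B R" "card r = 5"
        using that unfolding four_simplices_def simplices_Y by blast+
      then show ?thesis using new[of r] unfolding added_iff by blast
    qed
    moreover have "six - {w} \<in> four_simplices Y" if "w \<in> R" for w
    proof -
      have "six - {w} \<in> added_simplices A B R" using old[OF that] unfolding added_iff by blast
      then show ?thesis using c5[OF R6] that unfolding four_simplices_def simplices_Y by blast
    qed
    ultimately show ?thesis by blast
  qed
qed

section \<open>Deck transformations and lifts of the cluster\<close>

lemma deck_inverse:
  assumes g: "g \<in> deck_group X"
  shows "inv_into UNIV g \<in> deck_group X"
proof -
  have b: "bij g" using g unfolding deck_group_def by blast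
  have "proj X (inv_into UNIV g u) = proj X u" for u
    using proj_deck[OF g, of "inv_into UNIV g u"] surj_f_inv_f[OF bij_is_surj[OF b], of u] by simp
  moreover have "inv_into UNIV g ` t \<in> cover X \<longleftrightarrow> t \<in> cover X" for t
    using deck_image_cover[OF g, of "inv_into UNIV g ` t"] image_f_inv_f[OF bij_is_surj[OF b], of t] by simp
  ultimately show ?thesis
    unfolding deck_group_def using bij_imp_bij_inv[OF b] by (simp add: fun_eq_iff)
qed

lemma deck_image_cover_Y:
  assumes g: "g \<in> deck_group X" and t: "t \<in> cover Y"
  shows "g ` t \<in> cover Y"
proof -
  have proj: "proj X ` g ` t = proj X ` t" for t
    using proj_deck[OF g] by (simp add: image_image)
  have inj: "inj g" using g unfolding deck_group_def bij_def by blast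
  show ?thesis
  proof (cases "t \<in> cover X \<and> proj X ` t \<notin> removed_simplices A B R")
    case True
    then have "g ` t \<in> cover X \<and> proj X ` g ` t \<notin> removed_simplices A B R"
      using deck_image_cover[OF g] unfolding proj by blast
    then show ?thesis unfolding cover_Y by blast
  next
    case False
    then obtain tA tB where *: "tA \<in> cover X" "tB \<in> cover X" "proj X ` tA = insert A R"
      "proj X ` tB = insert B R" "proj X ` (tA \<inter> tB) = R" "t \<subseteq> tA \<union> tB"
      "proj X ` t \<in> added_simplices A B R"
      using t unfolding cover_Y by blast
    have "g ` tA \<in> cover X" "g ` tB \<in> cover X" using * deck_image_cover[OF g] by blast+
    moreover have "proj X ` (g ` tA \<inter> g ` tB) = R"
      using * proj[of "tA \<inter> tB"] inj by (simp add: image_Int)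
    moreover have "g ` t \<subseteq> g ` tA \<union> g ` tB" using *(6) by blast
    ultimately show ?thesis
      unfolding cover_Y using * proj[of tA] proj[of tB] proj[of t]
      by (intro UnI2 CollectI bexI[of _ "g ` tA"] bexI[of _ "g ` tB"]) simp_all
  qed
qed

text \<open>\<open>edge_frame\<close> for \<open>Y\<close> speaks of the deck group of
  \<open>Y\<close>, while the placement is equivariant under that of \<open>X\<close>; this
  inclusion connects them.\<close>

lemma deck_X_subset_Y:
  assumes g: "g \<in> deck_group X"
  shows "g \<in> deck_group Y"
proof -
  have b: "bij g" using g unfolding deck_group_def by blast
  have "t \<in> cover Y" if "g ` t \<in> cover Y" for t
    using deck_image_cover_Y[OF deck_inverse[OF g] that]
    by (simp add: image_inv_f_f[OF bij_is_inj[OF b]])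
  then have "\<forall>t. g ` t \<in> cover Y \<longleftrightarrow> t \<in> cover Y"
    using deck_image_cover_Y[OF g] by blast
  moreover have "proj X \<circ> g = proj X" by (rule ext) (simp add: proj_deck[OF g])
  ultimately show ?thesis using b unfolding deck_group_def proj_Y by blast
qed

text \<open>Lift both removed 4-simplices through one preimage \<open>u\<close> of \<open>C\<close>.
  Their parts over \<open>R\<close> are lifts of \<open>R\<close> through \<open>u\<close> and
  coincide, so the two local sections agree there and glue.\<close>

lemma section_exists:
  "\<exists>\<sigma>. (\<forall>x\<in>six. proj X (\<sigma> x) = x) \<and> \<sigma> ` insert A R \<in> cover X \<and> \<sigma> ` insert B R \<in> cover X"
proof -
  obtain u where u: "proj X u = C" using surj_proj by blast
  have "C \<in> insert A R" "C \<in> insert B R" unfolding R_def by auto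
  then obtain tA tB where tA: "tA \<in> cover X" "u \<in> tA" "proj X ` tA = insert A R"
    and tB: "tB \<in> cover X" "u \<in> tB" "proj X ` tB = insert B R"
    using cover_unique[OF AR_simplex, of u] cover_unique[OF BR_simplex, of u] u by metis
  define f where "f = the_inv_into tA (proj X)"
  define h where "h = the_inv_into tB (proj X)"
  note iA = inj_proj_cover[OF tA(1)] and iB = inj_proj_cover[OF tB(1)]
  have f: "proj X (f x) = x" "f x \<in> tA" if "x \<in> insert A R" for x
    unfolding f_def using f_the_inv_into_f[OF iA] the_inv_into_into[OF iA _ order_refl] tA(3) that by auto
  have h: "proj X (h x) = x" "h x \<in> tB" if "x \<in> insert B R" for x
    unfolding h_def using f_the_inv_into_f[OF iB] the_inv_into_into[OF iB _ order_refl] tB(3) that by auto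
  have fim: "f ` insert A R = tA" unfolding f_def using the_inv_into_onto[OF iA] tA(3) by simp
  have him: "h ` insert B R = tB" unfolding h_def using the_inv_into_onto[OF iB] tB(3) by simp
  have fC: "f C = u" unfolding f_def using the_inv_into_f_f[OF iA tA(2)] u by simp
  have hC: "h C = u" unfolding h_def using the_inv_into_f_f[OF iB tB(2)] u by simp
  have "f ` R \<in> cover X"
    by (rule cover_subset[OF tA(1)]) (use fim in \<open>auto simp: R_def\<close>)
  moreover have hR: "h ` R \<in> cover X"
    by (rule cover_subset[OF tB(1)]) (use him in \<open>auto simp: R_def\<close>)
  moreover have fR: "proj X ` f ` R = (\<lambda>x. x) ` R"
    unfolding image_image by (rule image_cong) (use f in auto)
  moreover have "proj X ` h ` R = (\<lambda>x. x) ` R"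
    unfolding image_image by (rule image_cong) (use h in auto)
  moreover have "u \<in> f ` R" "u \<in> h ` R"
    unfolding fC[symmetric] using fC hC by (auto simp: R_def)
  ultimately have eq: "f ` R = h ` R" by (intro cover_eq) simp_all
  have fh: "f x = h x" if "x \<in> R" for x
  proof -
    have "f x \<in> h ` R" using eq that by blast
    then obtain y where y: "y \<in> R" "f x = h y" by blast
    then have "x = y" using f[of x] h[of y] that by auto
    then show ?thesis using y by simp
  qed
  define \<sigma> where "\<sigma> x = (if x = B then h x else f x)" for x
  have "\<sigma> ` insert A R = f ` insert A R"
    by (rule image_cong) (use A_R neq in \<open>auto simp: \<sigma>_def\<close>)
  moreover have "\<sigma> ` insert B R = h ` insert B R"
    by (rule image_cong) (use fh in \<open>auto simp: \<sigma>_def\<close>)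
  moreover have "proj X (\<sigma> x) = x" if "x \<in> six" for x
    using that f h unfolding \<sigma>_def six_R by auto
  ultimately show ?thesis using fim him tA(1) tB(1) by metis
qed

definition \<sigma> :: "'v \<Rightarrow> 'u" where
  "\<sigma> = (SOME \<sigma>. (\<forall>x\<in>six. proj X (\<sigma> x) = x) \<and> \<sigma> ` insert A R \<in> cover X \<and> \<sigma> ` insert B R \<in> cover X)"

lemma \<sigma>: "x \<in> six \<Longrightarrow> proj X (\<sigma> x) = x" "\<sigma> ` insert A R \<in> cover X" "\<sigma> ` insert B R \<in> cover X"
  using someI_ex[OF section_exists] unfolding \<sigma>_def[symmetric] by blast+

lemma proj_\<sigma>_image: "r \<subseteq> six \<Longrightarrow> proj X ` \<sigma> ` r = r"
proof -
  assume r: "r \<subseteq> six"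
  have "proj X ` \<sigma> ` r = (\<lambda>x. x) ` r"
    unfolding image_image by (rule image_cong) (use r \<sigma>(1) in auto)
  then show ?thesis by simp
qed

lemma lift_Y_old:
  assumes "r \<in> simplices X" "r \<notin> removed_simplices A B R"
  shows "lift Y r = lift X r"
proof -
  have "r \<notin> added_simplices A B R" using assms AB_subset unfolding added_iff by blast
  then have "(t \<in> cover Y \<and> proj Y ` t = r) = (t \<in> cover X \<and> proj X ` t = r)" for t
    unfolding cover_Y proj_Y using assms(2) by blast
  then show ?thesis unfolding lift_def by simp
qed

text \<open>A new simplex of the cover sits in the union of two adjacent lifts. A deck
  transformation that matches the vertex over \<open>C\<close> carries the image of
  \<open>\<sigma>\<close> on \<open>six\<close> onto this union, and the projection singles out the
  simplex.\<close>

lemma new_lift: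
  assumes "r \<in> added_simplices A B R" "t \<in> cover Y" "proj X ` t = r"
  shows "\<exists>g\<in>deck_group X. t = g ` \<sigma> ` r"
proof -
  have r: "{A, B} \<subseteq> r" "r \<subseteq> six" using assms(1) unfolding added_iff by auto
  then have "t \<notin> cover X" using assms(3) AB_subset proj_cover by blast
  then obtain tA tB where t: "tA \<in> cover X" "tB \<in> cover X" "proj X ` tA = insert A R"
    "proj X ` tB = insert B R" "proj X ` (tA \<inter> tB) = R" "t \<subseteq> tA \<union> tB"
    using assms(2) unfolding cover_Y by blast
  have "C \<in> proj X ` (tA \<inter> tB)" unfolding t(5) R_def by simp
  then obtain u where u: "u \<in> tA" "u \<in> tB" "proj X u = C" by blast
  have C: "C \<in> R" "C \<in> six" unfolding R_def six_def by auto
  obtain g where g: "g \<in> deck_group X" "g (\<sigma> C) = u"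
    using deck_transitive[of "\<sigma> C" u] u \<sigma>(1)[OF C(2)] by auto
  have sub: "insert A R \<subseteq> six" "insert B R \<subseteq> six" unfolding six_R by auto
  have gA: "g ` \<sigma> ` insert A R = tA"
    by (rule deck_image_eq[OF g(1) \<sigma>(2) t(1), of "\<sigma> C"])
      (use t(3) proj_\<sigma>_image[OF sub(1)] g(2) u C in auto)
  have gB: "g ` \<sigma> ` insert B R = tB"
    by (rule deck_image_eq[OF g(1) \<sigma>(3) t(2), of "\<sigma> C"])
      (use t(4) proj_\<sigma>_image[OF sub(2)] g(2) u C in auto)
  have un: "tA \<union> tB = g ` \<sigma> ` six"
    unfolding gA[symmetric] gB[symmetric] six_R by auto
  have pg: "proj X (g (\<sigma> x)) = x" if "x \<in> six" for x
    using \<sigma>(1)[OF that] proj_deck[OF g(1)] by simp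
  have "t = g ` \<sigma> ` r"
  proof
    show "t \<subseteq> g ` \<sigma> ` r"
    proof
      fix w assume w: "w \<in> t"
      then obtain x where x: "x \<in> six" "w = g (\<sigma> x)" using t(6) un by auto
      then have "x \<in> r" using pg[OF x(1)] w assms(3) by (metis imageI)
      then show "w \<in> g ` \<sigma> ` r" using x by blast
    qed
    show "g ` \<sigma> ` r \<subseteq> t"
    proof
      fix w assume "w \<in> g ` \<sigma> ` r"
      then obtain x where x: "x \<in> r" "w = g (\<sigma> x)" by blast
      then obtain w' where w': "w' \<in> t" "proj X w' = x" using assms(3) by blast
      then obtain x' where x': "x' \<in> six" "w' = g (\<sigma> x')" using t(6) un by auto
      then have "x' = x" using pg[OF x'(1)] w' by simp
      then show "w \<in> t" using w' x x' by simp
    qed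
  qed
  then show ?thesis using g by blast
qed

lemma \<sigma>_cover_Y:
  assumes "r \<in> simplices Y" "r \<subseteq> six" "r \<noteq> {}"
  shows "\<sigma> ` r \<in> cover Y"
proof (cases "{A, B} \<subseteq> r")
  case True
  then have "r \<in> added_simplices A B R"
    using assms(1) AB_subset unfolding simplices_Y by blast
  note added = this
  moreover have "proj X ` (\<sigma> ` insert A R \<inter> \<sigma> ` insert B R) = R"
  proof -
    have "inj_on \<sigma> six" by (rule inj_on_inverseI[of _ "proj X"]) (rule \<sigma>(1))
    then have "\<sigma> ` insert A R \<inter> \<sigma> ` insert B R = \<sigma> ` (insert A R \<inter> insert B R)"
      by (rule inj_on_image_Int[symmetric]) (auto simp: six_R)
    also have "insert A R \<inter> insert B R = R" using A_R neq by auto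
    finally show ?thesis using proj_\<sigma>_image[of R] unfolding six_R by auto
  qed
  moreover have "\<sigma> ` r \<subseteq> \<sigma> ` insert A R \<union> \<sigma> ` insert B R"
    using assms(2) unfolding six_R by blast
  moreover have "proj X ` \<sigma> ` insert A R = insert A R" "proj X ` \<sigma> ` insert B R = insert B R"
    by (rule proj_\<sigma>_image, simp add: six_R, blast)+
  moreover have "proj X ` \<sigma> ` r \<in> added_simplices A B R"
    unfolding proj_\<sigma>_image[OF assms(2)] by (rule added)
  ultimately show ?thesis unfolding cover_Y using \<sigma>(2,3)
    by (intro UnI2 CollectI bexI[of _ "\<sigma> ` insert A R"] bexI[of _ "\<sigma> ` insert B R"] conjI)
next
  case False
  then have "r \<subseteq> insert A R \<or> r \<subseteq> insert B R" using assms(2) unfolding six_R by auto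
  then have "\<sigma> ` r \<in> cover X"
    using cover_subset[OF \<sigma>(2), of "\<sigma> ` r"] cover_subset[OF \<sigma>(3), of "\<sigma> ` r"] assms(3) by auto
  moreover have "r \<notin> removed_simplices A B R"
    using assms(1) False unfolding simplices_Y Un_iff Diff_iff added_iff by blast
  ultimately show ?thesis unfolding cover_Y using proj_\<sigma>_image[OF assms(2)] by simp
qed

text \<open>With both \<open>A\<close> and \<open>B\<close> in \<open>r\<close>,
  \<open>new_lift\<close> applies; otherwise \<open>r\<close> is an old simplex and its lift is the
  one in \<open>X\<close>.\<close>

lemma models_Y:
  assumes "r \<in> simplices Y" "r \<subseteq> six" "r \<noteq> {}"
  shows "models Y \<sigma> r"
proof (cases "{A, B} \<subseteq> r")
  case True
  then have r: "r \<in> added_simplices A B R"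
    using assms(1) AB_subset unfolding simplices_Y by blast
  have "\<exists>t. t \<in> cover Y \<and> proj Y ` t = r"
    using \<sigma>_cover_Y[OF assms] proj_\<sigma>_image[OF assms(2)] unfolding proj_Y by blast
  then have "lift Y r \<in> cover Y \<and> proj Y ` lift Y r = r"
    unfolding lift_def by (rule someI_ex)
  then obtain g where "g \<in> deck_group X" "lift Y r = g ` \<sigma> ` r"
    using new_lift[OF r, of "lift Y r"] unfolding proj_Y by blast
  then show ?thesis unfolding models_def using proj_Y place_Y \<sigma>(1) assms(2) by blast
next
  case False
  then have sub: "r \<subseteq> insert A R \<or> r \<subseteq> insert B R" using assms(2) unfolding six_R by auto
  have rX: "r \<in> simplices X" "r \<notin> removed_simplices A B R"
    using assms(1) False unfolding simplices_Y Un_iff Diff_iff added_iff by blast+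
  have s6: "insert A R \<subseteq> six" "insert B R \<subseteq> six" unfolding six_R by auto
  show ?thesis
    using sub models_subset[OF AR_simplex \<sigma>(2), of r Y] models_subset[OF BR_simplex \<sigma>(3), of r Y]
      assms(3) lift_Y_old[OF rX] proj_Y place_Y \<sigma>(1) s6 by blast
qed

lemma models_X:
  assumes "r \<subseteq> insert A R \<or> r \<subseteq> insert B R" "r \<noteq> {}"
  shows "models X \<sigma> r"
proof -
  have s6: "insert A R \<subseteq> six" "insert B R \<subseteq> six" unfolding six_R by auto
  show ?thesis
    using models_subset[OF AR_simplex \<sigma>(2), of r X] models_subset[OF BR_simplex \<sigma>(3), of r X] assms \<sigma>(1) s6 by blast
qed

abbreviation q :: "'v \<Rightarrow> real^4" where "q \<equiv> \<lambda>x. place X (\<sigma> x)"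

lemma sq_length_Y: "x \<in> six \<Longrightarrow> y \<in> six \<Longrightarrow> x \<noteq> y \<Longrightarrow> sq_length Y {x, y} = (dist (q x) (q y))\<^sup>2"
  using six_edges[of "{x, y}"] by (intro sq_length_models models_Y) (auto simp: edges_def)

lemma sq_length_old: "a \<in> edges X \<Longrightarrow> sq_length Y a = sq_length X a"
proof -
  assume a: "a \<in> edges X"
  then have "a \<in> simplices X" "card a = 2" unfolding edges_def by auto
  then have "lift Y a = lift X a" using removed_card[of a] by (intro lift_Y_old) auto
  then show ?thesis unfolding sq_length_def place_Y by simp
qed

section \<open>Signed volumes and the affine dependency of the cluster\<close>

text \<open>The simplices that omit a vertex of \<open>R\<close> exist after the move, the two
  others before it; so nondegeneracy of both complexes enters.\<close>

lemma simplex_nondegenerate: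
  assumes "w \<in> six"
  shows "inj_on q (six - {w})" "\<not> affine_dependent (q ` (six - {w}))"
proof -
  have c5: "card (six - {w}) = 5" using assms card_six by (simp add: card_Diff_singleton)
  then have ne: "six - {w} \<noteq> {}" by (metis card.empty zero_neq_numeral)
  have inj\<sigma>: "inj_on \<sigma> (six - {w})"
    by (rule inj_on_inverseI[of _ "proj X"]) (use \<sigma>(1) in auto)
  have "inj_on (place X) (\<sigma> ` (six - {w})) \<and> \<not> affine_dependent (place X ` \<sigma> ` (six - {w}))"
  proof (cases "w \<in> R")
    case True
    then have "six - {w} \<in> four_simplices Y" using four_simplices_Y by blast
    then have "\<sigma> ` (six - {w}) \<in> cover Y"
      using ne unfolding four_simplices_def by (intro \<sigma>_cover_Y) auto
    then show ?thesis
      using nondeg_Y card_image[OF inj\<sigma>] c5 unfolding nondegenerate_def place_Y by simp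
  next
    case False
    then have "w = A \<or> w = B" using assms unfolding six_R by auto
    then have "\<sigma> ` (six - {w}) \<in> cover X" using \<sigma>(2,3) minus_AB by metis
    then show ?thesis
      using nondeg_X card_image[OF inj\<sigma>] c5 unfolding nondegenerate_def by simp
  qed
  then show "inj_on q (six - {w})" "\<not> affine_dependent (q ` (six - {w}))"
    using comp_inj_on[OF inj\<sigma>, of "place X"] by (auto simp: image_image o_def)
qed

text \<open>The signs with which the six 4-simplices of the cluster enter the difference of the deficit
  angles after and before the move.\<close>

definition osgn :: "'v list \<Rightarrow> real" where
  "osgn xs = (if set xs \<in> simplices Y then orient Y xs else - orient X xs)"

text \<open>Signed volumes times 24; by \<open>lam_eq\<close> the choice of \<open>xs\<close> is
  immaterial. The value 0 off the cluster makes \<open>edge_weight\<close> vanish on edges that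
  leave it.\<close>

definition lam :: "'v \<Rightarrow> real" where
  "lam w = (if w \<in> six then
     (let xs = (SOME xs. distinct xs \<and> set xs = six - {w}) in osgn xs * orvol_list q xs) else 0)"

lemma six_minus_R: "w \<in> R \<Longrightarrow> six - {w} \<in> simplices Y \<and> six - {w} \<notin> simplices X \<and> card (six - {w}) = 5"
  using four_simplices_Y four_simplices_disjoint(2) unfolding four_simplices_def by blast

lemma six_minus_AB: "w \<in> {A, B} \<Longrightarrow> six - {w} \<in> simplices X \<and> six - {w} \<notin> simplices Y \<and> card (six - {w}) = 5"
  using four_simplices_X four_simplices_disjoint(1) unfolding four_simplices_def by blast

lemma six_minus_nonempty: "six - {w} \<noteq> {}"
  unfolding six_def using neq by auto

lemma six_cases: "w \<in> six \<longleftrightarrow> w \<in> R \<or> w \<in> {A, B}"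
  unfolding six_R by auto

lemma distinct_length_5: "distinct xs \<Longrightarrow> set xs = six - {w} \<Longrightarrow> w \<in> six \<Longrightarrow> length xs = 5"
  using six_minus_R six_minus_AB six_cases distinct_card by metis

lemma osgn_abs: "w \<in> six \<Longrightarrow> distinct xs \<Longrightarrow> set xs = six - {w} \<Longrightarrow> osgn xs \<in> {1, -1}"
proof -
  assume w: "w \<in> six" "distinct xs" "set xs = six - {w}"
  have len: "length xs = 5" using distinct_length_5 w by blast
  show ?thesis
  proof (cases "w \<in> R")
    case True
    then have "orient Y xs \<in> {1, -1}"
      using orient_Y len w six_minus_R unfolding orientation_def by simp
    then show ?thesis using six_minus_R[OF True] w unfolding osgn_def by simp
  next
    case False
    then have AB: "w \<in> {A, B}" using w six_cases by blast
    then have "orient X xs \<in> {1, -1}"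
      using orient_X len w six_minus_AB unfolding orientation_def by simp
    then show ?thesis using six_minus_AB[OF AB] w unfolding osgn_def by auto
  qed
qed

lemma lam_eq:
  assumes w: "w \<in> six" and xs: "distinct xs" "set xs = six - {w}"
  shows "lam w = osgn xs * orvol_list q xs"
proof -
  define ys where "ys = (SOME ys. distinct ys \<and> set ys = six - {w})"
  have ys: "distinct ys" "set ys = six - {w}"
    using someI_ex[of "\<lambda>ys. distinct ys \<and> set ys = six - {w}"] xs unfolding ys_def by blast+
  have len: "length xs = 5" using distinct_length_5 xs w by blast
  have "osgn ys * orvol_list q ys = osgn xs * orvol_list q xs"
  proof (cases "w \<in> R")
    case True
    then show ?thesis
      using orientation_orvol_invariant[OF orient_Y xs(1) len _ ys(1), of q] six_minus_R xs ys
      unfolding osgn_def by simp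
  next
    case False
    then have AB: "w \<in> {A, B}" using w six_cases by blast
    then show ?thesis
      using orientation_orvol_invariant[OF orient_X xs(1) len _ ys(1), of q] six_minus_AB[OF AB] xs ys
      unfolding osgn_def by simp
  qed
  then show ?thesis unfolding lam_def Let_def ys_def[symmetric] using w by simp
qed

lemma list_minus: obtains xs where "distinct xs" "set xs = six - {w}"
  using finite_distinct_list[of "six - {w}"] card_six by auto

lemma simplex_sign_Y: "w \<in> R \<Longrightarrow> simplex_sign Y (six - {w}) = sgn (lam w)"
proof -
  assume w: "w \<in> R"
  then have w6: "w \<in> six" using six_cases by blast
  obtain xs where xs: "distinct xs" "set xs = six - {w}" by (rule list_minus)
  have "simplex_sign Y (set xs) = sgn (orient Y xs * orvol_list (place X \<circ> \<sigma>) xs)"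
    by (rule simplex_sign_models[OF models_Y orient_Y xs(1) distinct_length_5[OF xs w6]])
      (use xs(2) six_minus_R[OF w] six_minus_nonempty[of w] in \<open>simp_all\<close>)
  then show ?thesis
    using lam_eq[OF w6 xs] six_minus_R[OF w] xs(2) unfolding osgn_def by (simp add: o_def)
qed

lemma simplex_sign_X: "w \<in> {A, B} \<Longrightarrow> simplex_sign X (six - {w}) = - sgn (lam w)"
proof -
  assume w: "w \<in> {A, B}"
  then have w6: "w \<in> six" using six_cases by blast
  obtain xs where xs: "distinct xs" "set xs = six - {w}" by (rule list_minus)
  have "simplex_sign X (set xs) = sgn (orient X xs * orvol_list (place X \<circ> \<sigma>) xs)"
    by (rule simplex_sign_models[OF models_X orient_X xs(1) distinct_length_5[OF xs w6]])
      (use xs(2) six_minus_AB[OF w] six_minus_nonempty[of w] w minus_AB in auto)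
  then show ?thesis
    using lam_eq[OF w6 xs] six_minus_AB[OF w] xs(2) unfolding osgn_def by (simp add: o_def sgn_minus)
qed

lemma orvol_list_nonzero:
  assumes "w \<in> six" "distinct xs" "set xs = six - {w}"
  shows "orvol_list q xs \<noteq> 0"
proof -
  have len: "length xs = 5" using distinct_length_5 assms by blast
  then have xs: "xs = [xs ! 0, xs ! 1, xs ! 2, xs ! 3, xs ! 4]"
    by (intro nth_equalityI) (auto simp: less_Suc_eq numeral_eq_Suc)
  have set: "q ` (six - {w}) = {q (xs ! 0), q (xs ! 1), q (xs ! 2), q (xs ! 3), q (xs ! 4)}"
    unfolding assms(3)[symmetric] by (subst xs) simp
  have "distinct (map q xs)"
    using simplex_nondegenerate(1)[OF assms(1)] assms(2,3) by (simp add: distinct_map)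
  then have "distinct [q (xs ! 0), q (xs ! 1), q (xs ! 2), q (xs ! 3), q (xs ! 4)]"
    by (subst (asm) xs) simp
  then show ?thesis
    using simplex_nondegenerate(2)[OF assms(1)] unfolding orvol_list_def set by (rule orvol_nonzero)
qed

lemma lam_abs: "w \<in> six \<Longrightarrow> distinct xs \<Longrightarrow> set xs = six - {w} \<Longrightarrow> \<bar>lam w\<bar> = \<bar>orvol_list q xs\<bar>"
  using lam_eq osgn_abs by (fastforce simp: abs_mult)

lemma lam_nonzero: "w \<in> six \<Longrightarrow> lam w \<noteq> 0"
  using list_minus lam_abs orvol_list_nonzero by (metis abs_eq_0_iff)

text \<open>The six 4-simplices form the boundary of a 5-simplex. With the orientation of the two
  removed ones reversed, which is the minus sign in \<open>osgn\<close>, they are coherently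
  oriented: within \<open>X\<close> or within \<open>Y\<close> by \<open>orientation\<close>,
  between the two by \<open>orient_replace\<close>.\<close>

lemma osgn_swap:
  assumes xy: "x \<in> six" "y \<in> six" "x \<noteq> y" and ts: "distinct ts" "set ts = six - {x, y}"
  shows "osgn (x # ts) = - osgn (y # ts)"
proof -
  have sx: "set (x # ts) = six - {y}" and sy: "set (y # ts) = six - {x}" using ts xy by auto
  have dx: "distinct (x # ts)" and dy: "distinct (y # ts)" using ts xy by auto
  have len: "length ts = 4" using distinct_length_5[OF dx sx xy(2)] by simp
  consider "x \<in> R" "y \<in> R" | "x \<in> R" "y \<in> {A, B}" | "x \<in> {A, B}" "y \<in> R" | "x \<in> {A, B}" "y \<in> {A, B}"
    using xy six_cases by blast
  then show ?thesis
  proof cases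
    case 1
    then have "orient Y (x # ts) = - orient Y (y # ts)"
      using orient_Y xy(3) len dx dy six_minus_R[OF 1(1)] six_minus_R[OF 1(2)] sx sy
      unfolding orientation_def by metis
    then show ?thesis using six_minus_R[OF 1(1)] six_minus_R[OF 1(2)] unfolding osgn_def sx sy by simp
  next
    case 2
    have "orient Y (y # ts) = orient X (x # ts)"
      using six_minus_R[OF 2(1)] six_minus_AB[OF 2(2)] by (intro orient_replace len dx dy) (simp_all add: sx[simplified] sy[simplified])
    then show ?thesis using six_minus_R[OF 2(1)] six_minus_AB[OF 2(2)] unfolding osgn_def sx sy by simp
  next
    case 3
    have "orient Y (x # ts) = orient X (y # ts)"
      using six_minus_R[OF 3(2)] six_minus_AB[OF 3(1)] by (intro orient_replace len dx dy) (simp_all add: sx[simplified] sy[simplified])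
    then show ?thesis using six_minus_R[OF 3(2)] six_minus_AB[OF 3(1)] unfolding osgn_def sx sy by simp
  next
    case 4
    then have "orient X (x # ts) = - orient X (y # ts)"
      using orient_X xy(3) len dx dy six_minus_AB[OF 4(1)] six_minus_AB[OF 4(2)] sx sy
      unfolding orientation_def by metis
    then show ?thesis using six_minus_AB[OF 4(1)] six_minus_AB[OF 4(2)] unfolding osgn_def sx sy by simp
  qed
qed

text \<open>Any two of the six vertices lie in a common nondegenerate 4-simplex of the
  cluster.\<close>

lemma q_inj: "inj_on q six"
proof (rule inj_onI)
  fix x y assume xy: "x \<in> six" "y \<in> six" "q x = q y"
  have "card {x, y} \<le> 2" by (simp add: card_insert_if)
  then have "\<not> six \<subseteq> {x, y}" using card_mono[of "{x, y}" six] card_six by auto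
  then obtain w where "w \<in> six" "w \<noteq> x" "w \<noteq> y" by blast
  then show "x = y"
    using simplex_nondegenerate(1)[of w] xy unfolding inj_on_def by blast
qed

lemma dependency_exists:
  "\<exists>\<mu>. (\<Sum>z\<in>six. \<mu> z) = 0 \<and> (\<Sum>z\<in>six. \<mu> z *\<^sub>R q z) = 0 \<and> (\<exists>z\<in>six. \<mu> z \<noteq> 0)"
proof -
  have fin: "finite (q ` six)" and card: "card (q ` six) = 6"
    using card_six card_image[OF q_inj] by auto
  have "affine_dependent (q ` six)"
    using fin card by (intro affine_dependent_biggerset) auto
  then obtain U where U: "sum U (q ` six) = 0" "\<exists>v\<in>q ` six. U v \<noteq> 0" "(\<Sum>v\<in>q ` six. U v *\<^sub>R v) = 0"
    unfolding affine_dependent_explicit_finite[OF fin] by blast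
  then show ?thesis
    by (intro exI[of _ "U \<circ> q"]) (auto simp: sum.reindex[OF q_inj])
qed

text \<open>Six points in four-space have some dependency \<open>\<mu>\<close>. By
  \<open>orvol_dependency\<close> its coefficients are proportional to the volumes up to signs, and
  \<open>osgn_swap\<close> makes the signs agree, so \<open>lam\<close> is a multiple of
  \<open>\<mu>\<close>.\<close>

lemma lam_dependency: "(\<Sum>z\<in>six. lam z) = 0" "(\<Sum>z\<in>six. lam z *\<^sub>R q z) = 0"
proof -
  obtain \<mu> where \<mu>: "(\<Sum>z\<in>six. \<mu> z) = 0" "(\<Sum>z\<in>six. \<mu> z *\<^sub>R q z) = 0" "\<exists>z\<in>six. \<mu> z \<noteq> 0"
    using dependency_exists by blast
  have ratio: "\<mu> x * lam y = \<mu> y * lam x" if xy: "x \<in> six" "y \<in> six" for x y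
  proof (cases "x = y")
    case False
    obtain ts where ts: "distinct ts" "set ts = six - {x, y}"
      using finite_distinct_list[of "six - {x, y}"] card_six by auto
    have sx: "set (x # ts) = six - {y}" and sy: "set (y # ts) = six - {x}" using ts xy False by auto
    have dx: "distinct (x # ts)" and dy: "distinct (y # ts)" using ts xy by auto
    have "length ts = 4" using distinct_length_5[OF dx sx xy(2)] by simp
    then obtain a b c d where abcd: "ts = [a, b, c, d]"
      by (auto simp: length_Suc_conv numeral_eq_Suc)
    have six: "six = {a, b, c, d, x, y}" using ts(2) xy unfolding abcd by auto
    have dist: "distinct [a, b, c, d, x, y]" using dx dy False unfolding abcd by auto
    \<comment> \<open>A cyclic shift of five vertices is an even permutation.\<close>
    have rot: "orvol z1 z2 z3 z4 z5 = orvol z2 z3 z4 z5 z1" for z1 z2 z3 z4 z5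
      using orvol_swap(1)[of z1 z2 z3 z4 z5] orvol_swap(2)[of z2 z1 z3 z4 z5]
        orvol_swap(3)[of z2 z3 z1 z4 z5] orvol_swap(4)[of z2 z3 z4 z1 z5] by simp
    have "\<mu> x * orvol_list q (x # ts) + \<mu> y * orvol_list q (y # ts) = 0"
      using orvol_dependency[OF dist \<mu>(1,2)[unfolded six]] rot[of "q x"] rot[of "q y"]
      unfolding orvol_list_def abcd by (simp add: numeral_eq_Suc)
    then have 1: "\<mu> x * orvol_list q (x # ts) = - (\<mu> y * orvol_list q (y # ts))" by linarith
    have "\<mu> x * lam y = osgn (x # ts) * (\<mu> x * orvol_list q (x # ts))"
      unfolding lam_eq[OF xy(2) dx sx] by simp
    also have "\<dots> = \<mu> y * lam x"
      unfolding 1 lam_eq[OF xy(1) dy sy] osgn_swap[OF xy False ts] by simp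
    finally show ?thesis .
  qed simp
  obtain z where z: "z \<in> six" "\<mu> z \<noteq> 0" using \<mu>(3) by blast
  have eq: "lam x = lam z / \<mu> z * \<mu> x" if "x \<in> six" for x
    using ratio[OF that z(1)] z(2) by (simp add: field_simps)
  have "(\<Sum>x\<in>six. lam x) = lam z / \<mu> z * (\<Sum>x\<in>six. \<mu> x)"
    unfolding sum_distrib_left by (rule sum.cong) (simp_all add: eq)
  then show "(\<Sum>z\<in>six. lam z) = 0" using \<mu>(1) by simp
  have "(\<Sum>x\<in>six. lam x *\<^sub>R q x) = (lam z / \<mu> z) *\<^sub>R (\<Sum>x\<in>six. \<mu> x *\<^sub>R q x)"
    unfolding scaleR_sum_right by (rule sum.cong) (simp_all add: eq)
  then show "(\<Sum>z\<in>six. lam z *\<^sub>R q z) = 0" using \<mu>(2) by simp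
qed

lemma simplex_volume_cluster:
  "w \<in> R \<Longrightarrow> simplex_volume Y (six - {w}) = \<bar>lam w\<bar> / 24"
  "w \<in> {A, B} \<Longrightarrow> simplex_volume X (six - {w}) = \<bar>lam w\<bar> / 24"
proof -
  have vol: "simplex_volume Z (six - {w}) = \<bar>lam w\<bar> / 24" if w: "w \<in> six" and m: "models Z \<sigma> (six - {w})" for Z w
  proof -
    obtain xs where xs: "distinct xs" "set xs = six - {w}" by (rule list_minus)
    have "length xs = 5" by (rule distinct_length_5[OF xs w])
    then obtain a b c d e where l: "xs = [a, b, c, d, e]"
      by (auto simp: length_Suc_conv numeral_eq_Suc)
    have "orvol (q a) (q b) (q c) (q d) (q e) = orvol_list q xs"
      unfolding orvol_list_def l by (simp add: numeral_eq_Suc)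
    then have "simplex_volume Z {a, b, c, d, e} = \<bar>orvol_list q xs\<bar> / 24"
      using xs m orvol_list_nonzero[OF w xs] unfolding l by (intro simplex_volume_models) auto
    then show ?thesis using lam_abs[OF w xs] xs(2) unfolding l by simp
  qed
  show "w \<in> R \<Longrightarrow> simplex_volume Y (six - {w}) = \<bar>lam w\<bar> / 24"
    using six_minus_R[of w] six_cases six_minus_nonempty[of w] by (intro vol models_Y) auto
  show "w \<in> {A, B} \<Longrightarrow> simplex_volume X (six - {w}) = \<bar>lam w\<bar> / 24"
    using six_minus_AB[of w] six_cases six_minus_nonempty[of w] minus_AB by (intro vol models_X) auto
qed

lemma realizes_six: "realizes q six (sq_length Y)"
  unfolding realizes_def using sq_length_Y by simp

lemma realizable_new: "w \<in> six \<Longrightarrow> realizable (six - {w}) (sq_length Y)"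
  unfolding realizable_def using simplex_nondegenerate[of w] realizes_six
  by (intro exI[of _ q]) (auto simp: realizes_def)

lemma edge_of_simplex: "s \<in> simplices X \<Longrightarrow> x \<in> s \<Longrightarrow> y \<in> s \<Longrightarrow> x \<noteq> y \<Longrightarrow> {x, y} \<in> edges X"
  unfolding edges_def using simplex_subset[of s "{x, y}"] by simp

text \<open>Angles at simplices outside the cluster must be differentiable too, so the chosen lift
  serves as a realization for every 4-simplex.\<close>

lemma realizable_X: "s \<in> four_simplices X \<Longrightarrow> realizable s (sq_length X)"
proof -
  assume s: "s \<in> four_simplices X"
  then have sX: "s \<in> simplices X" and c5: "card s = 5" unfolding four_simplices_def by auto
  let ?q = "place X \<circ> section_of s"
  note sec = section_of[OF sX]
  have cov: "section_of s ` s \<in> cover X" using lift_X[OF sX] unfolding sec(1) by simp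
  have inj: "inj_on (section_of s) s"
    by (rule inj_on_inverseI[of _ "proj X"]) (rule sec(2))
  have "card (section_of s ` s) = 5" using card_image[OF inj] c5 by simp
  then have nd: "inj_on (place X) (section_of s ` s)" "\<not> affine_dependent (place X ` section_of s ` s)"
    using nondeg_X cov unfolding nondegenerate_def by blast+
  have "realizes ?q s (sq_length X)" unfolding realizes_def
  proof (intro ballI impI)
    fix x y assume "x \<in> s" "y \<in> s" "x \<noteq> y"
    then have "models X (section_of s) {x, y}"
      by (intro models_subset[OF sX cov sec(2)]) auto
    then show "(dist (?q x) (?q y))\<^sup>2 = sq_length X {x, y}"
      using sq_length_models \<open>x \<noteq> y\<close> by simp
  qed
  then show ?thesis
    unfolding realizable_def using nd comp_inj_on[OF inj nd(1)] by (intro exI[of _ ?q]) (simp add: image_comp)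
qed

lemma realizable_Y: "s \<in> four_simplices Y \<Longrightarrow> realizable s (sq_length Y)"
proof -
  assume s: "s \<in> four_simplices Y"
  show ?thesis
  proof (cases "s \<in> four_simplices X")
    case True
    then have sX: "s \<in> simplices X" unfolding four_simplices_def by simp
    then show ?thesis
      using realizable_X[OF True] sq_length_old edge_of_simplex[OF sX]
      unfolding realizable_def realizes_def by metis
  next
    case False
    then obtain w where "w \<in> R" "s = six - {w}" using s four_simplices_Y by blast
    then show ?thesis using realizable_new six_cases by blast
  qed
qed

lemma simplex_sign_common:
  assumes "s \<in> four_simplices X" "s \<in> four_simplices Y"
  shows "simplex_sign Y s = simplex_sign X s"
proof -
  have s: "s \<in> simplices X" "s \<in> simplices Y" "card s = 5" using assms unfolding four_simplices_def by auto
  have "s \<notin> removed_simplices A B R"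
    using s AB_subset unfolding simplices_Y Un_iff Diff_iff added_iff by blast
  then have lift: "lift Y s = lift X s" by (rule lift_Y_old[OF s(1)])
  define xs where "xs = (SOME xs. distinct xs \<and> set xs = s)"
  have xs: "distinct xs \<and> set xs = s"
    unfolding xs_def by (rule someI_ex) (use finite_distinct_list[of s] in auto)
  have "orient Y xs = orient X xs"
    using xs s distinct_card[of xs] by (intro orient_common) auto
  then show ?thesis
    unfolding simplex_sign_def Let_def xs_def[symmetric] lift place_Y proj_Y by simp
qed

section \<open>The rank one change of the derivative matrix\<close>

definition edge_weight :: "'v set \<Rightarrow> real" where
  "edge_weight a = (\<Prod>x\<in>a. lam x)"

text \<open>The factor of the rank one change that belongs to the face; the minus sign is that of
  the deficit angle, and faces that leave the cluster see no change.\<close>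

definition face_weight :: "'v set \<Rightarrow> real" where
  "face_weight i = (if i \<subseteq> six then - face_area Y i / (\<Prod>w\<in>six - i. lam w) else 0)"

lemma face_area_six:
  assumes "{a, b, c} \<subseteq> six" "distinct [a, b, c]"
  shows "face_area Y {a, b, c} = triangle_area (q a) (q b) (q c)"
  using assms six_faces[OF assms(1)]
  by (intro face_area_models models_Y) (auto simp: faces_def)

lemma six_labels:
  assumes "i \<subseteq> six" "card i = 3"
  obtains a b c d e f where "distinct [a, b, c, d, e, f]" "six = {a, b, c, d, e, f}" "i = {a, b, c}"
    "six - i = {d, e, f}"
proof -
  obtain a b c where i: "i = {a, b, c}" "a \<noteq> b" "a \<noteq> c" "b \<noteq> c"
    using assms(2) unfolding card_3_iff by blast
  have "card (six - i) = 3" using assms card_six by (simp add: card_Diff_subset finite_subset)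
  then obtain d e f where def: "six - i = {d, e, f}" "d \<noteq> e" "d \<noteq> f" "e \<noteq> f" unfolding card_3_iff by blast
  then have "six = {a, b, c, d, e, f}" "d \<notin> i" "e \<notin> i" "f \<notin> i" using assms(1) i by auto
  then show thesis by (intro that[of a b c d e f]) (use i def in auto)
qed

text \<open>This is \<open>dihedral_slope_cluster\<close> for \<open>lam\<close>. An edge that
  leaves the cluster affects none of these angles, and its weight is 0.\<close>

lemma cluster_deriv:
  assumes i: "i \<subseteq> six" "card i = 3" and a: "card a = 2"
  shows "(\<Sum>w\<in>six - i. sgn (lam w) * dihedral_deriv (sq_length Y) (six - {w}) i a) =
    - face_weight i * edge_weight a"
proof -
  obtain x y where xy: "a = {x, y}" "x \<noteq> y" using a unfolding card_2_iff by blast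
  show ?thesis
  proof (cases "a \<subseteq> six")
    case False
    then have "edge_weight a = 0" unfolding xy(1) edge_weight_def using xy(2) by (auto simp: lam_def)
    moreover have "dihedral_deriv (sq_length Y) (six - {w}) i a = 0" for w
      by (rule dihedral_deriv_other) (use False in blast)
    ultimately show ?thesis by simp
  next
    case True
    obtain a' b c d e f where lab: "distinct [a', b, c, d, e, f]" "six = {a', b, c, d, e, f}" "i = {a', b, c}"
      "six - i = {d, e, f}" using six_labels[OF i] by blast
    have neq: "d \<noteq> e" "d \<noteq> f" "e \<noteq> f" using lab by auto
    have slope: "dihedral_deriv (sq_length Y) (six - {w}) i a = dihedral_slope q a' b c z1 z2 x y"
      if "distinct [a', b, c, z1, z2]" "six - {w} = {a', b, c, z1, z2}" "w \<in> six" for w z1 z2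
      unfolding dihedral_deriv_def xy(1)
      using that simplex_nondegenerate[OF that(3)] realizes_six xy(2)
      by (intro DERIV_imp_deriv has_real_derivative_dihedral[OF _ _ lab(3)]) (auto simp: realizes_def)
    have sixw: "six - {f} = {a', b, c, d, e}" "six - {d} = {a', b, c, e, f}" "six - {e} = {a', b, c, d, f}"
      using lab by auto
    have S: "(\<Sum>w\<in>six - i. sgn (lam w) * dihedral_deriv (sq_length Y) (six - {w}) i a) =
        sgn (lam f) * dihedral_slope q a' b c d e x y + sgn (lam d) * dihedral_slope q a' b c e f x y
        + sgn (lam e) * dihedral_slope q a' b c d f x y"
    proof -
      have "dihedral_deriv (sq_length Y) (six - {f}) i a = dihedral_slope q a' b c d e x y"
        "dihedral_deriv (sq_length Y) (six - {d}) i a = dihedral_slope q a' b c e f x y"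
        "dihedral_deriv (sq_length Y) (six - {e}) i a = dihedral_slope q a' b c d f x y"
        by (rule slope; use lab sixw in simp)+
      then show ?thesis unfolding lab(4) using neq by simp
    qed
    have vol: "\<bar>orvol (q z1) (q z2) (q z3) (q z4) (q z5)\<bar> = \<bar>lam w\<bar>"
      if "w \<in> six" "six - {w} = {z1, z2, z3, z4, z5}" "distinct [z1, z2, z3, z4, z5]" for w z1 z2 z3 z4 z5
      using lam_abs[OF that(1) that(3)] that(2) by (simp add: orvol_list_def numeral_eq_Suc)
    have "sgn (lam f) * dihedral_slope q a' b c d e x y + sgn (lam d) * dihedral_slope q a' b c e f x y
        + sgn (lam e) * dihedral_slope q a' b c d f x y = sqrt (gram (q b - q a') (q c - q a')) / 2 * (lam x * lam y) / (lam d * lam e * lam f)"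
    proof (rule dihedral_slope_cluster[OF lab(1)])
      show "(\<Sum>z\<in>{a', b, c, d, e, f}. lam z) = 0" "(\<Sum>z\<in>{a', b, c, d, e, f}. lam z *\<^sub>R q z) = 0"
        using lam_dependency unfolding lab(2) by simp_all
      show "lam d \<noteq> 0" "lam e \<noteq> 0" "lam f \<noteq> 0" using lam_nonzero lab(2) by auto
      show "\<bar>orvol (q a') (q b) (q c) (q d) (q e)\<bar> = \<bar>lam f\<bar>"
        "\<bar>orvol (q a') (q b) (q c) (q e) (q f)\<bar> = \<bar>lam d\<bar>"
        "\<bar>orvol (q a') (q b) (q c) (q d) (q f)\<bar> = \<bar>lam e\<bar>"
        by (rule vol; use lab sixw in simp)+
      show "x \<in> {a', b, c, d, e, f}" "y \<in> {a', b, c, d, e, f}" using True xy lab(2) by auto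
    qed
    also have "\<dots> = - face_weight i * edge_weight a"
    proof -
      have fa: "face_area Y i = sqrt (gram (q b - q a') (q c - q a')) / 2"
        unfolding lab(3) using i lab by (subst face_area_six) (auto simp: triangle_area_gram)
      have "(\<Prod>w\<in>six - i. lam w) = lam d * lam e * lam f" unfolding lab(4) using neq by simp
      then show ?thesis
        unfolding face_weight_def edge_weight_def xy(1) fa using i xy(2) by simp
    qed
    finally show ?thesis unfolding S .
  qed
qed

text \<open>The common 4-simplices contribute the same \<open>c0\<close> on both sides. The new ones
  enter with the sign of \<open>lam w\<close>, the old ones with the opposite sign, so the
  difference is the full sum over the cluster, known from \<open>cluster_deriv\<close>.\<close>

lemma d_omega_d_L_Y:
  assumes i: "i \<in> faces Y" and a: "a \<in> edges Y"
  shows "d_omega_d_L Y i a =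
    (if i \<in> faces X \<and> a \<in> edges X then d_omega_d_L X i a else 0) + face_weight i * edge_weight a"
proof -
  let ?l = "sq_length Y"
  define dd where "dd s = dihedral_deriv ?l s i a" for s
  define common where "common = four_simplices X \<inter> four_simplices Y"
  have c3: "card i = 3" and c2: "card a = 2" using i a unfolding faces_def edges_def by auto
  have fin: "finite (four_simplices Z)" for Z :: "('v, 'u) placed_complex" by simp
  have injsix: "inj_on (\<lambda>w. six - {w}) six" by (rule inj_onI) blast
  have injR: "inj_on (\<lambda>w. six - {w}) R" and injAB: "inj_on (\<lambda>w. six - {w}) {A, B}"
    by (rule inj_on_subset[OF injsix], simp add: six_R, blast?)+
  define c0 where "c0 = (\<Sum>s\<in>common. if i \<subseteq> s then simplex_sign Y s * dd s else 0)"
  have Ysum: "d_omega_d_L Y i a = - c0 - (\<Sum>w\<in>R. if i \<subseteq> six - {w} then sgn (lam w) * dd (six - {w}) else 0)"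
  proof -
    have "d_omega_d_L Y i a = - (\<Sum>s | s \<in> four_simplices Y \<and> i \<subseteq> s. simplex_sign Y s * dd s)"
      unfolding dd_def by (rule d_omega_d_L_eq[OF c3 c2 realizable_Y fin])
    also have "(\<Sum>s | s \<in> four_simplices Y \<and> i \<subseteq> s. simplex_sign Y s * dd s) =
        (\<Sum>s\<in>four_simplices Y. if i \<subseteq> s then simplex_sign Y s * dd s else 0)"
      by (simp add: sum.inter_filter[OF fin, symmetric])
    also have "\<dots> = (\<Sum>s\<in>common \<union> (\<lambda>w. six - {w}) ` R. if i \<subseteq> s then simplex_sign Y s * dd s else 0)"
      unfolding common_def four_simplices_Y[symmetric] ..
    also have "\<dots> = c0 + (\<Sum>s\<in>(\<lambda>w. six - {w}) ` R. if i \<subseteq> s then simplex_sign Y s * dd s else 0)"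
      unfolding c0_def using four_simplices_disjoint(2)
      by (intro sum.union_disjoint) (auto simp: common_def)
    also have "(\<Sum>s\<in>(\<lambda>w. six - {w}) ` R. if i \<subseteq> s then simplex_sign Y s * dd s else 0) =
        (\<Sum>w\<in>R. if i \<subseteq> six - {w} then sgn (lam w) * dd (six - {w}) else 0)"
      by (subst sum.reindex[OF injR]) (simp add: simplex_sign_Y cong: if_cong sum.cong)
    finally show ?thesis by simp
  qed
  have Xsum: "d_omega_d_L X i a = - c0 + (\<Sum>w\<in>{A, B}. if i \<subseteq> six - {w} then sgn (lam w) * dd (six - {w}) else 0)"
    if iX: "i \<in> faces X" and aX: "a \<in> edges X"
  proof -
    have dd: "dihedral_deriv (sq_length X) s i a = dd s" if "s \<in> four_simplices X" for s
      unfolding dd_def using that sq_length_old edge_of_simplex[of s] aX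
      by (intro dihedral_deriv_cong) (auto simp: four_simplices_def)
    have "d_omega_d_L X i a =
        - (\<Sum>s | s \<in> four_simplices X \<and> i \<subseteq> s. simplex_sign X s * dihedral_deriv (sq_length X) s i a)"
      by (rule d_omega_d_L_eq[OF c3 c2 realizable_X fin])
    also have "(\<Sum>s | s \<in> four_simplices X \<and> i \<subseteq> s. simplex_sign X s * dihedral_deriv (sq_length X) s i a) =
        (\<Sum>s | s \<in> four_simplices X \<and> i \<subseteq> s. simplex_sign X s * dd s)"
      by (rule sum.cong) (auto simp: dd)
    also have "\<dots> = (\<Sum>s\<in>four_simplices X. if i \<subseteq> s then simplex_sign X s * dd s else 0)"
      by (simp add: sum.inter_filter[OF fin, symmetric])
    also have "\<dots> = (\<Sum>s\<in>common \<union> (\<lambda>w. six - {w}) ` {A, B}. if i \<subseteq> s then simplex_sign X s * dd s else 0)"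
      unfolding common_def four_simplices_X[symmetric] ..
    also have "\<dots> = (\<Sum>s\<in>common. if i \<subseteq> s then simplex_sign X s * dd s else 0) +
        (\<Sum>s\<in>(\<lambda>w. six - {w}) ` {A, B}. if i \<subseteq> s then simplex_sign X s * dd s else 0)"
      using four_simplices_disjoint(1) by (intro sum.union_disjoint) (auto simp: common_def)
    also have "(\<Sum>s\<in>common. if i \<subseteq> s then simplex_sign X s * dd s else 0) = c0"
      unfolding c0_def by (rule sum.cong) (auto simp: common_def simplex_sign_common)
    also have "(\<Sum>s\<in>(\<lambda>w. six - {w}) ` {A, B}. if i \<subseteq> s then simplex_sign X s * dd s else 0) =
        (\<Sum>w\<in>{A, B}. - (if i \<subseteq> six - {w} then sgn (lam w) * dd (six - {w}) else 0))"
      by (subst sum.reindex[OF injAB]) (auto simp: simplex_sign_X intro!: sum.cong)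
    finally show ?thesis by (simp add: sum_negf)
  qed
  have total: "(\<Sum>w\<in>R. if i \<subseteq> six - {w} then sgn (lam w) * dd (six - {w}) else 0) +
      (\<Sum>w\<in>{A, B}. if i \<subseteq> six - {w} then sgn (lam w) * dd (six - {w}) else 0) =
      - face_weight i * edge_weight a"
  proof -
    have "(\<Sum>w\<in>R. if i \<subseteq> six - {w} then sgn (lam w) * dd (six - {w}) else 0) +
      (\<Sum>w\<in>{A, B}. if i \<subseteq> six - {w} then sgn (lam w) * dd (six - {w}) else 0) =
      (\<Sum>w\<in>six. if i \<subseteq> six - {w} then sgn (lam w) * dd (six - {w}) else 0)"
    proof -
      have "(\<Sum>w\<in>six. h w) = (\<Sum>w\<in>R. h w) + (\<Sum>w\<in>{A, B}. h w)" for h :: "'v \<Rightarrow> real"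
        unfolding six_R using A_R by (subst Un_commute) (intro sum.union_disjoint; simp)
      then show ?thesis by (rule sym)
    qed
    also have "\<dots> = - face_weight i * edge_weight a"
    proof (cases "i \<subseteq> six")
      case True
      then have "(\<Sum>w\<in>six. if i \<subseteq> six - {w} then sgn (lam w) * dd (six - {w}) else 0) =
          (\<Sum>w\<in>six - i. sgn (lam w) * dd (six - {w}))"
        using card_six by (intro sum.mono_neutral_cong_right) auto
      then show ?thesis using cluster_deriv[OF True c3 c2] unfolding dd_def by simp
    next
      case False
      then have "\<not> i \<subseteq> six - {w}" for w by blast
      then show ?thesis using False unfolding face_weight_def by simp
    qed
    finally show ?thesis .
  qed
  show ?thesis
  proof (cases "i \<in> faces X \<and> a \<in> edges X")
    case True
    then show ?thesis using Ysum Xsum total by simp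
  next
    case False
    \<comment> \<open>A new face or the new edge contains both \<open>A\<close> and
      \<open>B\<close>, and no 4-simplex of \<open>X\<close> does, so everything inherited from
      \<open>X\<close> vanishes.\<close>
    have "c0 = 0 \<and> (\<Sum>w\<in>{A, B}. if i \<subseteq> six - {w} then sgn (lam w) * dd (six - {w}) else 0) = 0"
    proof (cases "i \<in> faces X")
      case True
      then have "a = {A, B}" using False a edges_Y by auto
      then have "dd s = 0" if "s \<in> four_simplices X" for s
        using dihedral_deriv_other[of a s] AB_subset[of s] that unfolding dd_def four_simplices_def by auto
      moreover have "six - {w} \<in> four_simplices X" if "w \<in> {A, B}" for w
        using four_simplices_X that by blast
      ultimately show ?thesis unfolding c0_def common_def by (auto intro!: sum.neutral)
    next
      case False
      then have "{A, B} \<subseteq> i" using i faces_Y by auto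
      then have "\<not> i \<subseteq> s" if "s \<in> four_simplices X" for s
        using AB_subset[of s] that unfolding four_simplices_def by auto
      moreover have "six - {w} \<in> four_simplices X" if "w \<in> {A, B}" for w
        using four_simplices_X that by blast
      ultimately show ?thesis unfolding c0_def common_def by (auto intro!: sum.neutral)
    qed
    then show ?thesis using Ysum total False by auto
  qed
qed

section \<open>Area differentials of the faces of the cluster\<close>

lemma edge_frame_six:
  assumes "x \<in> six" "y \<in> six" "x \<noteq> y"
  shows "\<And>j k. j < 3 \<Longrightarrow> k < 3 \<Longrightarrow> n (\<sigma> ` {x, y}) j \<bullet> n (\<sigma> ` {x, y}) k = (if j = k then 1 else 0)"
    and "\<And>k. k < 3 \<Longrightarrow> (q x - q y) \<bullet> n (\<sigma> ` {x, y}) k = 0"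
    and "\<And>g k. k < 3 \<Longrightarrow> g \<in> deck_group X \<Longrightarrow>
      n (g ` \<sigma> ` {x, y}) k = \<rho> g (n (\<sigma> ` {x, y}) k) - \<rho> g 0"
proof -
  have "\<sigma> x \<noteq> \<sigma> y" using \<sigma>(1)[OF assms(1)] \<sigma>(1)[OF assms(2)] assms(3) by auto
  then have c: "card (\<sigma> ` {x, y}) = 2" by simp
  have e: "\<sigma> ` {x, y} \<in> cover Y"
    using six_edges[of "{x, y}"] assms by (intro \<sigma>_cover_Y) (auto simp: edges_def)
  have all: "(\<forall>j<3. \<forall>k<3. n (\<sigma> ` {x, y}) j \<bullet> n (\<sigma> ` {x, y}) k = (if j = k then 1 else 0)) \<and>
        (\<forall>k<3. \<forall>u\<in>\<sigma> ` {x, y}. \<forall>w\<in>\<sigma> ` {x, y}. (place Y u - place Y w) \<bullet> n (\<sigma> ` {x, y}) k = 0) \<and>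
        (\<forall>g\<in>deck_group Y. \<forall>k<3. n (g ` \<sigma> ` {x, y}) k = \<rho> g (n (\<sigma> ` {x, y}) k) - \<rho> g 0)"
    using frame c e unfolding edge_frame_def by blast
  show "\<And>j k. j < 3 \<Longrightarrow> k < 3 \<Longrightarrow> n (\<sigma> ` {x, y}) j \<bullet> n (\<sigma> ` {x, y}) k = (if j = k then 1 else 0)"
    using all by blast
  show "\<And>k. k < 3 \<Longrightarrow> (q x - q y) \<bullet> n (\<sigma> ` {x, y}) k = 0"
    using all unfolding place_Y by blast
  show "\<And>g k. k < 3 \<Longrightarrow> g \<in> deck_group X \<Longrightarrow> n (g ` \<sigma> ` {x, y}) k = \<rho> g (n (\<sigma> ` {x, y}) k) - \<rho> g 0"
    using all deck_X_subset_Y by blast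
qed

lemma face_area_pos:
  assumes "{x, y, z} \<subseteq> six" "distinct [x, y, z]"
  shows "triangle_area (q x) (q y) (q z) > 0"
proof -
  have "card {x, y, z} = 3" using assms by simp
  then obtain a b c d e f where lab: "distinct [a, b, c, d, e, f]" "six = {a, b, c, d, e, f}"
    "{x, y, z} = {a, b, c}" "six - {x, y, z} = {d, e, f}" using six_labels[OF assms(1)] by blast
  have "orvol_list q [x, y, z, d, e] \<noteq> 0"
    by (rule orvol_list_nonzero[of f]) (use lab assms in auto)
  then have "orvol (q x) (q y) (q z) (q d) (q e) \<noteq> 0"
    by (simp add: orvol_list_def numeral_eq_Suc)
  then show ?thesis unfolding triangle_area_gram using orvol_nonzero_gram by simp
qed

lemma d_S_d_v_six:
  assumes "{x, y, z} \<subseteq> six" "distinct [x, y, z]" "k < 3"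
  shows "d_S_d_v Y n {x, y, z} ({x, y}, k) =
    (dist (q x) (q y))\<^sup>2 * ((q x - q z) \<bullet> n (\<sigma> ` {x, y}) k) / (2 * face_area Y {x, y, z})"
  using assms six_faces[of "{x, y, z}"] edge_frame_six[of x y]
  unfolding face_area_six[OF assms(1,2)]
  by (intro d_S_d_v_models models_Y face_area_pos) (auto simp: faces_def)

lemma d_S_d_v_six_other:
  assumes "i \<subseteq> six" "card i = 3" "card a = 2" "\<not> a \<subseteq> i"
  shows "d_S_d_v Y n i (a, k) = 0"
proof -
  obtain x y z where i: "i = {x, y, z}" "x \<noteq> y" "x \<noteq> z" "y \<noteq> z"
    using assms(2) unfolding card_3_iff by blast
  show ?thesis unfolding i(1)
    by (rule d_S_d_v_models_other[of Y \<sigma>])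
      (use i assms six_faces[OF assms(1,2)] in \<open>auto intro!: models_Y simp: faces_def\<close>)
qed

text \<open>Only the faces \<open>insert z a\<close> with \<open>z\<close> in the cluster
  contribute. The area in the face weight cancels that in the slope, and up to a common factor there
  remains the sum of \<open>lam z * ((q x - q z) \<bullet> ?n)\<close>, which is zero by the affine
  dependency. This supplies \<open>K_PY\<close> of the linear algebra.\<close>

lemma face_weight_d_S_d_v:
  assumes c: "c \<in> components Y"
  shows "(\<Sum>i\<in>faces Y. face_weight i * d_S_d_v Y n i c) = 0"
proof -
  obtain a k where ck: "c = (a, k)" "a \<in> edges Y" "k < 3" using c unfolding components_def by auto
  then have c2: "card a = 2" unfolding edges_def by simp
  then obtain x y where xy: "a = {x, y}" "x \<noteq> y" unfolding card_2_iff by blast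
  have zero: "face_weight i * d_S_d_v Y n i c = 0" if "i \<in> faces Y" "\<not> (i \<subseteq> six \<and> a \<subseteq> i)" for i
    using that d_S_d_v_six_other[of i a k] c2 unfolding ck(1) face_weight_def faces_def by auto
  show ?thesis
  proof (cases "a \<subseteq> six")
    case False
    then show ?thesis using zero by (intro sum.neutral) auto
  next
    case True
    then have x6: "x \<in> six" "y \<in> six" using xy by auto
    let ?n = "n (\<sigma> ` {x, y}) k"
    define L where "L = (dist (q x) (q y))\<^sup>2"
    \<comment> \<open>Rewriting the product over the complement of a face as \<open>pl\<close> over
      the product on the face separates the edge factor from \<open>lam z\<close>.\<close>
    define pl where "pl = (\<Prod>w\<in>six. lam w)"
    have pl0: "pl \<noteq> 0" unfolding pl_def using lam_nonzero card_six by simp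
    have face: "insert z a \<in> faces Y" if "z \<in> six - a" for z
      using that xy True by (intro six_faces) auto
    have "(\<Sum>i\<in>faces Y. face_weight i * d_S_d_v Y n i c) =
        (\<Sum>i\<in>(\<lambda>z. insert z a) ` (six - a). face_weight i * d_S_d_v Y n i c)"
    proof (intro sum.mono_neutral_right ballI)
      fix i assume i: "i \<in> faces Y - (\<lambda>z. insert z a) ` (six - a)"
      show "face_weight i * d_S_d_v Y n i c = 0"
      proof (rule zero)
        show "i \<in> faces Y" using i by simp
        show "\<not> (i \<subseteq> six \<and> a \<subseteq> i)"
        proof
          assume ia: "i \<subseteq> six \<and> a \<subseteq> i"
          have "card i = 3" using i unfolding faces_def by simp
          then have "card (i - a) = 1" using ia c2 card_six by (simp add: card_Diff_subset finite_subset)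
          then obtain z where "i - a = {z}" by (metis card_1_singletonE)
          then have "i = insert z a" "z \<in> six - a" using ia by auto
          then show False using i by blast
        qed
      qed
    qed (use face in auto)
    also have "\<dots> = (\<Sum>z\<in>six - a. face_weight (insert z a) * d_S_d_v Y n (insert z a) c)"
      by (rule sum.reindex_cong[OF _ refl refl]) (auto simp: inj_on_def)
    also have "\<dots> = (\<Sum>z\<in>six - a. - (L * edge_weight a / (2 * pl)) * (lam z * ((q x - q z) \<bullet> ?n)))"
    proof (intro sum.cong refl)
      fix z assume z: "z \<in> six - a"
      have eq: "insert z a = {x, y, z}" using xy by auto
      have sub: "{x, y, z} \<subseteq> six" and dist: "distinct [x, y, z]" using z True xy by auto
      have S: "face_area Y {x, y, z} > 0" using face_area_pos[OF sub dist] face_area_six[OF sub dist] by simp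
      have "pl = (\<Prod>w\<in>six - {x, y, z}. lam w) * (\<Prod>w\<in>{x, y, z}. lam w)"
        unfolding pl_def using sub card_six by (intro prod.subset_diff) auto
      then have P: "pl = (\<Prod>w\<in>six - {x, y, z}. lam w) * (edge_weight a * lam z)"
        using dist unfolding edge_weight_def xy(1) by simp
      then have "(\<Prod>w\<in>six - {x, y, z}. lam w) \<noteq> 0" "edge_weight a * lam z \<noteq> 0" using pl0 by auto
      then have f1: "face_weight {x, y, z} = - face_area Y {x, y, z} * edge_weight a * lam z / pl"
        unfolding face_weight_def P using sub by (simp add: field_simps)
      have f2: "d_S_d_v Y n {x, y, z} c = L * ((q x - q z) \<bullet> ?n) / (2 * face_area Y {x, y, z})"
        unfolding ck(1) xy(1) L_def by (rule d_S_d_v_six[OF sub dist ck(3)])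
      show "face_weight (insert z a) * d_S_d_v Y n (insert z a) c =
          - (L * edge_weight a / (2 * pl)) * (lam z * ((q x - q z) \<bullet> ?n))"
        unfolding eq f1 f2 using S pl0 by (simp add: field_simps)
    qed
    also have "\<dots> = - (L * edge_weight a / (2 * pl)) * (\<Sum>z\<in>six - a. lam z * ((q x - q z) \<bullet> ?n))"
      by (simp add: sum_distrib_left)
    \<comment> \<open>The added terms are zero: trivially for \<open>z = x\<close>, and for
      \<open>z = y\<close> because the frame is orthogonal to the edge.\<close>
    also have "(\<Sum>z\<in>six - a. lam z * ((q x - q z) \<bullet> ?n)) = (\<Sum>z\<in>six. lam z * ((q x - q z) \<bullet> ?n))"
      using edge_frame_six(2)[OF x6 xy(2) ck(3)] card_six True xy(1)
      by (intro sum.mono_neutral_left) auto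
    also have "\<dots> = (\<Sum>z\<in>six. lam z *\<^sub>R (q x - q z)) \<bullet> ?n"
      by (simp add: inner_sum_left)
    also have "(\<Sum>z\<in>six. lam z *\<^sub>R (q x - q z)) = 0"
      using lam_dependency by (simp add: scaleR_diff_right sum_subtractf flip: scaleR_left.sum)
    finally show ?thesis by simp
  qed
qed

end

section \<open>The expression before and after the move\<close>

lemma mdet_3:
  "mdet M [r1, r2, r3] [c1, c2, c3] =
    M r1 c1 * (M r2 c2 * M r3 c3 - M r2 c3 * M r3 c2)
    - M r1 c2 * (M r2 c1 * M r3 c3 - M r2 c3 * M r3 c1)
    + M r1 c3 * (M r2 c1 * M r3 c2 - M r2 c2 * M r3 c1)"
  by (simp add: mdet_expand_first_col remove_nth_def numeral_3_eq_3 numeral_2_eq_2 algebra_simps)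

lemma ext_prod_scale: "ext_prod (\<lambda>vs. k * f vs) g vs = k * ext_prod f g vs"
  unfolding ext_prod_def by (simp add: sum_distrib_left mult_ac)

lemma det_minor_B: "Determinant.det (minor_B X Ds Cs) = mdet (d_omega_d_L X) Ds Cs"
  unfolding minor_B_def mdet_def ..

text \<open>On deviations supported in \<open>Vs\<close> the area map is a matrix product through
  \<open>Vs\<close>, so the form picks up a square minor as a factor.\<close>

lemma area_map_wedge:
  fixes Z :: "('v::finite, 'u) placed_complex"
  assumes Vs: "distinct Vs" "set Vs \<subseteq> components Z" and len: "length Ds' = length Vs"
    and Ds': "set Ds' \<subseteq> faces Z" and vs: "\<forall>v\<in>set vs. \<forall>b. b \<notin> set Vs \<longrightarrow> v b = 0"
  shows "wedge Ds' (map (area_map Z n) vs) = mdet (d_S_d_v Z n) Ds' Vs * wedge Vs vs"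
proof (cases "length vs = length Vs")
  case True
  have fin: "finite (components Z)" unfolding components_def by simp
  have "wedge Ds' (map (area_map Z n) vs) = mdet (\<lambda>i v. area_map Z n v i) Ds' vs"
    using mdet_map[of "\<lambda>j w. w j" id Ds' "area_map Z n" vs] True len by (simp add: wedge_conv_mdet)
  also have "\<dots> = mdet (\<lambda>i v. \<Sum>c\<in>set Vs. d_S_d_v Z n i c * v c) Ds' vs"
  proof (rule mdet_cong)
    fix i v assume iv: "i \<in> set Ds'" "v \<in> set vs"
    then have "area_map Z n v i = (\<Sum>c\<in>components Z. d_S_d_v Z n i c * v c)"
      using Ds' unfolding area_map_def by auto
    also have "\<dots> = (\<Sum>c\<in>set Vs. d_S_d_v Z n i c * v c)"
      using fin Vs vs iv by (intro sum.mono_neutral_right) auto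
    finally show "area_map Z n v i = (\<Sum>c\<in>set Vs. d_S_d_v Z n i c * v c)" .
  qed
  also have "\<dots> = mdet (d_S_d_v Z n) Ds' Vs * mdet (\<lambda>c v. v c) Vs vs"
    by (rule mdet_mult) (use len True Vs in auto)
  finally show ?thesis using True by (simp add: wedge_conv_mdet)
next
  case False
  then show ?thesis using len by simp
qed

text \<open>The unit vectors of \<open>Vs\<close> have wedge 1 and thus determine the factor
  uniquely.\<close>

lemma area_form_factor_eq:
  fixes Z :: "('v::finite, 'u) placed_complex"
  assumes "distinct Vs" "set Vs \<subseteq> components Z" "length Ds' = length Vs" "set Ds' \<subseteq> faces Z"
  shows "area_form_factor Z n Ds' Vs = mdet (d_S_d_v Z n) Ds' Vs"
  unfolding area_form_factor_def
proof (rule the_equality)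
  show "\<forall>vs. (\<forall>v\<in>set vs. \<forall>b. b \<notin> set Vs \<longrightarrow> v b = 0) \<longrightarrow>
      wedge Ds' (map (area_map Z n) vs) = mdet (d_S_d_v Z n) Ds' Vs * wedge Vs vs"
    using area_map_wedge[OF assms] by blast
next
  fix k
  assume k: "\<forall>vs. (\<forall>v\<in>set vs. \<forall>b. b \<notin> set Vs \<longrightarrow> v b = 0) \<longrightarrow>
      wedge Ds' (map (area_map Z n) vs) = k * wedge Vs vs"
  let ?vs = "map (\<lambda>c b. if b = c then 1 else 0 :: real) Vs"
  have supp: "\<forall>v\<in>set ?vs. \<forall>b. b \<notin> set Vs \<longrightarrow> v b = 0" by auto
  have "wedge Vs ?vs = mdet (\<lambda>r c. if r = c then 1 else 0) Vs Vs"
    using mdet_map[of "\<lambda>j w. w j" id Vs "\<lambda>c b. if b = c then 1 else 0 :: real" Vs]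
    by (simp add: wedge_conv_mdet)
  then have 1: "wedge Vs ?vs = 1" using assms(1) by simp
  have "k * wedge Vs ?vs = mdet (d_S_d_v Z n) Ds' Vs * wedge Vs ?vs"
    using k[THEN spec, THEN mp, OF supp] area_map_wedge[OF assms supp, of n] by metis
  then show "k = mdet (d_S_d_v Z n) Ds' Vs" unfolding 1 by simp
qed

lemma admissible_mdet:
  assumes "admissible Z Cs Cs' Ds Ds'"
  shows "distinct (Cs @ Cs')" "set (Cs @ Cs') = edges Z" "distinct (Ds @ Ds')" "set (Ds @ Ds') = faces Z"
    "length Ds = length Cs" "mdet (d_omega_d_L Z) Ds Cs \<noteq> 0"
    "spans_cols (d_omega_d_L Z) (faces Z) (edges Z) Cs"
proof -
  show 1: "distinct (Cs @ Cs')" "set (Cs @ Cs') = edges Z" "distinct (Ds @ Ds')" "set (Ds @ Ds') = faces Z"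
    "length Ds = length Cs" "mdet (d_omega_d_L Z) Ds Cs \<noteq> 0"
    using assms unfolding admissible_def det_minor_B by blast+
  have "length Cs = vec_space.rank (length (Ds @ Ds')) (minor_B Z (Ds @ Ds') (Cs @ Cs'))"
    using assms unfolding admissible_def by blast
  then show "spans_cols (d_omega_d_L Z) (faces Z) (edges Z) Cs"
    unfolding 1(2,4)[symmetric] minor_B_def by (intro rank_spans_cols 1)
qed

context placed_move
begin

lemma lift_Y_face: "i \<in> faces X \<Longrightarrow> lift Y i = lift X i"
  using removed_card[of i] unfolding faces_def by (intro lift_Y_old) auto

lemma d_S_d_v_old: "i \<in> faces X \<Longrightarrow> d_S_d_v Y n i c = d_S_d_v X n i c"
  unfolding d_S_d_v_def generated_dS_def proj_Y place_Y by (simp add: lift_Y_face)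

lemma face_area_old: "i \<in> faces X \<Longrightarrow> face_area Y i = face_area X i"
  unfolding face_area_def place_Y by (simp add: lift_Y_face)

text \<open>A face of \<open>X\<close> cannot contain both \<open>A\<close> and \<open>B\<close>, so
  the deviation of \<open>AB\<close> moves none of its edge midpoints.\<close>

lemma d_S_d_v_old_new:
  assumes "i \<in> faces X"
  shows "d_S_d_v Y n i ({A, B}, k) = 0"
proof -
  have i: "i \<in> simplices X" using assms unfolding faces_def by simp
  obtain x y z where xyz: "i = {x, y, z}" "x \<noteq> y" "x \<noteq> z" "y \<noteq> z"
    using assms unfolding faces_def card_3_iff by blast
  have cov: "section_of i ` i \<in> cover X" using lift_X[OF i] unfolding section_of[OF i] by simp
  have "models Y (section_of i) i"
    by (rule models_subset[OF i cov section_of(2)[OF i]])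
      (use xyz lift_Y_face[OF assms] place_Y proj_Y in auto)
  moreover have "\<not> {A, B} \<subseteq> i" using i AB_subset by blast
  ultimately show ?thesis
    using d_S_d_v_models_other[of Y "section_of i" x y z "{A, B}" n k] xyz by auto
qed

text \<open>The row of the face \<open>{A, B, w}\<close> is -L / (2 S) times the components of
  \<open>q w - q A\<close> in the frame, where L is the squared length of \<open>AB\<close> and S
  the area. The determinant of the components is, up to sign, \<open>lam C / norm u\<close>, since
  \<open>C\<close> is the vertex missing from \<open>A, B, D, E, F\<close>. With L^3 =
  \<open>norm u ^ 6\<close> this leaves the fifth power of the length and the 8 in the
  denominator.\<close>

lemma new_block:
  "\<bar>mdet (d_S_d_v Y n) [{A, B, D}, {A, B, E}, {A, B, F}] [({A, B}, 0), ({A, B}, 1), ({A, B}, 2)]\<bar> =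
    sq_length Y {A, B} powr (5/2) * \<bar>lam C\<bar> /
      (8 * (face_area Y {A, B, D} * face_area Y {A, B, E} * face_area Y {A, B, F}))"
proof -
  have six: "A \<in> six" "B \<in> six" "C \<in> six" "D \<in> six" "E \<in> six" "F \<in> six" unfolding six_def by auto
  define m where "m = n (\<sigma> ` {A, B})"
  define u where "u = q B - q A"
  define S where "S w = face_area Y {A, B, w}" for w
  note fr = edge_frame_six[OF six(1,2) neq(1), folded m_def]
  have S: "S w > 0" if "w \<in> {D, E, F}" for w
    unfolding S_def using that neq six by (subst face_area_six) (auto intro!: face_area_pos)
  have entry: "d_S_d_v Y n {A, B, w} ({A, B}, k) = - ((norm u)\<^sup>2 / (2 * S w)) * ((q w - q A) \<bullet> m k)"
    if "w \<in> {D, E, F}" "k < 3" for w k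
  proof -
    have "d_S_d_v Y n {A, B, w} ({A, B}, k) =
        (dist (q A) (q B))\<^sup>2 * ((q A - q w) \<bullet> m k) / (2 * S w)"
      unfolding S_def m_def using that neq six by (intro d_S_d_v_six) auto
    moreover have "(q A - q w) \<bullet> m k = - ((q w - q A) \<bullet> m k)" by (simp add: inner_diff_left)
    ultimately show ?thesis by (simp add: u_def dist_norm norm_minus_commute)
  qed
  have u0: "u \<noteq> 0" using q_inj six neq(1) unfolding u_def inj_on_def by auto
  have perp: "u \<bullet> m k = 0" if "k < 3" for k
    using fr(2)[OF that] unfolding u_def by (simp add: inner_diff_left)
  define d where "d = ((q D - q A) \<bullet> m 0) * (((q E - q A) \<bullet> m 1) * ((q F - q A) \<bullet> m 2) - ((q E - q A) \<bullet> m 2) * ((q F - q A) \<bullet> m 1))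
     - ((q D - q A) \<bullet> m 1) * (((q E - q A) \<bullet> m 0) * ((q F - q A) \<bullet> m 2) - ((q E - q A) \<bullet> m 2) * ((q F - q A) \<bullet> m 0))
     + ((q D - q A) \<bullet> m 2) * (((q E - q A) \<bullet> m 0) * ((q F - q A) \<bullet> m 1) - ((q E - q A) \<bullet> m 1) * ((q F - q A) \<bullet> m 0))"
  have "\<bar>lam C\<bar> = \<bar>orvol_list q [A, B, D, E, F]\<bar>"
    by (rule lam_abs[OF six(3)]) (use neq in \<open>auto simp: six_def\<close>)
  also have "\<dots> = \<bar>det4 u (q D - q A) (q E - q A) (q F - q A)\<bar>"
    by (simp add: orvol_list_def orvol_def u_def numeral_eq_Suc)
  also have "\<dots> = norm u * \<bar>d\<bar>"
    unfolding d_def by (rule det4_orthonormal[OF fr(1) perp u0])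
  finally have lamC: "\<bar>lam C\<bar> = norm u * \<bar>d\<bar>" .
  have "mdet (d_S_d_v Y n) [{A, B, D}, {A, B, E}, {A, B, F}] [({A, B}, 0), ({A, B}, 1), ({A, B}, 2)] =
      - ((norm u)\<^sup>2 / (2 * S D)) * - ((norm u)\<^sup>2 / (2 * S E)) * - ((norm u)\<^sup>2 / (2 * S F)) * d"
  proof -
    define p where "p w k = (q w - q A) \<bullet> m k" for w k
    define sc where "sc w = - ((norm u)\<^sup>2 / (2 * S w))" for w
    have entry': "d_S_d_v Y n {A, B, w} ({A, B}, k) = sc w * p w k"
      if "w = D \<or> w = E \<or> w = F" "k = 0 \<or> k = 1 \<or> k = 2" for w k
      unfolding p_def sc_def by (rule entry) (use that in auto)
    show ?thesis
      unfolding mdet_3 d_def p_def[symmetric] sc_def[symmetric]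
      by (simp only: entry' simp_thms) (simp add: algebra_simps)
  qed
  also have "\<bar>\<dots>\<bar> = (norm u)\<^sup>2 / (2 * S D) * ((norm u)\<^sup>2 / (2 * S E)) * ((norm u)\<^sup>2 / (2 * S F)) * \<bar>d\<bar>"
    using S[of D] S[of E] S[of F] by (simp add: abs_mult)
  also have "\<dots> = (norm u) ^ 5 * \<bar>lam C\<bar> / (8 * (S D * S E * S F))"
    unfolding lamC by (simp add: eval_nat_numeral)
  also have "(norm u) ^ 5 = sq_length Y {A, B} powr (5/2)"
  proof -
    have "sq_length Y {A, B} = (norm u)\<^sup>2"
      using sq_length_Y[OF six(1,2) neq(1)] by (simp add: u_def dist_norm norm_minus_commute)
    then have "sq_length Y {A, B} = norm u powr 2" using u0 by simp
    moreover have "norm u ^ 5 = norm u powr 5" using u0 by simp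
    moreover have "norm u powr 5 = (norm u powr 2) powr (5/2)" by (simp only: powr_powr) simp
    ultimately show ?thesis by (simp only:)
  qed
  finally show ?thesis unfolding S_def .
qed

lemma area_product:
  "(\<Prod>i\<in>faces Y. face_area Y i) = (\<Prod>i\<in>faces X. face_area X i) *
    (face_area Y {A, B, C} * (face_area Y {A, B, D} * face_area Y {A, B, E} * face_area Y {A, B, F}))"
proof -
  have "(\<Prod>i\<in>faces Y. face_area Y i) = (\<Prod>i\<in>faces X. face_area Y i) *
      (\<Prod>i\<in>set [{A, B, C}, {A, B, D}, {A, B, E}, {A, B, F}]. face_area Y i)"
    unfolding faces_Y(1) by (rule prod.union_disjoint) (use faces_Y(2) in auto)
  moreover have "(\<Prod>i\<in>set [{A, B, C}, {A, B, D}, {A, B, E}, {A, B, F}]. face_area Y i) =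
      face_area Y {A, B, C} * (face_area Y {A, B, D} * face_area Y {A, B, E} * face_area Y {A, B, F})"
    using prod.distinct_set_conv_list[OF faces_Y(3), of "face_area Y"] by (simp add: mult_ac)
  moreover have "(\<Prod>i\<in>faces X. face_area Y i) = (\<Prod>i\<in>faces X. face_area X i)"
    by (rule prod.cong) (auto simp: face_area_old)
  ultimately show ?thesis by simp
qed

lemma volume_products:
  obtains V where
    "(\<Prod>s\<in>four_simplices Y. simplex_volume Y s) =
       V * (\<bar>lam C\<bar> / 24 * (\<bar>lam D\<bar> / 24) * (\<bar>lam E\<bar> / 24) * (\<bar>lam F\<bar> / 24))"
    "(\<Prod>s\<in>four_simplices X. simplex_volume X s) = V * (\<bar>lam A\<bar> / 24 * (\<bar>lam B\<bar> / 24))"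
proof -
  let ?c = "four_simplices X \<inter> four_simplices Y"
  have injsix: "inj_on (\<lambda>w. six - {w}) six" by (rule inj_onI) blast
  have injR: "inj_on (\<lambda>w. six - {w}) R" and injAB: "inj_on (\<lambda>w. six - {w}) {A, B}"
    by (rule inj_on_subset[OF injsix], simp add: six_R, blast?)+
  have "(\<Prod>s\<in>four_simplices Y. simplex_volume Y s) =
      (\<Prod>s\<in>?c \<union> (\<lambda>w. six - {w}) ` R. simplex_volume Y s)"
    unfolding four_simplices_Y[symmetric] ..
  also have "\<dots> = (\<Prod>s\<in>?c. simplex_volume Y s) * (\<Prod>s\<in>(\<lambda>w. six - {w}) ` R. simplex_volume Y s)"
    using four_simplices_disjoint(2) by (intro prod.union_disjoint) auto
  also have "(\<Prod>s\<in>?c. simplex_volume Y s) = (\<Prod>s\<in>?c. simplex_volume X s)"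
  proof (rule prod.cong[OF refl])
    fix s assume "s \<in> ?c"
    then have s: "s \<in> simplices X" "s \<in> simplices Y" unfolding four_simplices_def by auto
    then have rem: "s \<notin> removed_simplices A B R"
      using AB_subset unfolding simplices_Y Un_iff Diff_iff added_iff by blast
    show "simplex_volume Y s = simplex_volume X s"
      unfolding simplex_volume_def place_Y lift_Y_old[OF s(1) rem] ..
  qed
  also have "(\<Prod>s\<in>(\<lambda>w. six - {w}) ` R. simplex_volume Y s) = (\<Prod>w\<in>R. \<bar>lam w\<bar> / 24)"
    by (subst prod.reindex[OF injR]) (simp add: simplex_volume_cluster)
  also have "\<dots> = \<bar>lam C\<bar> / 24 * (\<bar>lam D\<bar> / 24) * (\<bar>lam E\<bar> / 24) * (\<bar>lam F\<bar> / 24)"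
    unfolding R_def using neq by simp
  finally have Yv: "(\<Prod>s\<in>four_simplices Y. simplex_volume Y s) = (\<Prod>s\<in>?c. simplex_volume X s) *
      (\<bar>lam C\<bar> / 24 * (\<bar>lam D\<bar> / 24) * (\<bar>lam E\<bar> / 24) * (\<bar>lam F\<bar> / 24))" .
  have "(\<Prod>s\<in>four_simplices X. simplex_volume X s) =
      (\<Prod>s\<in>?c \<union> (\<lambda>w. six - {w}) ` {A, B}. simplex_volume X s)"
    unfolding four_simplices_X[symmetric] ..
  also have "\<dots> = (\<Prod>s\<in>?c. simplex_volume X s) * (\<Prod>s\<in>(\<lambda>w. six - {w}) ` {A, B}. simplex_volume X s)"
    using four_simplices_disjoint(1) by (intro prod.union_disjoint) auto
  also have "(\<Prod>s\<in>(\<lambda>w. six - {w}) ` {A, B}. simplex_volume X s) = (\<Prod>w\<in>{A, B}. \<bar>lam w\<bar> / 24)"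
    by (subst prod.reindex[OF injAB]) (auto simp: simplex_volume_cluster intro!: prod.cong)
  also have "\<dots> = \<bar>lam A\<bar> / 24 * (\<bar>lam B\<bar> / 24)" using neq by simp
  finally show thesis using that Yv by blast
qed

text \<open>The basis condition in matrix form. The count follows from
  \<open>left_kernel_basis_length\<close> and makes the minor that gives
  \<open>area_form_factor\<close> square.\<close>

lemma column_basis_old:
  assumes basis: "column_basis X n Vs" and adm: "admissible X Cs Cs' Ds Ds'"
  shows "\<And>a c. a \<in> edges X \<Longrightarrow> c \<in> set Vs \<Longrightarrow>
      (\<Sum>i\<in>faces X. d_omega_d_L X i a * d_S_d_v X n i c) = 0"
    and "length Vs = length Ds'"
proof -
  \<comment> \<open>Kernel vectors vanish off the faces, so the matrix is cut off there too.\<close>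
  define P where "P i c = (if i \<in> faces X then d_S_d_v X n i c else 0)" for i c
  have Vs: "distinct Vs" "set Vs \<subseteq> components X"
    and col: "\<And>c. c \<in> set Vs \<Longrightarrow> area_map X n (\<lambda>b. if b = c then 1 else 0) \<in> ker_Omega_S X"
    and ex: "\<And>s. s \<in> ker_Omega_S X \<Longrightarrow> \<exists>!v. (\<forall>b. b \<notin> set Vs \<longrightarrow> v b = 0) \<and> s = area_map X n v"
    using basis unfolding column_basis_def by blast+
  have fin: "finite (components X)" unfolding components_def by simp
  have map: "area_map X n v = (\<lambda>i. \<Sum>c\<in>set Vs. P i c * v c)" if v: "\<forall>b. b \<notin> set Vs \<longrightarrow> v b = 0" for v
  proof
    fix i
    have "(\<Sum>c\<in>components X. d_S_d_v X n i c * v c) = (\<Sum>c\<in>set Vs. d_S_d_v X n i c * v c)"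
      using fin Vs v by (intro sum.mono_neutral_right) auto
    then show "area_map X n v i = (\<Sum>c\<in>set Vs. P i c * v c)"
      unfolding area_map_def P_def by simp
  qed
  have PK: "(\<lambda>i. P i c) \<in> ker_Omega_S X" if "c \<in> set Vs" for c
  proof -
    have "area_map X n (\<lambda>b. if b = c then 1 else 0) = (\<lambda>i. P i c)"
      using that by (subst map) (auto simp: if_distrib cong: if_cong)
    then show ?thesis using col[OF that] by simp
  qed
  show "(\<Sum>i\<in>faces X. d_omega_d_L X i a * d_S_d_v X n i c) = 0" if "a \<in> edges X" "c \<in> set Vs" for a c
    using PK[OF that(2)] that(1) unfolding ker_Omega_S_def d_Omega_d_S_def P_def by simp
  note a = admissible_mdet[OF adm]
  show "length Vs = length Ds'"
  proof (rule left_kernel_basis_length[where M = "d_omega_d_L X" and P = P and K = "ker_Omega_S X"])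
    show "ker_Omega_S X = {s. (\<forall>i. i \<notin> faces X \<longrightarrow> s i = 0) \<and>
        (\<forall>a\<in>edges X. (\<Sum>i\<in>faces X. d_omega_d_L X i a * s i) = 0)}"
      unfolding ker_Omega_S_def d_Omega_d_S_def ..
    show "\<exists>!v. (\<forall>b. b \<notin> set Vs \<longrightarrow> v b = 0) \<and> s = (\<lambda>i. \<Sum>c\<in>set Vs. P i c * v c)"
      if "s \<in> ker_Omega_S X" for s
    proof -
      have "((\<forall>b. b \<notin> set Vs \<longrightarrow> v b = 0) \<and> s = area_map X n v) =
          ((\<forall>b. b \<notin> set Vs \<longrightarrow> v b = 0) \<and> s = (\<lambda>i. \<Sum>c\<in>set Vs. P i c * v c))" for v
        by (rule conj_cong[OF refl]) (simp only: map)
      then show ?thesis using ex[OF that] by simp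
    qed
    show "distinct Cs" "set Cs \<subseteq> edges X" using a by auto
  qed (use a Vs PK in auto)
qed

lemma expression_move:
  assumes basis: "column_basis X n Vs" and adm: "admissible X Cs Cs' Ds Ds'"
    and adm2: "admissible Y Cs2 Cs2' Ds2 Ds2'"
  shows "\<exists>\<epsilon>\<in>{1, -1 :: real}. \<forall>ws vs. set ws \<subseteq> ker_omega_L Y \<longrightarrow>
           expression Y n Cs2 Cs2' Ds2 Ds2' (Vs @ [({A, B}, 0), ({A, B}, 1), ({A, B}, 2)]) ws vs =
           \<epsilon> * 72 * sq_length Y {A, B} powr (5/2) *
           ext_prod (expression X n Cs Cs' Ds Ds' Vs (map (forget_edge {A, B}) ws))
                    (wedge [({A, B}, 0), ({A, B}, 1), ({A, B}, 2)]) vs"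
proof -
  let ?new = "[({A, B}, 0), ({A, B}, 1), ({A, B}, 2)] :: ('v set \<times> nat) list"
  let ?fs = "[{A, B, D}, {A, B, E}, {A, B, F}]"
  have Vs: "distinct Vs" "set Vs \<subseteq> components X" using basis unfolding column_basis_def by blast+
  have six: "A \<in> six" "B \<in> six" "C \<in> six" "D \<in> six" "E \<in> six" "F \<in> six" unfolding six_def by auto
  have lam0: "lam A \<noteq> 0" "lam B \<noteq> 0" "lam C \<noteq> 0" "lam D \<noteq> 0" "lam E \<noteq> 0" "lam F \<noteq> 0"
    using lam_nonzero six by auto
  have Spos: "face_area Y {A, B, w} > 0" if "w \<in> R" for w
  proof -
    have "{A, B, w} \<subseteq> six" "distinct [A, B, w]" using that six_R A_R neq(1) by auto
    then show ?thesis using face_area_six face_area_pos by simp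
  qed
  have sixABC: "six - {A, B, C} = {D, E, F}" unfolding six_def using neq by auto
  have fw: "face_weight {A, B, C} = - face_area Y {A, B, C} / (lam D * lam E * lam F)"
    unfolding face_weight_def sixABC using six neq by simp
  have ew: "edge_weight {A, B} = lam A * lam B" unfolding edge_weight_def using neq by simp
  have comp: "set (Vs @ ?new) \<subseteq> components Y" "distinct (Vs @ ?new)"
    using Vs edges_Y unfolding components_def by auto
  note a = admissible_mdet[OF adm] and a2 = admissible_mdet[OF adm2]
  interpret rank_one_extension "d_omega_d_L X" "d_omega_d_L Y" "d_S_d_v X n" "d_S_d_v Y n"
    "faces X" "faces Y" "edges X" "edges Y" "{A, B, C}" ?fs "{A, B}" face_weight edge_weight Vs ?new
    Cs Cs' Cs2 Cs2' Ds Ds' Ds2 Ds2'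
  proof
    show "edges Y = insert {A, B} (edges X)" "{A, B} \<notin> edges X" by (rule edges_Y)+
    show "faces Y = faces X \<union> set ({A, B, C} # ?fs)" "faces X \<inter> set ({A, B, C} # ?fs) = {}"
      "distinct ({A, B, C} # ?fs)" by (rule faces_Y)+
    show "d_omega_d_L Y i e = d_omega_d_L X i e + face_weight i * edge_weight e"
      if "i \<in> faces X" "e \<in> edges X" for i e
      using d_omega_d_L_Y[of i e] that faces_Y(1) edges_Y(1) by auto
    show "d_omega_d_L Y i e = face_weight i * edge_weight e"
      if "i \<in> faces Y" "e \<in> edges Y" "i \<notin> faces X \<or> e = {A, B}" for i e
      using d_omega_d_L_Y[OF that(1,2)] that(3) edges_Y(2) by auto
    show "face_weight {A, B, C} \<noteq> 0" "edge_weight {A, B} \<noteq> 0"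
      unfolding fw ew using lam0 Spos[of C] by (auto simp: R_def)
    show "length ?new = length ?fs" by simp
    show "d_S_d_v Y n i c = d_S_d_v X n i c" if "i \<in> faces X" for i c by (rule d_S_d_v_old[OF that])
    show "d_S_d_v Y n i c = 0" if "i \<in> faces X" "c \<in> set ?new" for i c
      using that d_S_d_v_old_new by auto
    show "(\<Sum>i\<in>faces Y. face_weight i * d_S_d_v Y n i c) = 0" if "c \<in> set (Vs @ ?new)" for c
      using that comp by (intro face_weight_d_S_d_v) blast
    show "(\<Sum>i\<in>faces X. d_omega_d_L X i e * d_S_d_v X n i c) = 0" if "e \<in> edges X" "c \<in> set Vs" for e c
      by (rule column_basis_old(1)[OF basis adm that])
    show "length Vs = length Ds'" by (rule column_basis_old(2)[OF basis adm])
  qed (use a a2 in blast)+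
  obtain e :: real where e: "e \<in> {1, -1}"
    "\<forall>(W :: 'v set \<Rightarrow> ('v set \<Rightarrow> real) \<Rightarrow> real) N. length N = length Cs' \<longrightarrow>
     (\<forall>i\<in>faces Y. \<forall>n\<in>set N. (\<Sum>a\<in>edges Y. d_omega_d_L Y i a * W a n) = 0) \<longrightarrow>
     mdet W Cs2' N * mdet (d_S_d_v Y n) Ds2' (Vs @ ?new) / mdet (d_omega_d_L Y) Ds2 Cs2 =
     e * (mdet W Cs' N * (mdet (d_S_d_v X n) Ds' Vs * mdet (d_S_d_v Y n) ?fs ?new)
       / (mdet (d_omega_d_L X) Ds Cs * (face_weight {A, B, C} * edge_weight {A, B})))"
    using mdet_extension by blast
  obtain V where V: "(\<Prod>s\<in>four_simplices Y. simplex_volume Y s) =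
       V * (\<bar>lam C\<bar> / 24 * (\<bar>lam D\<bar> / 24) * (\<bar>lam E\<bar> / 24) * (\<bar>lam F\<bar> / 24))"
    "(\<Prod>s\<in>four_simplices X. simplex_volume X s) = V * (\<bar>lam A\<bar> / 24 * (\<bar>lam B\<bar> / 24))"
    using volume_products by blast
  define SX where "SX = (\<Prod>i\<in>faces X. face_area X i)"
  define SC where "SC = face_area Y {A, B, C}"
  define S3 where "S3 = face_area Y {A, B, D} * face_area Y {A, B, E} * face_area Y {A, B, F}"
  define L where "L = sq_length Y {A, B} powr (5/2)"
  define d3 where "d3 = mdet (d_S_d_v Y n) ?fs ?new"
  have pos: "SC > 0" "S3 > 0" unfolding SC_def S3_def using Spos by (simp_all add: R_def)
  have d3: "\<bar>d3\<bar> = L * \<bar>lam C\<bar> / (8 * S3)"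
    unfolding d3_def L_def S3_def by (rule new_block)
  \<comment> \<open>Everything that the move multiplies in, apart from the sign \<open>e\<close>.
    The areas and all values of \<open>lam\<close> cancel in absolute value, leaving 24^4 / 24^2 / 8
    = 72 times \<open>L\<close>.\<close>
  define r where "r = SC * S3 / (\<bar>lam C\<bar> / 24 * (\<bar>lam D\<bar> / 24) * (\<bar>lam E\<bar> / 24) * (\<bar>lam F\<bar> / 24))
    * (\<bar>lam A\<bar> / 24 * (\<bar>lam B\<bar> / 24)) * d3 / (face_weight {A, B, C} * edge_weight {A, B})"
  have "\<bar>r\<bar> = 72 * L"
    unfolding r_def fw ew SC_def[symmetric] abs_mult abs_divide d3 abs_minus_cancel abs_abs
    using pos lam0 by (simp add: abs_mult field_simps)
  then obtain e' where e': "e' \<in> {1, -1 :: real}" "r = e' * (72 * L)"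
    by (metis abs_eq_iff' insertI1 insertI2 mult_1 mult_minus1)
  have "e * e' \<in> {1, -1}" using e(1) e'(1) by auto
  then show ?thesis
  proof (rule bexI[rotated], intro allI impI)
    fix ws vs
    assume ws: "set ws \<subseteq> ker_omega_L Y"
    \<comment> \<open>The edge \<open>AB\<close> is not among the coordinates \<open>Cs'\<close>, so
      forgetting its component does not change the wedge.\<close>
    have ABC: "{A, B} \<notin> set Cs'" using a(2) edges_Y(2) by auto
    have affY: "area_form_factor Y n Ds2' (Vs @ ?new) = mdet (d_S_d_v Y n) Ds2' (Vs @ ?new)"
      by (rule area_form_factor_eq) (use comp length_D2' a2 in auto)
    have affX: "area_form_factor X n Ds' Vs = mdet (d_S_d_v X n) Ds' Vs"
      by (rule area_form_factor_eq) (use Vs length_Vs a in auto)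
    define cX where "cX = mdet (d_S_d_v X n) Ds' Vs"
    define dX where "dX = mdet (d_omega_d_L X) Ds Cs"
    define k where "k = face_weight {A, B, C} * edge_weight {A, B}"
    define wX where "wX = wedge Cs' (map (forget_edge {A, B}) ws)"
    define om where "om = wedge (Vs @ ?new) vs"
    have form: "wedge Cs2' ws * area_form_factor Y n Ds2' (Vs @ ?new) / Determinant.det (minor_B Y Ds2 Cs2) =
        e * (wX * (cX * d3) / (dX * k))"
    \<comment> \<open>\<open>mdet_extension\<close> takes as many vectors as there are coordinates;
      for any other number both forms are 0.\<close>
    proof (cases "length ws = length Cs'")
      case True
      have ker: "\<forall>i\<in>faces Y. \<forall>w\<in>set ws. (\<Sum>a\<in>edges Y. d_omega_d_L Y i a * w a) = 0"
        using ws unfolding ker_omega_L_def by blast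
      have "mdet (\<lambda>a w. w a) Cs2' ws * mdet (d_S_d_v Y n) Ds2' (Vs @ ?new) / mdet (d_omega_d_L Y) Ds2 Cs2 =
          e * (mdet (\<lambda>a w. w a) Cs' ws * (cX * d3) / (dX * k))"
        unfolding cX_def d3_def dX_def k_def
        by (rule e(2)[THEN spec[of _ "\<lambda>a w. w a"], THEN spec[of _ ws], THEN mp, OF True, THEN mp])
          (rule ker)
      moreover have "mdet (\<lambda>a w. w a) Cs' ws = wX"
      proof -
        have "wX = mdet (\<lambda>a w. forget_edge {A, B} w a) Cs' ws"
          using mdet_map[of "\<lambda>a w. w a" id Cs' "forget_edge {A, B}" ws] True
          unfolding wX_def by (simp add: wedge_conv_mdet)
        also have "\<dots> = mdet (\<lambda>a w. w a) Cs' ws"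
          by (rule mdet_cong) (use ABC in \<open>auto simp: forget_edge_def\<close>)
        finally show ?thesis by simp
      qed
      ultimately show ?thesis
        unfolding affY det_minor_B using True length_C2' by (simp add: wedge_conv_mdet)
    next
      case False
      then have "wedge Cs2' ws = 0" "wX = 0" unfolding wX_def using length_C2' by simp_all
      then show ?thesis by simp
    qed
    have "expression Y n Cs2 Cs2' Ds2 Ds2' (Vs @ ?new) ws vs =
        SX * (SC * S3) / (V * (\<bar>lam C\<bar> / 24 * (\<bar>lam D\<bar> / 24) * (\<bar>lam E\<bar> / 24) * (\<bar>lam F\<bar> / 24))) *
        (wedge Cs2' ws * area_form_factor Y n Ds2' (Vs @ ?new) / Determinant.det (minor_B Y Ds2 Cs2)) * om"
      unfolding expression_def area_product V(1) SX_def SC_def S3_def om_def by simp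
    \<comment> \<open>No bound on \<open>V\<close> is at hand: for \<open>V = 0\<close> both sides
      would be 0 by the convention for division.\<close>
    also have "\<dots> = e * r * (SX / (V * (\<bar>lam A\<bar> / 24 * (\<bar>lam B\<bar> / 24))) * wX * cX / dX * om)"
      unfolding form r_def k_def[symmetric] using lam0 by (simp add: divide_simps)
    also have "SX / (V * (\<bar>lam A\<bar> / 24 * (\<bar>lam B\<bar> / 24))) * wX * cX / dX * om =
        ext_prod (expression X n Cs Cs' Ds Ds' Vs (map (forget_edge {A, B}) ws)) (wedge ?new) vs"
    proof -
      have "expression X n Cs Cs' Ds Ds' Vs (map (forget_edge {A, B}) ws) =
          (\<lambda>vs. SX / (V * (\<bar>lam A\<bar> / 24 * (\<bar>lam B\<bar> / 24))) * wX * cX / dX * wedge Vs vs)"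
        unfolding expression_def V(2) SX_def wX_def cX_def dX_def affX det_minor_B by (rule ext) simp
      then show ?thesis unfolding om_def by (simp only: ext_prod_scale ext_prod_wedge)
    qed
    finally show "expression Y n Cs2 Cs2' Ds2 Ds2' (Vs @ ?new) ws vs =
           e * e' * 72 * sq_length Y {A, B} powr (5/2) *
           ext_prod (expression X n Cs Cs' Ds Ds' Vs (map (forget_edge {A, B}) ws)) (wedge ?new) vs"
      unfolding e'(2) L_def by simp
  qed
qed

end

theorem theorem3:
  fixes X Y :: "('v::finite, 'u) placed_complex"
    and \<rho> :: "('u \<Rightarrow> 'u) \<Rightarrow> real^4 \<Rightarrow> real^4"
    and n :: "'u set \<Rightarrow> nat \<Rightarrow> real^4"
    and A B C D E F :: 'v
    and Cs Cs' Ds Ds' Cs2 Cs2' Ds2 Ds2' :: "'v set list"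
    and Vs :: "('v set \<times> nat) list"
  assumes "abstract_complex (simplices X)"
    and "closed_pl_4manifold (realization (simplices X))"
    and "connected (realization (simplices X))"
    and "orientation (simplices X) (orient X)"
    and "universal_cover X"
    and "equivariant_placement X \<rho>"
    and "move_2_4 X A B C D E F Y"
    and "nondegenerate X" and "nondegenerate Y"
    and "edge_frame Y \<rho> n"
    and "ker_Omega_S X \<subseteq> range (area_map X n)"
    and "column_basis X n Vs"
    and "admissible X Cs Cs' Ds Ds'"
    and "admissible Y Cs2 Cs2' Ds2 Ds2'"
  shows "\<exists>\<epsilon>\<in>{1, -1 :: real}. \<forall>ws vs. set ws \<subseteq> ker_omega_L Y \<longrightarrow>
           expression Y n Cs2 Cs2' Ds2 Ds2' (Vs @ [({A, B}, 0), ({A, B}, 1), ({A, B}, 2)]) ws vs =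
           \<epsilon> * 72 * sq_length Y {A, B} powr (5/2) *
           ext_prod (expression X n Cs Cs' Ds Ds' Vs (map (forget_edge {A, B}) ws))
                    (wedge [({A, B}, 0), ({A, B}, 1), ({A, B}, 2)]) vs"
proof -
  interpret placed_move X \<rho> Y A B C D E F n
    by unfold_locales (fact assms)+
  show ?thesis by (rule expression_move) (fact assms)+
qed

end
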